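(* Let $K$ be a compact non-polar subset of $[-1,1]$ and let $w(x)=\sqrt{1-x}$. Then: (i) For each $n\in\mathbb N$, $W_{\infty,n}(K,w)\geq 2\sqrt{\mathrm{Cap}(K)}$, with equality if and only if there exists a polynomial $S_n$ of degree $n$ such that $K=\{z\in\mathbb C:(1-z)S_n^2(z)\in[0,1]\}$. (ii) If in addition $K$ is a regular Parreau–Widom set, then for each $n\in\mathbb N$, $$W_{\infty,n}(K,w)\leq 2\sqrt{\mathrm{Cap}(K)}\,e^{\frac12 g_K(1)+\mathrm{PW}(K)},$$ with equality if and only if $K=[a,1]$ for some $a\in[-1,1)$.
   Context: $\mathrm{Cap}(K)$ denotes logarithmic capacity; $\mu_K$ the equilibrium measure. The Green function is $g_K(z)=-\log\mathrm{Cap}(K)+\int\log|z-\zeta|\,d\mu_K(\zeta)$. Regular means regular for the Dirichlet problem. For a weight $w$ (non-negative, continuous on $K$, positive on a non-polar subset), $T^{(K)}_{n,w}$ is the monic polynomial of degree $n$ minimizing $\|wP_n\|_K$ (sup-norm on $K$); $t_n(K,w)=\|wT^{(K)}_{n,w}\|_K$, and $W_{\infty,n}(K,w)=t_n(K,w)/\mathrm{Cap}(K)^n$. For regular compact $K\subset\mathbb R$ with $a=\inf K$, $b=\sup K$, write $K=[a,b]\setminus\bigcup_jI_j$ with $I_j$ the bounded components of $\mathbb R\setminus K$, and let $c_j$ be the critical point of $g_K$ in $I_j$; $\mathrm{PW}(K)=\sum_j g_K(c_j)$, and $K$ is Parreau–Widom if $\mathrm{PW}(K)<\infty$. *)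

theory Defs
  imports "HOL-Analysis.Analysis" "HOL-Computational_Algebra.Polynomial"
begin

text \<open>The logarithmic kernel log(1/|z-w|) is split into its positive part (possibly
  infinite, in particular on the diagonal) and its negative part (bounded on compacts).\<close>

definition kpos :: "complex \<Rightarrow> complex \<Rightarrow> ennreal" where
  "kpos z w = (if z = w then \<infinity> else ennreal (max 0 (- ln (cmod (z - w)))))"

definition kneg :: "complex \<Rightarrow> complex \<Rightarrow> real" where
  "kneg z w = (if z = w then 0 else max 0 (ln (cmod (z - w))))"

definition log_potential :: "complex measure \<Rightarrow> complex \<Rightarrow> ereal" where
  "log_potential \<mu> z =
     enn2ereal (\<integral>\<^sup>+ w. kpos z w \<partial>\<mu>) - ereal (\<integral> w. kneg z w \<partial>\<mu>)"

definition log_energy :: "complex measure \<Rightarrow> ereal" where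
  "log_energy \<mu> =
     enn2ereal (\<integral>\<^sup>+ z. (\<integral>\<^sup>+ w. kpos z w \<partial>\<mu>) \<partial>\<mu>)
     - ereal (\<integral> z. (\<integral> w. kneg z w \<partial>\<mu>) \<partial>\<mu>)"

definition prob_on :: "complex measure \<Rightarrow> complex set \<Rightarrow> bool" where
  "prob_on \<mu> S \<longleftrightarrow> emeasure \<mu> UNIV = 1 \<and> sets \<mu> = sets borel \<and> emeasure \<mu> (UNIV - S) = 0"

definition robin :: "complex set \<Rightarrow> ereal" where
  "robin S = (INF \<mu> \<in> {\<mu>. prob_on \<mu> S}. log_energy \<mu>)"

definition Cap :: "complex set \<Rightarrow> real" where
  "Cap S = (if robin S = \<infinity> then 0 else exp (- real_of_ereal (robin S)))"

definition equilibrium_measure :: "complex set \<Rightarrow> complex measure" where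
  "equilibrium_measure S = (SOME \<mu>. prob_on \<mu> S \<and> log_energy \<mu> = robin S)"

definition green :: "complex set \<Rightarrow> complex \<Rightarrow> ereal" where
  "green S z = ereal (- ln (Cap S)) - log_potential (equilibrium_measure S) z"

abbreviation cset :: "real set \<Rightarrow> complex set" where
  "cset K \<equiv> complex_of_real ` K"

definition greenR :: "real set \<Rightarrow> real \<Rightarrow> real" where
  "greenR K x = real_of_ereal (green (cset K) (complex_of_real x))"

text \<open>Regularity for the Dirichlet problem of a compact K in R (K = boundary of the
  unbounded complementary component): the Green function vanishes at every point of K.\<close>
definition regular_real :: "real set \<Rightarrow> bool" where
  "regular_real K \<longleftrightarrow> (\<forall>x\<in>K. green (cset K) (complex_of_real x) = 0)"

definition gaps :: "real set \<Rightarrow> real set set" where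
  "gaps K = {I \<in> components (UNIV - K). bounded I}"

definition crit_point :: "real set \<Rightarrow> real set \<Rightarrow> real" where
  "crit_point K I = (THE c. c \<in> I \<and> (greenR K has_real_derivative 0) (at c))"

definition PW :: "real set \<Rightarrow> ennreal" where
  "PW K = (\<integral>\<^sup>+ I. ennreal (greenR K (crit_point K I)) \<partial>count_space (gaps K))"

definition parreau_widom :: "real set \<Rightarrow> bool" where
  "parreau_widom K \<longleftrightarrow> PW K < \<infinity>"

definition weighted_norm :: "(real \<Rightarrow> real) \<Rightarrow> real set \<Rightarrow> complex poly \<Rightarrow> real" where
  "weighted_norm w K P = (SUP x\<in>K. w x * cmod (poly P (complex_of_real x)))"

definition cheb_t :: "real set \<Rightarrow> (real \<Rightarrow> real) \<Rightarrow> nat \<Rightarrow> real" where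
  "cheb_t K w n = (INF P \<in> {P. degree P = n \<and> lead_coeff P = 1}. weighted_norm w K P)"

definition widom_factor :: "real set \<Rightarrow> (real \<Rightarrow> real) \<Rightarrow> nat \<Rightarrow> real" where
  "widom_factor K w n = cheb_t K w n / Cap (cset K) ^ n"

end

theory Submission
  imports Defs "HOL-Probability.Probability" "HOL-Computational_Algebra.Fundamental_Theorem_Algebra"
begin

text \<open>
  All measures live on a subset of \<open>[-1, 1]\<close>, where the kernel \<open>ln (2 / \<bar>x - y\<bar>)\<close> is nonnegative and is a
  superposition of products of indicator functions of intervals; so the energy is positive definite.

  The weighted Chebyshev polynomial \<open>T\<close> alternates at \<open>n + 1\<close> points of \<open>K\<close> between \<open>M\<close> and \<open>-M\<close>, with \<open>M\<close>
  its weighted norm. Hence every value in \<open>(0, M\<^sup>2)\<close> is taken by \<open>(1 - x) T\<^sup>2\<close> at \<open>2 n + 1\<close> real points, two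
  between consecutive alternation points and one to the right of the last. Pulling back the arcsine law gives a
  probability measure \<open>\<nu>\<close> on \<open>E = {x. (1 - x) T\<^sup>2 \<in> [0, M\<^sup>2]} \<supseteq> K\<close> with constant potential on \<open>E\<close>, and
  \<open>Cap E = (M\<^sup>2 / 4) powr (1 / (2 n + 1))\<close>. Monotonicity of the capacity is the lower bound. If \<open>K\<close> misses a point of
  \<open>E\<close>, then it misses an interval contained in \<open>E\<close>, and perturbing \<open>\<nu>\<close> by the difference of two concentric arcsine
  laws there shows that the capacity of \<open>K\<close> is strictly smaller.

  For the upper bound, \<open>ln (Cap E / Cap K)\<close> is the integral of the Green function of \<open>K\<close> against \<open>\<nu>\<close>. The measure
  \<open>\<nu>\<close> gives mass at most \<open>2 / (2 n + 1)\<close> to each gap, where the Green function is strictly concave with maximum at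
  the critical point, and mass at most \<open>1 / (2 n + 1)\<close> to the interval between \<open>sup K\<close> and \<open>1\<close>, where it is
  increasing. As \<open>\<nu>\<close> has no atoms, each of these estimates is strict.
\<close>

section \<open>Energy of the logarithmic kernel on the line\<close>

text \<open>The factor 2 in the kernel shifts all potentials and energies by \<open>ln 2\<close> and
  makes them nonnegative, so Tonelli and Fatou apply at once. Positive definiteness is used as 2
  I(\<mu>, \<nu>) \<le> I(\<mu>, \<mu>) + I(\<nu>, \<nu>), which has no subtraction and stays
  meaningful for infinite energies. If \<nu> has constant potential on E, then I(m, \<nu>) =
  I(\<nu>, \<nu>) for every probability measure m on E, and this inequality alone shows that \<nu>
  minimizes the energy. The weight fits because its square is a polynomial:
  \<open>(1 - x) T^2\<close> has odd degree 2 n + 1, and the weighted problem for T becomes a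
  question about the real solutions of one polynomial equation. Each full swing from M to -M yields
  two solutions, the half swing down to the zero of the weight at 1 yields one. This is the origin
  of the exponent n + 1/2 and of the factor 1/2 in front of the Green function at 1. The potential
  of the arcsine law comes from the doubling formula of the cosine: it gives a functional equation
  with only one bounded solution.\<close>

definition log_kernel :: "real \<Rightarrow> real \<Rightarrow> ennreal" where
  "log_kernel x y = (if x = y then \<infinity> else ennreal (ln (2 / \<bar>x - y\<bar>)))"

lemma measurable_log_kernel [measurable]:
  assumes [measurable]: "f \<in> borel_measurable M" "g \<in> borel_measurable M"
  shows "(\<lambda>z. log_kernel (f z) (g z)) \<in> borel_measurable M"
  unfolding log_kernel_def by measurable

lemma nn_integral_even:
  assumes [measurable]: "f \<in> borel_measurable borel" and even: "\<And>v :: real. f (- v) = f v"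
  shows "(\<integral>\<^sup>+v. f v \<partial>lborel) = 2 * (\<integral>\<^sup>+v. f v * indicator {0<..} v \<partial>lborel)"
proof -
  have "(\<integral>\<^sup>+v. f v \<partial>lborel) = (\<integral>\<^sup>+v. f v * indicator {0<..} v + f v * indicator {..<0} v \<partial>lborel)"
  proof (rule nn_integral_cong_AE)
    show "AE v in lborel. f v = f v * indicator {0<..} v + f v * indicator {..<0} v"
      using AE_lborel_singleton[of "0::real"] by eventually_elim (auto simp: indicator_def)
  qed
  also have "\<dots> = (\<integral>\<^sup>+v. f v * indicator {0<..} v \<partial>lborel) + (\<integral>\<^sup>+v. f v * indicator {..<0} v \<partial>lborel)"
    by (intro nn_integral_add) measurable
  also have "(\<integral>\<^sup>+v. f v * indicator {..<0} v \<partial>lborel) = (\<integral>\<^sup>+v. f v * indicator {0<..} v \<partial>lborel)"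
    by (subst nn_integral_real_affine[where c = "-1" and t = 0])
       (auto simp: even indicator_def intro!: nn_integral_cong)
  finally show ?thesis by (simp add: mult_2)
qed

text \<open>Integrating the reciprocal produces the logarithm. For \<open>s\<close> at least 1 the
  domain is empty and \<open>ennreal\<close> cuts the right-hand side to 0, in agreement with the
  truncation in \<open>log_kernel\<close>.\<close>

lemma nn_integral_symmetric_reciprocal:
  fixes s :: real
  assumes "0 < s"
  shows "(\<integral>\<^sup>+v. ennreal (1 / (2 * (\<bar>v\<bar> + s))) * indicator {v. \<bar>v\<bar> + s < 1} v \<partial>lborel) = ennreal (- ln s)"
proof -
  define f where "f v = ennreal (1 / (2 * (\<bar>v\<bar> + s))) * indicator {v. \<bar>v\<bar> + s < 1} v" for v :: real
  have f_meas [measurable]: "f \<in> borel_measurable borel"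
    unfolding f_def by measurable
  have half: "(\<integral>\<^sup>+v. f v * indicator {0<..} v \<partial>lborel) = ennreal (- ln s / 2)"
  proof (cases "s < 1")
    case True
    have "(\<integral>\<^sup>+v. f v * indicator {0<..} v \<partial>lborel) =
        (\<integral>\<^sup>+v. ennreal (1 / (2 * (v + s))) * indicator {0..1 - s} v \<partial>lborel)"
    proof (rule nn_integral_cong_AE)
      have "AE v in lborel. v \<noteq> 0 \<and> v \<noteq> 1 - s"
        by (intro AE_conjI AE_lborel_singleton)
      then show "AE v in lborel. f v * indicator {0<..} v = ennreal (1 / (2 * (v + s))) * indicator {0..1 - s} v"
        by eventually_elim (auto simp: f_def indicator_def)
    qed
    also have "\<dots> = ennreal (ln ((1 - s) + s) / 2 - ln (0 + s) / 2)"
      using assms True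
      by (intro nn_integral_FTC_Icc) (auto intro!: derivative_eq_intros simp: field_simps)
    finally show ?thesis by simp
  next
    case False
    then have "f v = 0" for v by (auto simp: f_def)
    moreover have "- ln s / 2 \<le> 0" using False by simp
    ultimately show ?thesis by (simp add: ennreal_neg)
  qed
  have "(\<integral>\<^sup>+v. f v \<partial>lborel) = ennreal 2 * ennreal (- ln s / 2)"
    unfolding half[symmetric] using nn_integral_even[OF f_meas] by (simp add: f_def indicator_def)
  also have "\<dots> = ennreal (- ln s)"
    by (subst ennreal_mult'[symmetric]) auto
  finally show ?thesis by (simp add: f_def)
qed

lemma nn_integral_symmetric_reciprocal_0:
  "(\<integral>\<^sup>+v. ennreal (1 / (2 * \<bar>v\<bar>)) * indicator {v. \<bar>v\<bar> < 1} v \<partial>lborel) = (\<infinity>::ennreal)" (is "?I = _")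
proof -
  have le: "ennreal (- ln s) \<le> ?I" if "0 < s" for s
  proof -
    have "ennreal (- ln s) =
      (\<integral>\<^sup>+v. ennreal (1 / (2 * (\<bar>v\<bar> + s))) * indicator {v. \<bar>v\<bar> + s < 1} v \<partial>lborel)"
      using nn_integral_symmetric_reciprocal[OF that] by simp
    also have "\<dots> \<le> ?I"
    proof (rule nn_integral_mono_AE)
      show "AE v in lborel. ennreal (1 / (2 * (\<bar>v\<bar> + s))) * indicator {v. \<bar>v\<bar> + s < 1} v
          \<le> ennreal (1 / (2 * \<bar>v\<bar>)) * indicator {v. \<bar>v\<bar> < 1} v"
        using AE_lborel_singleton[of "0::real"]
        by eventually_elim (use that in \<open>auto simp: indicator_def intro!: ennreal_leI divide_left_mono\<close>)
    qed
    finally show ?thesis .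
  qed
  \<comment> \<open>The choice \<open>s = exp (- n)\<close> turns the lower bound
    \<open>- ln s\<close> into n.\<close>
  have "of_nat n \<le> ?I" for n :: nat
    using le[of "exp (- real n)"] by (simp add: ennreal_of_nat_eq_real_of_nat)
  then have "\<not> (\<exists>n. ?I < of_nat n)"
    by (simp add: not_less)
  then have "\<not> ?I < \<top>"
    using ennreal_Ex_less_of_nat by blast
  then show ?thesis
    by (simp add: less_top[symmetric])
qed

text \<open>The sets \<open>slot p\<close> are intervals, so integrating the product of their indicators over \<open>p\<close>
  writes the kernel as a superposition of rank-one kernels; this makes it positive definite.\<close>

definition slot :: "real \<times> real \<Rightarrow> real set" where
  "slot = (\<lambda>(u, q). {x. 0 < q \<and> \<bar>x - u\<bar> < 1 \<and> 2 * q * \<bar>x - u\<bar> < 1})"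

lemma measurable_slot [measurable]:
  assumes [measurable]: "f \<in> borel_measurable M" "g \<in> M \<rightarrow>\<^sub>M lborel \<Otimes>\<^sub>M lborel"
  shows "(\<lambda>z. indicator (slot (g z)) (f z) :: ennreal) \<in> borel_measurable M"
proof -
  have [measurable]: "(\<lambda>z. fst (g z)) \<in> M \<rightarrow>\<^sub>M borel" "(\<lambda>z. snd (g z)) \<in> M \<rightarrow>\<^sub>M borel"
    using measurable_compose[OF assms(2) measurable_fst] measurable_compose[OF assms(2) measurable_snd] by simp_all
  have "(\<lambda>z. indicator (slot (g z)) (f z) :: ennreal) =
     (\<lambda>z. if 0 < snd (g z) \<and> \<bar>f z - fst (g z)\<bar> < 1 \<and> 2 * snd (g z) * \<bar>f z - fst (g z)\<bar> < 1 then 1 else 0)"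
    by (auto simp: slot_def indicator_def split: prod.splits)
  then show ?thesis by simp
qed

lemma borel_slot [measurable]: "slot p \<in> sets borel"
  unfolding slot_def by (cases p) simp

text \<open>The second coordinate is a layer-cake parameter: \<open>1 / (2 * m)\<close> is the
  length of the set of q for which both points lie within \<open>1 / (2 * q)\<close> of u. The
  weight by itself is not a product of a function of x and a function of y; under the integral over
  q it becomes one.\<close>

lemma nn_integral_slot_snd:
  assumes "0 < m" "m = max \<bar>x - u\<bar> \<bar>y - u\<bar>"
  shows "(\<integral>\<^sup>+q. indicator (slot (u, q)) x * indicator (slot (u, q)) y \<partial>lborel) =
    ennreal (1 / (2 * m)) * indicator {m. m < 1} m"
proof -
  have "2 * q * \<bar>x - u\<bar> < 1 \<and> 2 * q * \<bar>y - u\<bar> < 1 \<longleftrightarrow> q < 1 / (2 * m)" if "0 < q" for q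
  proof -
    have "2 * q * \<bar>x - u\<bar> < 1 \<and> 2 * q * \<bar>y - u\<bar> < 1 \<longleftrightarrow> max (2 * q * \<bar>x - u\<bar>) (2 * q * \<bar>y - u\<bar>) < 1"
      by simp
    also have "max (2 * q * \<bar>x - u\<bar>) (2 * q * \<bar>y - u\<bar>) = 2 * q * m"
      using that assms(2) by (simp add: max_mult_distrib_left)
    finally show ?thesis using assms(1) by (simp add: field_simps)
  qed
  then have "(indicator (slot (u, q)) x * indicator (slot (u, q)) y :: ennreal) =
      indicator {m. m < 1} m * indicator {0<..<1 / (2 * m)} q" for q
    using assms(2) by (auto simp: slot_def indicator_def)
  then show ?thesis
    using assms(1) by (simp add: nn_integral_cmult mult.commute)
qed

lemma log_kernel_eq_slots:
  "log_kernel x y = (\<integral>\<^sup>+p. indicator (slot p) x * indicator (slot p) y \<partial>(lborel \<Otimes>\<^sub>M lborel))"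
proof -
  \<comment> \<open>Seen from the midpoint shifted by v, the farther of the two points is at
    distance \<open>\<bar>v\<bar> + s\<close>; this reduces the double integral to the reciprocal
    integral, whose value is \<open>- ln s\<close>.\<close>
  define c s where "c = (x + y) / 2" and "s = \<bar>x - y\<bar> / 2"
  have mx: "max \<bar>x - (c + v)\<bar> \<bar>y - (c + v)\<bar> = \<bar>v\<bar> + s" for v
    by (auto simp: c_def s_def field_simps max_def abs_if)
  have "(\<integral>\<^sup>+p. indicator (slot p) x * indicator (slot p) y \<partial>(lborel \<Otimes>\<^sub>M lborel)) =
      (\<integral>\<^sup>+u. \<integral>\<^sup>+q. indicator (slot (u, q)) x * indicator (slot (u, q)) y \<partial>lborel \<partial>lborel)"
    by (rule lborel.nn_integral_fst[symmetric]) measurable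
  also have "\<dots> = (\<integral>\<^sup>+v. \<integral>\<^sup>+q. indicator (slot (c + v, q)) x * indicator (slot (c + v, q)) y \<partial>lborel \<partial>lborel)"
    by (subst nn_integral_real_affine[where c = 1 and t = c]) auto
  also have "\<dots> = (\<integral>\<^sup>+v. ennreal (1 / (2 * (\<bar>v\<bar> + s))) * indicator {v. \<bar>v\<bar> + s < 1} v \<partial>lborel)"
  proof (rule nn_integral_cong_AE)
    show "AE v in lborel. (\<integral>\<^sup>+q. indicator (slot (c + v, q)) x * indicator (slot (c + v, q)) y \<partial>lborel) =
       ennreal (1 / (2 * (\<bar>v\<bar> + s))) * indicator {v. \<bar>v\<bar> + s < 1} v"
      using AE_lborel_singleton[of "0::real"]
    proof eventually_elim
      case (elim v)
      have "0 < \<bar>v\<bar> + s" using elim by (simp add: s_def add_pos_nonneg)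
      from nn_integral_slot_snd[OF this mx[symmetric]] show ?case
        by (simp add: indicator_def)
    qed
  qed
  also have "\<dots> = log_kernel x y"
  proof (cases "x = y")
    case True
    then show ?thesis
      using nn_integral_symmetric_reciprocal_0 by (simp add: s_def log_kernel_def)
  next
    case False
    then have "0 < s" by (simp add: s_def)
    moreover have "- ln s = ln (2 / \<bar>x - y\<bar>)"
      using False by (simp add: s_def ln_div)
    ultimately show ?thesis
      using nn_integral_symmetric_reciprocal[of s] False by (simp add: log_kernel_def)
  qed
  finally show ?thesis ..
qed

section \<open>Mutual energy and its positivity\<close>

abbreviation potential :: "real measure \<Rightarrow> real \<Rightarrow> ennreal" where
  "potential \<mu> x \<equiv> (\<integral>\<^sup>+y. log_kernel x y \<partial>\<mu>)"

definition mutual_energy :: "real measure \<Rightarrow> real measure \<Rightarrow> ennreal" where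
  "mutual_energy \<mu> \<nu> = (\<integral>\<^sup>+x. \<integral>\<^sup>+y. log_kernel x y \<partial>\<nu> \<partial>\<mu>)"

lemma measurable_emeasure_slot:
  assumes "finite_measure \<nu>" and [measurable_cong, simp]: "sets \<nu> = sets borel"
  shows "(\<lambda>p. emeasure \<nu> (slot p)) \<in> borel_measurable (lborel \<Otimes>\<^sub>M lborel)"
proof -
  interpret finite_measure \<nu> by fact
  have "(\<lambda>p. emeasure \<nu> (slot p)) = (\<lambda>p. \<integral>\<^sup>+y. indicator (slot p) y \<partial>\<nu>)" by simp
  also have "\<dots> \<in> borel_measurable (lborel \<Otimes>\<^sub>M lborel)" by measurable
  finally show ?thesis .
qed

text \<open>By Tonelli the energy form is the L2 inner product of the functions giving the masses of
  the slots; symmetry and positivity can be read off.\<close>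

lemma mutual_energy_eq_slots:
  assumes "finite_measure \<mu>" "finite_measure \<nu>"
    and [measurable_cong, simp]: "sets \<mu> = sets borel" "sets \<nu> = sets borel"
  shows "mutual_energy \<mu> \<nu> = (\<integral>\<^sup>+p. emeasure \<mu> (slot p) * emeasure \<nu> (slot p) \<partial>(lborel \<Otimes>\<^sub>M lborel))"
proof -
  interpret \<mu>: finite_measure \<mu> by fact
  interpret \<nu>: finite_measure \<nu> by fact
  interpret L: pair_sigma_finite lborel "lborel :: real measure" ..
  interpret \<mu>L: pair_sigma_finite \<mu> "lborel \<Otimes>\<^sub>M (lborel :: real measure)" ..
  interpret \<nu>L: pair_sigma_finite \<nu> "lborel \<Otimes>\<^sub>M (lborel :: real measure)" ..
  let ?P = "lborel \<Otimes>\<^sub>M (lborel :: real measure)"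
  have "mutual_energy \<mu> \<nu> = (\<integral>\<^sup>+x. \<integral>\<^sup>+y. \<integral>\<^sup>+p. indicator (slot p) x * indicator (slot p) y \<partial>?P \<partial>\<nu> \<partial>\<mu>)"
    by (simp add: mutual_energy_def log_kernel_eq_slots)
  also have "\<dots> = (\<integral>\<^sup>+x. \<integral>\<^sup>+p. \<integral>\<^sup>+y. indicator (slot p) x * indicator (slot p) y \<partial>\<nu> \<partial>?P \<partial>\<mu>)"
    by (intro nn_integral_cong \<nu>L.Fubini'[symmetric]) measurable
  also have "\<dots> = (\<integral>\<^sup>+x. \<integral>\<^sup>+p. indicator (slot p) x * emeasure \<nu> (slot p) \<partial>?P \<partial>\<mu>)"
    by (intro nn_integral_cong) (simp add: nn_integral_cmult)
  also have "\<dots> = (\<integral>\<^sup>+p. \<integral>\<^sup>+x. indicator (slot p) x * emeasure \<nu> (slot p) \<partial>\<mu> \<partial>?P)"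
  proof (rule \<mu>L.Fubini'[symmetric])
    note [measurable] = measurable_emeasure_slot[OF assms(2,4)]
    show "(\<lambda>(x, p). indicator (slot p) x * emeasure \<nu> (slot p)) \<in> borel_measurable (\<mu> \<Otimes>\<^sub>M ?P)"
      by measurable
  qed
  also have "\<dots> = (\<integral>\<^sup>+p. emeasure \<mu> (slot p) * emeasure \<nu> (slot p) \<partial>?P)"
    by (intro nn_integral_cong) (simp add: nn_integral_multc)
  finally show ?thesis .
qed

lemma mutual_energy_commute:
  assumes "finite_measure \<mu>" "finite_measure \<nu>" "sets \<mu> = sets borel" "sets \<nu> = sets borel"
  shows "mutual_energy \<mu> \<nu> = mutual_energy \<nu> \<mu>"
  using assms by (simp add: mutual_energy_eq_slots mult.commute)

lemma two_mult_le_squares_ennreal: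
  fixes a b :: ennreal
  shows "2 * (a * b) \<le> a * a + b * b"
proof (cases "a = \<top> \<or> b = \<top>")
  case True
  then show ?thesis by (auto simp: ennreal_top_mult ennreal_mult_top)
next
  case False
  then obtain x y where "a = ennreal x" "b = ennreal y" "0 \<le> x" "0 \<le> y"
    by (metis ennreal_cases)
  moreover have "2 * (x * y) \<le> x * x + y * y"
    using zero_le_square[of "x - y"] by (simp add: algebra_simps)
  ultimately show ?thesis
    by (simp flip: ennreal_mult ennreal_plus ennreal_numeral add: ennreal_leI)
qed

text \<open>Positivity of the energy of the signed measure \<open>\<mu> + \<epsilon> \<rho>' - (\<nu> + \<epsilon> \<rho>)\<close>.\<close>

lemma mutual_energy_positive_perturbed:
  fixes \<epsilon> :: ennreal
  assumes fin: "finite_measure \<mu>" "finite_measure \<nu>" "finite_measure \<rho>" "finite_measure \<rho>'"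
    and sets: "sets \<mu> = sets borel" "sets \<nu> = sets borel" "sets \<rho> = sets borel" "sets \<rho>' = sets borel"
  shows "2 * (mutual_energy \<mu> \<nu> + \<epsilon> * mutual_energy \<mu> \<rho> + \<epsilon> * mutual_energy \<rho>' \<nu> + \<epsilon> * \<epsilon> * mutual_energy \<rho>' \<rho>)
    \<le> (mutual_energy \<mu> \<mu> + 2 * \<epsilon> * mutual_energy \<mu> \<rho>' + \<epsilon> * \<epsilon> * mutual_energy \<rho>' \<rho>')
      + (mutual_energy \<nu> \<nu> + 2 * \<epsilon> * mutual_energy \<nu> \<rho> + \<epsilon> * \<epsilon> * mutual_energy \<rho> \<rho>)"
proof -
  let ?P = "lborel \<Otimes>\<^sub>M (lborel :: real measure)"
  let ?A = "\<lambda>p. emeasure \<mu> (slot p) + \<epsilon> * emeasure \<rho>' (slot p)"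
  let ?B = "\<lambda>p. emeasure \<nu> (slot p) + \<epsilon> * emeasure \<rho> (slot p)"
  note [measurable] = measurable_emeasure_slot[OF fin(1) sets(1)] measurable_emeasure_slot[OF fin(2) sets(2)]
    measurable_emeasure_slot[OF fin(3) sets(3)] measurable_emeasure_slot[OF fin(4) sets(4)]
  \<comment> \<open>The squared signed mass of every slot is nonnegative. Keeping the positive part
    \<open>?A\<close> and the negative part \<open>?B\<close> of the signed measure apart avoids
    differences of infinite quantities.\<close>
  have le: "(\<integral>\<^sup>+p. 2 * (?A p * ?B p) \<partial>?P) \<le> (\<integral>\<^sup>+p. ?A p * ?A p + ?B p * ?B p \<partial>?P)"
    by (intro nn_integral_mono two_mult_le_squares_ennreal)
  have L: "(\<integral>\<^sup>+p. 2 * (?A p * ?B p) \<partial>?P) =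
     2 * (mutual_energy \<mu> \<nu> + \<epsilon> * mutual_energy \<mu> \<rho> + \<epsilon> * mutual_energy \<rho>' \<nu> + \<epsilon> * \<epsilon> * mutual_energy \<rho>' \<rho>)"
  proof -
    have "?A p * ?B p = emeasure \<mu> (slot p) * emeasure \<nu> (slot p) + \<epsilon> * (emeasure \<mu> (slot p) * emeasure \<rho> (slot p))
      + \<epsilon> * (emeasure \<rho>' (slot p) * emeasure \<nu> (slot p)) + \<epsilon> * \<epsilon> * (emeasure \<rho>' (slot p) * emeasure \<rho> (slot p))" for p
      by (simp add: algebra_simps)
    then show ?thesis
      using fin sets by (simp add: nn_integral_cmult nn_integral_add mutual_energy_eq_slots)
  qed
  have sq: "(\<integral>\<^sup>+p. (emeasure a (slot p) + \<epsilon> * emeasure b (slot p)) * (emeasure a (slot p) + \<epsilon> * emeasure b (slot p)) \<partial>?P) =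
      mutual_energy a a + 2 * \<epsilon> * mutual_energy a b + \<epsilon> * \<epsilon> * mutual_energy b b"
    if "finite_measure a" "finite_measure b" "sets a = sets borel" "sets b = sets borel" for a b
  proof -
    note [measurable] = measurable_emeasure_slot[OF that(1,3)] measurable_emeasure_slot[OF that(2,4)]
    have "(x + \<epsilon> * y) * (x + \<epsilon> * y) = x * x + 2 * \<epsilon> * (x * y) + \<epsilon> * \<epsilon> * (y * y)" for x y :: ennreal
      by (simp add: ring_distribs mult_2 mult_2_right ac_simps)
    then show ?thesis
      using that by (simp add: nn_integral_cmult nn_integral_add mutual_energy_eq_slots)
  qed
  show ?thesis
    using le by (simp add: L sq[OF fin(1,4) sets(1,4)] sq[OF fin(2,3) sets(2,3)] nn_integral_add)
qed

lemma mutual_energy_positive: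
  assumes "finite_measure \<mu>" "finite_measure \<nu>" "sets \<mu> = sets borel" "sets \<nu> = sets borel"
  shows "2 * mutual_energy \<mu> \<nu> \<le> mutual_energy \<mu> \<mu> + mutual_energy \<nu> \<nu>"
  using mutual_energy_positive_perturbed[OF assms(1,2) assms(1,2) assms(3,4) assms(3,4), of 0] by simp

section \<open>Arcsine laws\<close>

text \<open>The equilibrium measure of the interval with centre c and radius r. Parametrizing by the
  angle avoids a density with singularities at the endpoints.\<close>

definition arcsine :: "real \<Rightarrow> real \<Rightarrow> real measure" where
  "arcsine c r = distr (uniform_measure lborel {0..pi}) borel (\<lambda>\<theta>. c + r * cos \<theta>)"

lemma sets_arcsine [simp, measurable_cong]: "sets (arcsine c r) = sets borel"
  by (simp add: arcsine_def)

lemma prob_space_arcsine: "prob_space (arcsine c r)"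
  unfolding arcsine_def
  by (intro prob_space.prob_space_distr prob_space_uniform_measure) auto

lemma nn_integral_arcsine:
  assumes [measurable]: "f \<in> borel_measurable borel"
  shows "(\<integral>\<^sup>+t. f t \<partial>arcsine c r) = (\<integral>\<^sup>+\<theta>. f (c + r * cos \<theta>) * indicator {0..pi} \<theta> \<partial>lborel) / ennreal pi"
  unfolding arcsine_def by (subst nn_integral_distr) (auto simp: nn_integral_uniform_measure)

text \<open>Jordan's inequality: sin is concave on the interval and the left-hand side is its
  chord.\<close>

lemma sin_ge_linear:
  assumes "0 \<le> u" "u \<le> pi / 2"
  shows "2 * u / pi \<le> sin u"
proof -
  have "convex_on {0..pi/2} (\<lambda>x. - sin x)"
    by (rule convex_on_realI[where f' = "\<lambda>x. - cos x"])
       (auto intro!: derivative_eq_intros cos_monotone_0_pi_le)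
  then have "- sin ((1 - 2 * u / pi) *\<^sub>R 0 + (2 * u / pi) *\<^sub>R (pi / 2)) \<le>
      (1 - 2 * u / pi) * (- sin 0) + (2 * u / pi) * (- sin (pi / 2))"
    using assms by (intro convex_onD) (auto simp: field_simps)
  then show ?thesis by simp
qed

text \<open>Write the difference as twice the product of the sines of the half sum a and the half
  difference b. Since b is at most a and at most \<open>pi - a\<close>, Jordan's inequality bounds
  both sines below by \<open>2 * b / pi\<close>. The quadratic order is forced at 0 and
  \<open>pi\<close>, where cos is stationary.\<close>

lemma cos_diff_ge_square:
  assumes "\<alpha> \<in> {0..pi}" "\<theta> \<in> {0..pi}"
  shows "2 * (\<alpha> - \<theta>)\<^sup>2 / pi\<^sup>2 \<le> \<bar>cos \<alpha> - cos \<theta>\<bar>"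
proof -
  define a b where "a = (\<alpha> + \<theta>) / 2" and "b = \<bar>\<theta> - \<alpha>\<bar> / 2"
  have b: "0 \<le> b" "b \<le> pi / 2" and ab: "b \<le> a" "b \<le> pi - a"
    using assms by (auto simp: a_def b_def abs_if field_simps)
  have sb: "2 * b / pi \<le> sin b" using b by (intro sin_ge_linear)
  have sa: "2 * b / pi \<le> sin a"
  proof (cases "a \<le> pi / 2")
    case True
    have "2 * b / pi \<le> 2 * a / pi" using ab by (simp add: divide_right_mono)
    also have "\<dots> \<le> sin a" using True ab b by (intro sin_ge_linear) auto
    finally show ?thesis .
  next
    case False
    have "2 * b / pi \<le> 2 * (pi - a) / pi" using ab by (simp add: divide_right_mono)
    also have "\<dots> \<le> sin (pi - a)" using False ab b by (intro sin_ge_linear) auto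
    finally show ?thesis by simp
  qed
  have "\<bar>cos \<alpha> - cos \<theta>\<bar> = 2 * \<bar>sin a\<bar> * \<bar>sin ((\<theta> - \<alpha>) / 2)\<bar>"
    by (simp add: cos_diff_cos a_def abs_mult)
  also have "\<bar>sin ((\<theta> - \<alpha>) / 2)\<bar> = \<bar>sin b\<bar>"
  proof (cases "\<theta> \<ge> \<alpha>")
    case False
    then have "(\<theta> - \<alpha>) / 2 = - b" by (simp add: b_def field_simps)
    then show ?thesis by simp
  qed (simp add: b_def)
  finally have "\<bar>cos \<alpha> - cos \<theta>\<bar> = 2 * \<bar>sin a\<bar> * \<bar>sin b\<bar>" .
  moreover have "2 * (2 * b / pi) * (2 * b / pi) \<le> 2 * \<bar>sin a\<bar> * \<bar>sin b\<bar>"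
    using sa sb b by (intro mult_mono) auto
  moreover have "2 * (2 * b / pi) * (2 * b / pi) = 2 * (\<alpha> - \<theta>)\<^sup>2 / pi\<^sup>2"
    by (simp add: b_def power2_eq_square abs_if field_simps)
  ultimately show ?thesis by simp
qed

text \<open>With t the distance of the angles divided by \<open>pi\<close>, the logarithm of
  \<open>1 / t^2\<close> is four times that of \<open>sqrt (1 / t)\<close>, hence at most
  \<open>4 * sqrt (1 / t)\<close>: an integrable singularity with an explicit integral.\<close>

lemma log_kernel_cos_le:
  assumes "\<alpha> \<in> {0..pi}" "\<theta> \<in> {0..pi}" "\<alpha> \<noteq> \<theta>"
  shows "log_kernel (cos \<alpha>) (cos \<theta>) \<le> ennreal (4 * sqrt pi * \<bar>\<theta> - \<alpha>\<bar> powr (-1/2))"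
proof -
  define t where "t = \<bar>\<alpha> - \<theta>\<bar> / pi"
  have t: "0 < t" using assms(3) by (simp add: t_def)
  have ge: "2 * t\<^sup>2 \<le> \<bar>cos \<alpha> - cos \<theta>\<bar>"
    using cos_diff_ge_square[OF assms(1,2)] by (simp add: t_def power_divide)
  moreover have "0 < 2 * t\<^sup>2" using t by simp
  ultimately have pos: "0 < \<bar>cos \<alpha> - cos \<theta>\<bar>" by linarith
  have "ln (2 / \<bar>cos \<alpha> - cos \<theta>\<bar>) \<le> ln (2 / (2 * t\<^sup>2))"
    using ge pos t by (intro ln_mono divide_left_mono mult_pos_pos) auto
  also have "2 / (2 * t\<^sup>2) = sqrt (1 / t) ^ 4"
    using t by (simp add: power_divide real_sqrt_power[symmetric] power4_eq_xxxx power2_eq_square real_sqrt_divide)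
  also have "ln (sqrt (1 / t) ^ 4) = 4 * ln (sqrt (1 / t))"
    using t by (simp add: ln_realpow)
  also have "\<dots> \<le> 4 * sqrt (1 / t)"
    using ln_le_minus_one[of "sqrt (1 / t)"] t by simp
  also have "\<dots> = 4 * sqrt pi * \<bar>\<theta> - \<alpha>\<bar> powr (-1/2)"
    using t by (simp add: t_def real_sqrt_divide powr_minus powr_half_sqrt abs_minus_commute field_simps)
  finally show ?thesis using pos by (auto simp: log_kernel_def intro!: ennreal_leI)
qed

section \<open>The potential of the arcsine law of [-1, 1]\<close>

abbreviation (input) cos_potential :: "real \<Rightarrow> ennreal" where
  "cos_potential x \<equiv> (\<integral>\<^sup>+\<theta>. log_kernel x (cos \<theta>) * indicator {0..pi} \<theta> \<partial>lborel)"

lemma nn_integral_abs_powr_half: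
  assumes "0 \<le> c"
  shows "(\<integral>\<^sup>+v. ennreal (\<bar>v\<bar> powr (-1/2)) * indicator {-c..c} v \<partial>lborel) = ennreal (4 * sqrt c)"
proof -
  let ?f = "\<lambda>v. ennreal (\<bar>v\<bar> powr (-1/2)) * indicator {-c..c} v"
  have "((\<lambda>x. x powr (-1/2)) has_integral (c powr (-1/2 + 1) / (-1/2+1))) {0..c}"
    by (rule has_integral_powr_from_0) (use assms in auto)
  then have "((\<lambda>x. x powr (-1/2)) has_integral (2 * sqrt c)) {0..c}"
    using assms by (simp add: powr_half_sqrt mult.commute)
  then have "((\<lambda>x. if x \<in> {0..c} then x powr (-1/2) else 0) has_integral (2 * sqrt c)) UNIV"
    by (simp only: has_integral_restrict_UNIV)
  moreover have "(\<lambda>x. if x \<in> {0..c} then x powr (-1/2) else 0) = (\<lambda>x. indicator {0..c} x * x powr (-1/2))"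
    by (auto simp: fun_eq_iff indicator_def)
  ultimately have "((\<lambda>x. indicator {0..c} x * x powr (-1/2)) has_integral (2 * sqrt c)) UNIV"
    by simp
  then have pos: "(\<integral>\<^sup>+v. ennreal (indicator {0..c} v * v powr (-1/2)) \<partial>lborel) = ennreal (2 * sqrt c)"
    by (intro nn_integral_has_integral_lborel) auto
  have pos': "(\<integral>\<^sup>+v. ?f v * indicator {0<..} v \<partial>lborel) = ennreal (2 * sqrt c)"
    unfolding pos[symmetric]
  proof (rule nn_integral_cong_AE)
    show "AE v in lborel. ?f v * indicator {0<..} v = ennreal (indicator {0..c} v * v powr (-1/2))"
      using AE_lborel_singleton[of "0::real"]
      by eventually_elim (use assms in \<open>auto simp: indicator_def\<close>)
  qed
  have "(\<integral>\<^sup>+v. ?f v \<partial>lborel) = 2 * (\<integral>\<^sup>+v. ?f v * indicator {0<..} v \<partial>lborel)"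
    by (rule nn_integral_even) (auto simp: indicator_def)
  also have "\<dots> = ennreal 2 * ennreal (2 * sqrt c)"
    unfolding pos' by simp
  finally show ?thesis using assms by (subst (asm) ennreal_mult[symmetric]) auto
qed

text \<open>The constant is the product of the factor \<open>4 * sqrt pi\<close> of the pointwise
  bound and the integral \<open>4 * sqrt pi\<close>. It is the independence of x that will make the
  functional equation determine the potential.\<close>

lemma cos_potential_bounded:
  assumes "\<bar>x\<bar> \<le> 1"
  shows "cos_potential x \<le> ennreal (16 * pi)"
proof -
  define \<alpha> where "\<alpha> = arccos x"
  have \<alpha>: "\<alpha> \<in> {0..pi}" "x = cos \<alpha>"
    using assms by (auto simp: \<alpha>_def arccos_lbound arccos_ubound cos_arccos_abs)
  have "cos_potential x \<le> (\<integral>\<^sup>+\<theta>. ennreal (4 * sqrt pi) * (ennreal (\<bar>\<theta> - \<alpha>\<bar> powr (-1/2)) * indicator {-pi..pi} (\<theta> - \<alpha>)) \<partial>lborel)"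
  proof (rule nn_integral_mono_AE)
    show "AE \<theta> in lborel. log_kernel x (cos \<theta>) * indicator {0..pi} \<theta> \<le>
        ennreal (4 * sqrt pi) * (ennreal (\<bar>\<theta> - \<alpha>\<bar> powr (-1/2)) * indicator {-pi..pi} (\<theta> - \<alpha>))"
      using AE_lborel_singleton[of \<alpha>]
    proof eventually_elim
      case (elim \<theta>)
      then show ?case
        using log_kernel_cos_le[OF \<alpha>(1), of \<theta>] \<alpha>
        by (auto simp: indicator_def simp flip: ennreal_mult)
    qed
  qed
  also have "\<dots> = ennreal (4 * sqrt pi) *
      (\<integral>\<^sup>+\<theta>. ennreal (\<bar>\<theta> - \<alpha>\<bar> powr (-1/2)) * indicator {-pi..pi} (\<theta> - \<alpha>) \<partial>lborel)"
    by (intro nn_integral_cmult) measurable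
  also have "(\<integral>\<^sup>+\<theta>. ennreal (\<bar>\<theta> - \<alpha>\<bar> powr (-1/2)) * indicator {-pi..pi} (\<theta> - \<alpha>) \<partial>lborel) =
      (\<integral>\<^sup>+v. ennreal (\<bar>v\<bar> powr (-1/2)) * indicator {-pi..pi} v \<partial>lborel)"
    by (subst nn_integral_real_affine[where c = 1 and t = \<alpha>]) auto
  also have "\<dots> = ennreal (4 * sqrt pi)"
    by (rule nn_integral_abs_powr_half) simp
  finally show ?thesis by (simp flip: ennreal_mult)
qed

text \<open>The difference of the doubled cosines is 2 (cos \<alpha> - cos \<phi>) (cos \<alpha> +
  cos \<phi>). The term \<open>ln 4\<close> balances this factor 2 against the numerators 2 of the
  kernels, one on the left and two on the right.\<close>

lemma log_kernel_cos_double: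
  "log_kernel (cos (2 * \<alpha>)) (cos (2 * \<phi>)) + ennreal (ln 4) =
    log_kernel (cos \<alpha>) (cos \<phi>) + log_kernel (cos \<alpha>) (- cos \<phi>)"
proof -
  define a b where "a = cos \<alpha>" and "b = cos \<phi>"
  have ab: "\<bar>a\<bar> \<le> 1" "\<bar>b\<bar> \<le> 1" by (simp_all add: a_def b_def)
  have eq: "cos (2 * \<alpha>) - cos (2 * \<phi>) = 2 * ((a - b) * (a + b))"
    unfolding a_def b_def cos_double_cos by (simp add: power2_eq_square algebra_simps)
  show ?thesis
  proof (cases "a = b \<or> a = - b")
    case True
    then have "cos (2 * \<alpha>) - cos (2 * \<phi>) = 0" using eq by auto
    then have "cos (2 * \<alpha>) = cos (2 * \<phi>)" by linarith
    then show ?thesis using True by (auto simp: log_kernel_def a_def[symmetric] b_def[symmetric])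
  next
    case False
    then have ne: "a - b \<noteq> 0" "a + b \<noteq> 0" by auto
    then have ne2: "cos (2 * \<alpha>) \<noteq> cos (2 * \<phi>)" using eq by auto
    have le: "\<bar>a - b\<bar> \<le> 2" "\<bar>a + b\<bar> \<le> 2" using ab by linarith+
    have nn: "0 \<le> ln (2 / \<bar>a - b\<bar>)" "0 \<le> ln (2 / \<bar>a + b\<bar>)" using le ne by (auto intro!: ln_ge_zero simp: field_simps)
    have le': "\<bar>cos (2 * \<alpha>) - cos (2 * \<phi>)\<bar> \<le> 2"
      using abs_cos_le_one[of "2 * \<alpha>"] abs_cos_le_one[of "2 * \<phi>"] by linarith
    have nn': "0 \<le> ln (2 / \<bar>cos (2 * \<alpha>) - cos (2 * \<phi>)\<bar>)"
      using le' ne2 by (auto intro!: ln_ge_zero simp: field_simps)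
    have "ln (2 / \<bar>cos (2 * \<alpha>) - cos (2 * \<phi>)\<bar>) + ln 4 = ln (2 / \<bar>a - b\<bar>) + ln (2 / \<bar>a + b\<bar>)"
    proof -
      have "ln (4::real) = 2 * ln 2" using ln_realpow[of 2 2] by simp
      then show ?thesis unfolding eq abs_mult
        using ne by (simp add: ln_div ln_mult)
    qed
    then show ?thesis
      using ne ne2 nn nn'
      by (simp add: log_kernel_def a_def[symmetric] b_def[symmetric] flip: ennreal_plus)
  qed
qed

text \<open>Substitute \<theta> = 2 \<phi> and apply the pointwise formula on the half interval; the
  reflection \<phi> to \<open>pi - \<phi>\<close> turns the kernel at - cos \<phi> into the missing
  half of the integral at cos \<alpha>.\<close>

lemma cos_potential_double:
  "cos_potential (cos (2 * \<alpha>)) + ennreal (pi * ln 4) = 2 * cos_potential (cos \<alpha>)"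
proof -
  have pos: "0 \<le> ln (4::real)" by simp
  have "cos_potential (cos (2 * \<alpha>)) = 2 * (\<integral>\<^sup>+\<phi>. log_kernel (cos (2 * \<alpha>)) (cos (2 * \<phi>)) * indicator {0..pi/2} \<phi> \<partial>lborel)"
    by (subst nn_integral_real_affine[where c = 2 and t = 0])
       (auto simp: indicator_def field_simps intro!: arg_cong2[where f = "(*)"] nn_integral_cong)
  moreover have "ennreal (pi * ln 4) = 2 * (\<integral>\<^sup>+\<phi>. ennreal (ln 4) * indicator {0..pi/2} \<phi> \<partial>lborel)"
    using pos by (simp add: nn_integral_cmult field_simps flip: ennreal_mult ennreal_numeral)
  ultimately have "cos_potential (cos (2 * \<alpha>)) + ennreal (pi * ln 4) =
     2 * (\<integral>\<^sup>+\<phi>. log_kernel (cos (2 * \<alpha>)) (cos (2 * \<phi>)) * indicator {0..pi/2} \<phi> + ennreal (ln 4) * indicator {0..pi/2} \<phi> \<partial>lborel)"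
    by (subst nn_integral_add) (auto simp: distrib_left)
  also have "(\<integral>\<^sup>+\<phi>. log_kernel (cos (2 * \<alpha>)) (cos (2 * \<phi>)) * indicator {0..pi/2} \<phi> + ennreal (ln 4) * indicator {0..pi/2} \<phi> \<partial>lborel) =
     (\<integral>\<^sup>+\<phi>. log_kernel (cos \<alpha>) (cos \<phi>) * indicator {0..pi/2} \<phi> + log_kernel (cos \<alpha>) (- cos \<phi>) * indicator {0..pi/2} \<phi> \<partial>lborel)"
    by (intro nn_integral_cong) (simp add: log_kernel_cos_double flip: distrib_right)
  also have "\<dots> = (\<integral>\<^sup>+\<phi>. log_kernel (cos \<alpha>) (cos \<phi>) * indicator {0..pi/2} \<phi> \<partial>lborel) +
      (\<integral>\<^sup>+\<phi>. log_kernel (cos \<alpha>) (- cos \<phi>) * indicator {0..pi/2} \<phi> \<partial>lborel)"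
    by (intro nn_integral_add) measurable
  also have "(\<integral>\<^sup>+\<phi>. log_kernel (cos \<alpha>) (- cos \<phi>) * indicator {0..pi/2} \<phi> \<partial>lborel) =
      (\<integral>\<^sup>+\<phi>. log_kernel (cos \<alpha>) (cos \<phi>) * indicator {pi/2..pi} \<phi> \<partial>lborel)"
    by (subst nn_integral_real_affine[where c = "-1" and t = pi])
       (auto simp: indicator_def intro!: nn_integral_cong)
  also have "(\<integral>\<^sup>+\<phi>. log_kernel (cos \<alpha>) (cos \<phi>) * indicator {0..pi/2} \<phi> \<partial>lborel) + \<dots> =
     (\<integral>\<^sup>+\<phi>. log_kernel (cos \<alpha>) (cos \<phi>) * indicator {0..pi/2} \<phi> + log_kernel (cos \<alpha>) (cos \<phi>) * indicator {pi/2..pi} \<phi> \<partial>lborel)"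
    by (intro nn_integral_add[symmetric]) measurable
  also have "\<dots> = cos_potential (cos \<alpha>)"
  proof (rule nn_integral_cong_AE)
    show "AE \<phi> in lborel. log_kernel (cos \<alpha>) (cos \<phi>) * indicator {0..pi/2} \<phi> + log_kernel (cos \<alpha>) (cos \<phi>) * indicator {pi/2..pi} \<phi>
        = log_kernel (cos \<alpha>) (cos \<phi>) * indicator {0..pi} \<phi>"
      using AE_lborel_singleton[of "pi/2"]
      by eventually_elim (use pi_gt_zero in \<open>auto simp: indicator_def\<close>)
  qed
  finally show ?thesis .
qed

text \<open>A bounded solution \<open>b\<close> of \<open>b (cos (2 * \<alpha>)) = 2 * b (cos \<alpha>)\<close> vanishes.\<close>

lemma cos_potential_eq:
  assumes "\<bar>x\<bar> \<le> 1"
  shows "cos_potential x = ennreal (pi * ln 4)"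
proof -
  \<comment> \<open>The constant \<open>pi * ln 4\<close> solves the doubling equation; subtracting
    it leaves a homogeneous equation, under which a nonzero value would double indefinitely.\<close>
  define b where "b x = enn2real (cos_potential x) - pi * ln 4" for x
  have eq: "cos_potential x = ennreal (enn2real (cos_potential x))" if "\<bar>x\<bar> \<le> 1" for x
    using cos_potential_bounded[OF that] by (intro ennreal_enn2real[symmetric]) (auto simp: less_top[symmetric] top_unique)
  have bd: "\<bar>b x\<bar> \<le> 16 * pi + pi * ln 4" if "\<bar>x\<bar> \<le> 1" for x
  proof -
    have "enn2real (cos_potential x) \<le> 16 * pi"
      using cos_potential_bounded[OF that] by (intro enn2real_leI) auto
    moreover have "0 \<le> pi * ln 4" "0 \<le> enn2real (cos_potential x)" by simp_all
    ultimately show ?thesis unfolding b_def by linarith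
  qed
  have dbl: "b (cos (2 * \<alpha>)) = 2 * b (cos \<alpha>)" for \<alpha>
  proof -
    have "ennreal (enn2real (cos_potential (cos (2 * \<alpha>))) + pi * ln 4) = ennreal (2 * enn2real (cos_potential (cos \<alpha>)))"
      using cos_potential_double[of \<alpha>] eq[of "cos \<alpha>"] eq[of "cos (2 * \<alpha>)"]
      by (simp add: ennreal_mult)
    then show ?thesis by (subst (asm) ennreal_inj) (auto simp: b_def)
  qed
  have pow: "b (cos (2 ^ k * \<alpha>)) = 2 ^ k * b (cos \<alpha>)" for k \<alpha>
  proof (induction k arbitrary: \<alpha>)
    case (Suc k)
    have "b (cos (2 ^ Suc k * \<alpha>)) = b (cos (2 ^ k * (2 * \<alpha>)))" by (simp add: ac_simps)
    also have "\<dots> = 2 ^ Suc k * b (cos \<alpha>)" unfolding Suc.IH by (simp add: dbl)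
    finally show ?case .
  qed simp
  have "b x = 0"
  proof (rule ccontr)
    assume "b x \<noteq> 0"
    obtain k :: nat where "(16 * pi + pi * ln 4) / \<bar>b x\<bar> < 2 ^ k"
      using real_arch_pow[of 2] by auto
    then have "16 * pi + pi * ln 4 < \<bar>2 ^ k * b x\<bar>"
      using \<open>b x \<noteq> 0\<close> by (simp add: field_simps abs_mult)
    also have "2 ^ k * b x = b (cos (2 ^ k * arccos x))"
      using assms by (simp add: pow cos_arccos_abs)
    finally show False using bd[of "cos (2 ^ k * arccos x)"] by simp
  qed
  then show ?thesis using eq[OF assms] by (simp add: b_def)
qed

section \<open>Arcsine laws on subintervals\<close>

lemma log_kernel_affine:
  assumes "0 < r" "r \<le> 1" "\<bar>x - y\<bar> \<le> 2"
  shows "log_kernel (c + r * x) (c + r * y) = ennreal (ln (1 / r)) + log_kernel x y"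
proof (cases "x = y")
  case False
  have "\<bar>(c + r * x) - (c + r * y)\<bar> = r * \<bar>x - y\<bar>"
    using assms by (simp add: abs_mult flip: right_diff_distrib)
  moreover have "0 \<le> ln (1 / r)" "0 \<le> ln (2 / \<bar>x - y\<bar>)"
    using assms False by (auto intro!: ln_ge_zero simp: field_simps)
  ultimately show ?thesis
    using False assms by (simp add: log_kernel_def ln_div ln_mult algebra_simps flip: ennreal_plus)
qed (simp add: log_kernel_def)

text \<open>The value is \<open>ln 2\<close> minus the logarithm of the capacity
  \<open>r / 2\<close> of the interval.\<close>

lemma potential_arcsine:
  assumes "0 < r" "r \<le> 1" "\<bar>x - c\<bar> \<le> r"
  shows "(\<integral>\<^sup>+t. log_kernel x t \<partial>arcsine c r) = ennreal (ln (4 / r))"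
proof -
  define x' where "x' = (x - c) / r"
  have x': "x = c + r * x'" "\<bar>x'\<bar> \<le> 1" using assms by (auto simp: x'_def)
  have nn: "0 \<le> ln (1 / r)" using assms by (auto intro!: ln_ge_zero simp: field_simps)
  have "log_kernel x (c + r * cos \<theta>) = ennreal (ln (1 / r)) + log_kernel x' (cos \<theta>)" for \<theta>
    unfolding x'(1) using assms x'(2) abs_cos_le_one[of \<theta>]
    by (intro log_kernel_affine) linarith+
  then have "(\<integral>\<^sup>+\<theta>. log_kernel x (c + r * cos \<theta>) * indicator {0..pi} \<theta> \<partial>lborel) =
      (\<integral>\<^sup>+\<theta>. ennreal (ln (1 / r)) * indicator {0..pi} \<theta> \<partial>lborel) + cos_potential x'"
    by (subst nn_integral_add[symmetric]) (auto simp: distrib_right)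
  also have "\<dots> = ennreal (pi * ln (4 / r))"
  proof -
    have "ln (4 / r) = ln (1 / r) + ln 4"
      using assms ln_mult_pos[of "1 / r" 4] by simp
    then have "ennreal (pi * ln (4 / r)) = ennreal (ln (1 / r)) * ennreal pi + ennreal (pi * ln 4)"
      using nn by (simp add: algebra_simps del: ln_inverse flip: ennreal_mult ennreal_plus)
    then show ?thesis
      using cos_potential_eq[OF x'(2)] by (simp add: nn_integral_cmult)
  qed
  finally show ?thesis
    using assms by (simp add: nn_integral_arcsine divide_ennreal ln_ge_zero)
qed

text \<open>Pairing \<theta> with \<open>pi - \<theta>\<close> combines two kernels into
  \<open>ln (4 / (X\<^sup>2 - s\<^sup>2 * (cos \<theta>)\<^sup>2))\<close>, which increases with the
  radius s. So outside the larger interval a concentric arcsine law loses potential when it is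
  contracted. The loss is bounded below uniformly in x, because a strict gain in energy will be
  extracted from it.\<close>

lemma potential_arcsine_less:
  assumes r: "0 < r'" "r' < r" and I: "{c - r..c + r} \<subseteq> {-1..1}" and x: "x \<in> {-1..1}" "r < \<bar>x - c\<bar>"
  shows "(\<integral>\<^sup>+t. log_kernel x t \<partial>arcsine c r') + ennreal (ln (1 + (r\<^sup>2 - r'\<^sup>2) / 8) / 8)
     \<le> (\<integral>\<^sup>+t. log_kernel x t \<partial>arcsine c r)"
proof -
  define X where "X = x - c"
  define \<delta> where "\<delta> = ln (1 + (r\<^sup>2 - r'\<^sup>2) / 8)"
  have rr: "0 < r\<^sup>2 - r'\<^sup>2" using r by (simp add: power_strict_mono)
  then have \<delta>: "0 \<le> \<delta>" by (simp add: \<delta>_def)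
  let ?K = "\<lambda>s \<theta>. log_kernel x (c + s * cos \<theta>)"
  let ?S = "\<lambda>s. (\<integral>\<^sup>+\<theta>. ?K s \<theta> * indicator {0..pi} \<theta> \<partial>lborel)"
  have c: "\<bar>c\<bar> + r \<le> 1" using I r by (auto simp: abs_if)
  have sym: "2 * ?S s = (\<integral>\<^sup>+\<theta>. (?K s \<theta> + log_kernel x (c - s * cos \<theta>)) * indicator {0..pi} \<theta> \<partial>lborel)" for s
  proof -
    have "?S s = (\<integral>\<^sup>+\<theta>. log_kernel x (c - s * cos \<theta>) * indicator {0..pi} \<theta> \<partial>lborel)"
      by (subst nn_integral_real_affine[where c = "-1" and t = pi])
         (auto simp: indicator_def intro!: nn_integral_cong)
    then show ?thesis
      by (simp add: distrib_right nn_integral_add mult_2)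
  qed
  have sum: "?K s \<theta> + log_kernel x (c - s * cos \<theta>) = ennreal (ln (4 / (X\<^sup>2 - s\<^sup>2 * (cos \<theta>)\<^sup>2)))"
      and less: "s\<^sup>2 * (cos \<theta>)\<^sup>2 < X\<^sup>2"
    if "0 < s" "s \<le> r" for s \<theta>
  proof -
    define v where "v = s * cos \<theta>"
    have v: "\<bar>v\<bar> \<le> s" using that by (simp add: v_def abs_mult mult_left_le)
    have vX: "\<bar>v\<bar> < \<bar>X\<bar>" using v that x(2) by (simp add: X_def)
    then show less: "s\<^sup>2 * (cos \<theta>)\<^sup>2 < X\<^sup>2"
      using power_strict_mono[OF vX, of 2] by (simp add: v_def power_mult_distrib)
    have ne: "X - v \<noteq> 0" "X + v \<noteq> 0" using vX by auto
    have "\<bar>X - v\<bar> \<le> 2" "\<bar>X + v\<bar> \<le> 2" using v c that x by (auto simp: X_def abs_if split: if_splits)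
    then have nn: "0 \<le> ln (2 / \<bar>X - v\<bar>)" "0 \<le> ln (2 / \<bar>X + v\<bar>)"
      using ne by (auto intro!: ln_ge_zero simp: field_simps)
    have "ln (4 / (X\<^sup>2 - s\<^sup>2 * (cos \<theta>)\<^sup>2)) = ln (2 / \<bar>X - v\<bar>) + ln (2 / \<bar>X + v\<bar>)"
    proof -
      have "X\<^sup>2 - s\<^sup>2 * (cos \<theta>)\<^sup>2 = \<bar>X - v\<bar> * \<bar>X + v\<bar>"
        using less by (simp add: v_def flip: abs_mult) (simp add: power2_eq_square algebra_simps)
      then have "4 / (X\<^sup>2 - s\<^sup>2 * (cos \<theta>)\<^sup>2) = (2 / \<bar>X - v\<bar>) * (2 / \<bar>X + v\<bar>)" by simp
      then show ?thesis using ne ln_mult_pos[of "2 / \<bar>X - v\<bar>" "2 / \<bar>X + v\<bar>"] by simp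
    qed
    moreover have "log_kernel x (c + v) = ennreal (ln (2 / \<bar>X - v\<bar>))" "log_kernel x (c - v) = ennreal (ln (2 / \<bar>X + v\<bar>))"
      using ne by (auto simp: X_def log_kernel_def algebra_simps)
    ultimately show "?K s \<theta> + log_kernel x (c - s * cos \<theta>) = ennreal (ln (4 / (X\<^sup>2 - s\<^sup>2 * (cos \<theta>)\<^sup>2)))"
      using nn by (simp add: v_def[symmetric] flip: ennreal_plus)
  qed
  have X2: "X\<^sup>2 \<le> 4" using x c r power_mono[of "\<bar>X\<bar>" 2 2] by (auto simp: X_def)
  \<comment> \<open>The gain is claimed only for angles up to \<open>pi / 4\<close>, where the
    squared cosine is at least 1/2. With the denominator at most 4, the ratio of the two arguments
    is then at least 1 + (r^2 - r'^2) / 8.\<close>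
  have pt: "(?K r' \<theta> + log_kernel x (c - r' * cos \<theta>)) * indicator {0..pi} \<theta> + ennreal \<delta> * indicator {0..pi/4} \<theta>
      \<le> (?K r \<theta> + log_kernel x (c - r * cos \<theta>)) * indicator {0..pi} \<theta>" for \<theta>
  proof -
    let ?k = "(cos \<theta>)\<^sup>2"
    have k: "0 \<le> ?k" "?k \<le> 1" by (simp_all add: abs_square_le_1)
    have A: "0 < X\<^sup>2 - r\<^sup>2 * ?k" "0 < X\<^sup>2 - r'\<^sup>2 * ?k" using less[of r \<theta>] less[of r' \<theta>] r by auto
    have A4: "X\<^sup>2 - r\<^sup>2 * ?k \<le> 4" "X\<^sup>2 - r'\<^sup>2 * ?k \<le> 4" using X2 k by (auto intro: order_trans[of _ "X\<^sup>2"])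
    have le: "r'\<^sup>2 * ?k \<le> r\<^sup>2 * ?k" using rr k by (intro mult_right_mono) auto
    have nn: "0 \<le> ln (4 / (X\<^sup>2 - r'\<^sup>2 * ?k))" using A A4 by (auto intro!: ln_ge_zero simp: field_simps)
    have mono: "ln (4 / (X\<^sup>2 - r'\<^sup>2 * ?k)) \<le> ln (4 / (X\<^sup>2 - r\<^sup>2 * ?k))"
      using A le by (intro ln_mono divide_left_mono) auto
    have strict: "ln (4 / (X\<^sup>2 - r'\<^sup>2 * ?k)) + \<delta> \<le> ln (4 / (X\<^sup>2 - r\<^sup>2 * ?k))" if "\<theta> \<in> {0..pi/4}"
    proof -
      have "cos (pi / 4) \<le> cos \<theta>" using that by (intro cos_monotone_0_pi_le) auto
      then have "(cos (pi / 4))\<^sup>2 \<le> ?k" by (intro power_mono) (auto simp: cos_45)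
      then have k2: "1 / 2 \<le> ?k" by (simp add: cos_45 power_divide)
      have "(r\<^sup>2 - r'\<^sup>2) / 8 \<le> (r\<^sup>2 - r'\<^sup>2) * ?k / 4"
        using mult_left_mono[OF k2, of "(r\<^sup>2 - r'\<^sup>2) / 4"] rr by simp
      also have "\<dots> \<le> (r\<^sup>2 - r'\<^sup>2) * ?k / (X\<^sup>2 - r\<^sup>2 * ?k)"
        using rr k A A4 by (intro divide_left_mono mult_nonneg_nonneg) auto
      finally have "1 + (r\<^sup>2 - r'\<^sup>2) / 8 \<le> (X\<^sup>2 - r'\<^sup>2 * ?k) / (X\<^sup>2 - r\<^sup>2 * ?k)"
        using A by (simp add: field_simps)
      then have "\<delta> \<le> ln ((X\<^sup>2 - r'\<^sup>2 * ?k) / (X\<^sup>2 - r\<^sup>2 * ?k))"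
        unfolding \<delta>_def using rr A by (intro ln_mono) (auto intro: add_pos_nonneg)
      then show ?thesis using A by (simp add: ln_div)
    qed
    show ?thesis
      using strict mono nn \<delta> r pi_gt_zero
      by (cases "\<theta> \<in> {0..pi/4}"; cases "\<theta> \<in> {0..pi}")
         (auto simp: sum indicator_def ennreal_leI simp flip: ennreal_plus)
  qed
  \<comment> \<open>An interval of length \<open>pi / 4\<close>, halved by the pairing, contributes
    \<open>pi / 8 * \<delta>\<close>; dividing by \<open>pi\<close> leaves the asserted
    \<open>\<delta> / 8\<close>.\<close>
  have "2 * (?S r' + ennreal (pi / 8 * \<delta>)) = 2 * ?S r' + (\<integral>\<^sup>+\<theta>. ennreal \<delta> * indicator {0..pi/4} \<theta> \<partial>lborel)"
    using \<delta> by (simp add: distrib_left nn_integral_cmult field_simps flip: ennreal_mult ennreal_numeral)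
  also have "\<dots> = (\<integral>\<^sup>+\<theta>. (?K r' \<theta> + log_kernel x (c - r' * cos \<theta>)) * indicator {0..pi} \<theta> + ennreal \<delta> * indicator {0..pi/4} \<theta> \<partial>lborel)"
    unfolding sym by (intro nn_integral_add[symmetric]) measurable
  also have "\<dots> \<le> (\<integral>\<^sup>+\<theta>. (?K r \<theta> + log_kernel x (c - r * cos \<theta>)) * indicator {0..pi} \<theta> \<partial>lborel)"
    by (intro nn_integral_mono pt)
  also have "\<dots> = 2 * ?S r" by (rule sym[symmetric])
  finally have "?S r' + ennreal (pi / 8 * \<delta>) \<le> ?S r"
    by (subst (asm) ennreal_mult_le_mult_iff) auto
  then have "(?S r' + ennreal (pi / 8 * \<delta>)) / ennreal pi \<le> ?S r / ennreal pi"
    by (rule divide_right_mono_ennreal)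
  moreover have "(?S r' + ennreal (pi / 8 * \<delta>)) / ennreal pi = ?S r' / ennreal pi + ennreal (\<delta> / 8)"
    using \<delta> by (simp add: add_divide_distrib_ennreal divide_ennreal)
  ultimately show ?thesis
    by (simp add: nn_integral_arcsine \<delta>_def)
qed

section \<open>Transfer to the real line\<close>

lemma kneg_eq: "kneg z w = max 0 (ln (cmod (z - w)))"
  by (simp add: kneg_def)

lemma measurable_kneg [measurable]:
  assumes [measurable]: "f \<in> borel_measurable M" "g \<in> borel_measurable M"
  shows "(\<lambda>x. kneg (f x) (g x)) \<in> borel_measurable M"
  unfolding kneg_eq by measurable

lemma measurable_kpos [measurable]:
  assumes [measurable]: "f \<in> borel_measurable M" "g \<in> borel_measurable M"
  shows "(\<lambda>x. kpos (f x) (g x)) \<in> borel_measurable M"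
  unfolding kpos_def by measurable

text \<open>Both sides express the logarithm of the reciprocal distance; negative parts are moved
  across so that the identity also holds on the diagonal, where both sides are infinite.\<close>

lemma kpos_kneg_log_kernel:
  assumes "\<bar>x - y\<bar> \<le> 2"
  shows "kpos (complex_of_real x) (complex_of_real y) + ennreal (ln 2) =
    log_kernel x y + ennreal (kneg (complex_of_real x) (complex_of_real y))"
proof (cases "x = y")
  case False
  have cm: "cmod (complex_of_real x - complex_of_real y) = \<bar>x - y\<bar>"
    by (simp flip: of_real_diff)
  have "0 \<le> ln (2 / \<bar>x - y\<bar>)" using assms False by (auto intro!: ln_ge_zero simp: field_simps)
  moreover have "ln (2 / \<bar>x - y\<bar>) = ln 2 - ln \<bar>x - y\<bar>" using False by (simp add: ln_div)
  ultimately show ?thesis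
    using False by (simp add: kpos_def kneg_eq log_kernel_def cm max_def flip: ennreal_plus)
qed (simp add: kpos_def log_kernel_def)

definition real_prob_on :: "real measure \<Rightarrow> real set \<Rightarrow> bool" where
  "real_prob_on m K \<longleftrightarrow> prob_space m \<and> sets m = sets borel \<and> (AE x in m. x \<in> K)"

lemma real_prob_on_prob_space: "real_prob_on m K \<Longrightarrow> prob_space m"
  and real_prob_on_finite_measure: "real_prob_on m K \<Longrightarrow> finite_measure m"
  and real_prob_on_sets: "real_prob_on m K \<Longrightarrow> sets m = sets borel"
  and real_prob_on_AE: "real_prob_on m K \<Longrightarrow> AE x in m. x \<in> K"
  by (simp_all add: real_prob_on_def prob_space_def)

lemma borel_cset:
  assumes "closed K"
  shows "cset K \<in> sets borel"
proof -
  have "cset K = Re -` K \<inter> Im -` {0}"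
    by (auto simp: image_iff complex_eq_iff)
  moreover have "closed (Re -` K \<inter> Im -` {0})"
    using assms by (intro closed_Int closed_vimage) (auto intro: continuous_intros)
  ultimately show ?thesis by simp
qed

text \<open>Converts identities between sums of nonnegative terms into the differences by which
  \<open>log_potential\<close> and \<open>log_energy\<close> are defined.\<close>

lemma enn2ereal_diff_shift:
  assumes "A + ennreal a = B + ennreal b" "0 \<le> a" "0 \<le> b"
  shows "enn2ereal A - ereal b = enn2ereal B - ereal a"
proof -
  have "enn2ereal A + ereal a = enn2ereal B + ereal b"
    using arg_cong[OF assms(1), of enn2ereal] assms(2,3) by (simp add: plus_ennreal.rep_eq enn2ereal_ennreal)
  then show ?thesis by (cases "enn2ereal A"; cases "enn2ereal B") auto
qed

definition real_marginal :: "complex measure \<Rightarrow> real measure" where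
  "real_marginal \<mu> = distr \<mu> borel Re"

section \<open>Measures on a closed subset of [-1, 1]\<close>

locale interval_measure =
  fixes \<mu> :: "complex measure" and K :: "real set"
  assumes prob: "prob_on \<mu> (cset K)" and closed: "closed K" and K: "K \<subseteq> {-1..1}"
begin

lemma sets_\<mu> [simp, measurable_cong]: "sets \<mu> = sets borel"
  using prob by (simp add: prob_on_def)

lemma space_\<mu> [simp]: "space \<mu> = UNIV"
  using sets_eq_imp_space_eq[OF sets_\<mu>] by simp

sublocale prob_space \<mu>
  by (rule prob_spaceI) (use prob in \<open>simp add: prob_on_def\<close>)

lemma AE_cset: "AE z in \<mu>. \<exists>x\<in>K. z = complex_of_real x"
proof (rule AE_I')
  show "UNIV - cset K \<in> null_sets \<mu>"
    using prob borel_cset[OF closed] by (auto simp: prob_on_def null_sets_def)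
qed auto

abbreviation m where "m \<equiv> real_marginal \<mu>"

lemma sets_m [simp, measurable_cong]: "sets m = sets borel"
  by (simp add: real_marginal_def)

lemma real_prob_on_m: "real_prob_on m K"
proof -
  have "prob_space m" unfolding real_marginal_def by (rule prob_space_distr) simp
  moreover have "AE x in m. x \<in> K"
    unfolding real_marginal_def using closed AE_cset
    by (subst AE_distr_iff) auto
  ultimately show ?thesis by (simp add: real_prob_on_def)
qed

lemma nn_integral_m: "f \<in> borel_measurable borel \<Longrightarrow> (\<integral>\<^sup>+x. f x \<partial>m) = (\<integral>\<^sup>+z. f (Re z) \<partial>\<mu>)"
  unfolding real_marginal_def by (rule nn_integral_distr) auto

lemma integral_kneg:
  assumes "x \<in> {-1..1}"
  shows "ennreal (\<integral>w. kneg (complex_of_real x) w \<partial>\<mu>) = (\<integral>\<^sup>+w. ennreal (kneg (complex_of_real x) w) \<partial>\<mu>)"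
    and "0 \<le> (\<integral>w. kneg (complex_of_real x) w \<partial>\<mu>)" "(\<integral>w. kneg (complex_of_real x) w \<partial>\<mu>) \<le> ln 2"
proof -
  have bd: "AE w in \<mu>. kneg (complex_of_real x) w \<le> ln 2"
    using AE_cset
  proof eventually_elim
    case (elim w)
    then obtain y where y: "y \<in> K" "w = complex_of_real y" by auto
    have "\<bar>x - y\<bar> \<le> 2" using assms y K by (auto simp: abs_le_iff dest!: subsetD)
    then have "cmod (complex_of_real x - w) \<le> 2" using y by (simp flip: of_real_diff)
    then show ?case by (cases "complex_of_real x = w") (auto simp: kneg_eq intro!: ln_mono)
  qed
  have int: "integrable \<mu> (kneg (complex_of_real x))"
    by (rule integrable_const_bound[where B = "ln 2"]) (use bd in \<open>auto simp: kneg_eq\<close>)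
  show "ennreal (\<integral>w. kneg (complex_of_real x) w \<partial>\<mu>) = (\<integral>\<^sup>+w. ennreal (kneg (complex_of_real x) w) \<partial>\<mu>)"
    by (rule nn_integral_eq_integral[symmetric, OF int]) (auto simp: kneg_eq)
  show "0 \<le> (\<integral>w. kneg (complex_of_real x) w \<partial>\<mu>)"
    by (rule integral_nonneg_AE) (auto simp: kneg_eq)
  show "(\<integral>w. kneg (complex_of_real x) w \<partial>\<mu>) \<le> ln 2"
    using integral_mono_AE[OF int, of "\<lambda>_. ln 2"] bd prob_space by simp
qed

lemma nn_integral_kpos:
  assumes "x \<in> {-1..1}"
  shows "(\<integral>\<^sup>+w. kpos (complex_of_real x) w \<partial>\<mu>) + ennreal (ln 2) =
     (\<integral>\<^sup>+y. log_kernel x y \<partial>m) + ennreal (\<integral>w. kneg (complex_of_real x) w \<partial>\<mu>)"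
proof -
  have "(\<integral>\<^sup>+w. kpos (complex_of_real x) w \<partial>\<mu>) + ennreal (ln 2) =
      (\<integral>\<^sup>+w. kpos (complex_of_real x) w + ennreal (ln 2) \<partial>\<mu>)"
    by (subst nn_integral_add) (auto simp: emeasure_space_1[simplified])
  also have "\<dots> = (\<integral>\<^sup>+w. log_kernel x (Re w) + ennreal (kneg (complex_of_real x) w) \<partial>\<mu>)"
  proof (rule nn_integral_cong_AE)
    show "AE w in \<mu>. kpos (complex_of_real x) w + ennreal (ln 2) = log_kernel x (Re w) + ennreal (kneg (complex_of_real x) w)"
      using AE_cset
    proof eventually_elim
      case (elim w)
      then obtain y where y: "y \<in> K" "w = complex_of_real y" by auto
      have "\<bar>x - y\<bar> \<le> 2" using assms y K by (auto simp: abs_le_iff dest!: subsetD)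
      then show ?case using kpos_kneg_log_kernel[of x y] y by simp
    qed
  qed
  also have "\<dots> = (\<integral>\<^sup>+y. log_kernel x y \<partial>m) + (\<integral>\<^sup>+w. ennreal (kneg (complex_of_real x) w) \<partial>\<mu>)"
    by (subst nn_integral_add) (auto simp: nn_integral_m)
  finally show ?thesis by (simp add: integral_kneg[OF assms])
qed

lemma log_potential_eq:
  assumes "x \<in> {-1..1}"
  shows "log_potential \<mu> (complex_of_real x) = enn2ereal (\<integral>\<^sup>+y. log_kernel x y \<partial>m) - ereal (ln 2)"
  unfolding log_potential_def
  by (intro enn2ereal_diff_shift nn_integral_kpos integral_kneg assms) simp

lemma log_energy_eq: "log_energy \<mu> = enn2ereal (mutual_energy m m) - ereal (ln 2)"
proof -
  have AEK: "AE z in \<mu>. z = complex_of_real (Re z) \<and> Re z \<in> {-1..1}"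
    using AE_cset by eventually_elim (use K in auto)
  have [measurable]: "(\<lambda>z. \<integral>w. kneg z w \<partial>\<mu>) \<in> borel_measurable borel"
    by measurable
  have [measurable]: "(\<lambda>x. \<integral>\<^sup>+y. log_kernel x y \<partial>m) \<in> borel_measurable borel"
  proof -
    interpret m: prob_space m using real_prob_on_m by (simp add: real_prob_on_def)
    show ?thesis by measurable
  qed
  have bd: "AE z in \<mu>. 0 \<le> (\<integral>w. kneg z w \<partial>\<mu>) \<and> (\<integral>w. kneg z w \<partial>\<mu>) \<le> ln 2"
    using AEK by eventually_elim (metis integral_kneg(2,3))
  have int: "integrable \<mu> (\<lambda>z. \<integral>w. kneg z w \<partial>\<mu>)"
    by (rule integrable_const_bound[where B = "ln 2"]) (use bd in auto)
  have kn: "ennreal (\<integral>z. (\<integral>w. kneg z w \<partial>\<mu>) \<partial>\<mu>) = (\<integral>\<^sup>+z. ennreal (\<integral>w. kneg z w \<partial>\<mu>) \<partial>\<mu>)"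
    by (rule nn_integral_eq_integral[symmetric, OF int]) (use bd in auto)
  have "(\<integral>\<^sup>+z. (\<integral>\<^sup>+w. kpos z w \<partial>\<mu>) \<partial>\<mu>) + ennreal (ln 2) = (\<integral>\<^sup>+z. (\<integral>\<^sup>+w. kpos z w \<partial>\<mu>) + ennreal (ln 2) \<partial>\<mu>)"
    by (subst nn_integral_add) (auto simp: emeasure_space_1[simplified])
  also have "\<dots> = (\<integral>\<^sup>+z. (\<integral>\<^sup>+y. log_kernel (Re z) y \<partial>m) + ennreal (\<integral>w. kneg z w \<partial>\<mu>) \<partial>\<mu>)"
    by (rule nn_integral_cong_AE) (use AEK in \<open>eventually_elim, metis nn_integral_kpos\<close>)
  also have "\<dots> = mutual_energy m m + ennreal (\<integral>z. (\<integral>w. kneg z w \<partial>\<mu>) \<partial>\<mu>)"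
    unfolding kn mutual_energy_def by (subst nn_integral_add) (auto simp: nn_integral_m)
  finally show ?thesis
    unfolding log_energy_def
    by (rule enn2ereal_diff_shift) (use bd in \<open>auto intro!: integral_nonneg_AE\<close>)
qed

end

text \<open>Measures on the line, pushed into the plane, are the competitors that bound
  \<open>robin\<close> from above.\<close>

lemma prob_on_distr_of_real:
  assumes m: "real_prob_on m K" and K: "closed K" "K \<subseteq> {-1..1}"
  defines "\<mu> \<equiv> distr m borel complex_of_real"
  shows "prob_on \<mu> (cset K)" "log_energy \<mu> = enn2ereal (mutual_energy m m) - ereal (ln 2)"
proof -
  interpret m: prob_space m using m by (simp add: real_prob_on_def)
  have [simp, measurable_cong]: "sets m = sets borel" using m by (simp add: real_prob_on_def)
  have [simp]: "space m = UNIV" using sets_eq_imp_space_eq[of m borel] by simp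
  interpret \<mu>: prob_space \<mu> unfolding \<mu>_def by (rule m.prob_space_distr) simp
  have csb: "cset K \<in> sets borel" using K by (intro borel_cset)
  have "AE x in m. \<not> complex_of_real x \<in> UNIV - cset K"
    using real_prob_on_AE[OF m] by eventually_elim auto
  then have "emeasure m (complex_of_real -` (UNIV - cset K) \<inter> space m) = 0"
    using csb by (subst (asm) AE_iff_measurable[OF _ refl]) (auto simp: vimage_def Int_def cong: conj_cong)
  then show P: "prob_on \<mu> (cset K)"
    using csb \<mu>.emeasure_space_1 by (auto simp: prob_on_def \<mu>_def emeasure_distr)
  interpret interval_measure \<mu> K
    using P K by unfold_locales
  have "real_marginal \<mu> = m"
    unfolding real_marginal_def \<mu>_def by (subst distr_distr) (auto simp: o_def intro!: distr_id2)
  then show "log_energy \<mu> = enn2ereal (mutual_energy m m) - ereal (ln 2)"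
    using log_energy_eq by simp
qed

section \<open>Pulling back the arcsine law under a polynomial\<close>

lemma AE_arcsine_notin_finite:
  assumes "finite F"
  shows "AE y in arcsine 0 1. y \<in> {-1<..<1} - F"
proof -
  have fin: "finite (arccos ` (F \<union> {-1, 1}))" using assms by simp
  have "AE \<theta> in lborel. \<theta> \<notin> arccos ` (F \<union> {-1, 1})"
    by (rule AE_not_in) (use fin finite_imp_null_set_lborel in blast)
  then have "AE \<theta> in uniform_measure lborel {0..pi}. \<theta> \<in> {0..pi} \<and> \<theta> \<notin> arccos ` (F \<union> {-1, 1})"
    by (intro AE_uniform_measureI) auto
  then have "AE \<theta> in uniform_measure lborel {0..pi}. 0 + 1 * cos \<theta> \<in> {-1<..<1} - F"
  proof eventually_elim
    case (elim \<theta>)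
    have "\<theta> = arccos (cos \<theta>)" using elim by (simp add: arccos_cos)
    then have "cos \<theta> \<notin> F \<union> {-1, 1}" using elim by (metis imageI)
    moreover have "- 1 \<le> cos \<theta>" "cos \<theta> \<le> 1" by auto
    ultimately show ?case by (auto simp: less_le)
  qed
  moreover have "F \<in> sets borel" using assms by (intro borel_closed finite_imp_closed)
  ultimately show ?thesis
    unfolding arcsine_def by (subst AE_distr_iff) auto
qed

text \<open>The leading terms cancel in the difference of the two sides, which thus has degree below
  \<open>card S\<close> if nonzero, yet vanishes on S.\<close>

lemma poly_eq_smult_prod_roots:
  fixes p :: "'a :: idom poly"
  assumes "finite S" "card S = degree p" "\<And>r. r \<in> S \<Longrightarrow> poly p r = 0"
  shows "p = smult (lead_coeff p) (\<Prod>r\<in>S. [:-r, 1:])"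
proof (rule ccontr)
  define g where "g = (\<Prod>r\<in>S. [:-r, 1:])"
  define q where "q = p - smult (lead_coeff p) g"
  assume "p \<noteq> smult (lead_coeff p) (\<Prod>r\<in>S. [:-r, 1:])"
  then have q: "q \<noteq> 0" by (simp add: q_def g_def)
  have dg: "degree g = degree p"
    unfolding g_def assms(2)[symmetric] by (subst degree_prod_eq_sum_degree) auto
  have lg: "lead_coeff g = 1"
    unfolding g_def by (simp add: lead_coeff_prod)
  have "degree q \<le> degree p"
    unfolding q_def by (intro degree_diff_le) (auto simp: dg degree_smult_le[THEN order_trans])
  moreover have "coeff q (degree p) = 0"
    using lg by (simp add: q_def dg)
  ultimately have less: "degree q < degree p"
    using q by (metis le_neq_implies_less leading_coeff_0_iff)
  have "S \<subseteq> {x. poly q x = 0}"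
    using assms(1,3) by (auto simp: q_def g_def poly_prod prod_zero_iff)
  then have "card S \<le> card {x. poly q x = 0}"
    by (intro card_mono poly_roots_finite q)
  also have "\<dots> \<le> degree q" by (rule card_poly_roots_bound[OF q])
  finally show False using less assms(2) by simp
qed

lemma borel_measurable_poly [measurable]: "poly (p :: real poly) \<in> borel_measurable borel"
  by (intro borel_measurable_continuous_onI continuous_intros)

text \<open>The push-forward of the arcsine law under all local inverses of \<open>R\<close>; these are taken on
  the pieces of the line that are cut out by the critical points of \<open>R\<close>.\<close>

lemma polynomial_pullback_exists:
  fixes R :: "real poly"
  assumes d: "0 < degree R"
  obtains \<nu> where "sets \<nu> = sets borel"
    "\<And>f. f \<in> borel_measurable borel \<Longrightarrow>
       (\<integral>\<^sup>+x. f x \<partial>\<nu>) = ennreal (1 / degree R) * (\<integral>\<^sup>+y. (\<Sum>x | poly R x = y. f x) \<partial>arcsine 0 1)"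
proof -
  define Z where "Z = {x. poly (pderiv R) x = 0}"
  have "pderiv R \<noteq> 0" using d by (simp add: pderiv_eq_0_iff)
  then have Z: "finite Z" unfolding Z_def by (rule poly_roots_finite)
  define N where "N = card Z"
  \<comment> \<open>The number of critical points to the left labels the components of the
    complement of \<open>Z\<close>; by the mean value theorem R is injective on each of
    them.\<close>
  define J where "J k = {x. x \<notin> Z \<and> card {z\<in>Z. z < x} = k}" for k
  have same: "{z\<in>Z. z < x} = {z\<in>Z. z < y}" if "x \<in> J k" "y \<in> J k" "x \<le> y" for x y k
    using that Z by (intro card_subset_eq) (auto simp: J_def)
  have int: "is_interval (J k)" for k
    unfolding is_interval_1
  proof (intro ballI allI impI)
    fix x y t assume "x \<in> J k" "y \<in> J k" "x \<le> t \<and> t \<le> y"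
    then have xy: "x \<in> J k" "y \<in> J k" "x \<le> t" "t \<le> y" by auto
    have eq: "{z\<in>Z. z < x} = {z\<in>Z. z < y}" using same[of x k y] xy by auto
    have "t \<notin> Z"
    proof
      assume "t \<in> Z"
      then have "t \<noteq> y" "t \<noteq> x" using xy by (auto simp: J_def)
      then have "t < y" "x < t" using xy by auto
      then have "t \<in> {z\<in>Z. z < y}" using \<open>t \<in> Z\<close> by simp
      then show False unfolding eq[symmetric] using \<open>x < t\<close> by simp
    qed
    moreover have "{z\<in>Z. z < t} = {z\<in>Z. z < x}"
    proof
      show "{z\<in>Z. z < t} \<subseteq> {z\<in>Z. z < x}" unfolding eq using xy by auto
    qed (use xy in auto)
    ultimately show "t \<in> J k" using xy by (simp add: J_def)
  qed
  have ne: "poly R x \<noteq> poly R y" if xy: "x \<in> J k" "y \<in> J k" "x < y" for x y k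
  proof
    assume "poly R x = poly R y"
    moreover obtain z where z: "x < z" "z < y" "poly R y - poly R x = (y - x) * poly (pderiv R) z"
      using poly_MVT[OF xy(3)] by blast
    ultimately have "z \<in> {z\<in>Z. z < y}" using xy(3) by (simp add: Z_def)
    then show False unfolding same[OF xy(1,2) less_imp_le[OF xy(3)], symmetric] using z by simp
  qed
  have inj: "inj_on (poly R) (J k)" for k
    by (rule inj_onI) (metis ne linorder_neqE_linordered_idom)
  have cover: "x \<in> J (card {z\<in>Z. z < x})" "card {z\<in>Z. z < x} \<le> N" if "x \<notin> Z" for x
    using that Z by (auto simp: J_def N_def intro: card_mono)
  \<comment> \<open>The default 0 off the image of the piece has no effect: the density
    \<open>?w\<close> vanishes there.\<close>
  define g where "g k y = (if y \<in> poly R ` J k then inv_into (J k) (poly R) y else 0)" for k y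
  have gJ: "g k (poly R x) = x" if "x \<in> J k" for k x
    using that inj by (simp add: g_def)
  have image_borel: "poly R ` S \<in> sets borel" if "is_interval S" for S
    using that by (intro real_interval_borel_measurable)
      (auto simp: is_interval_connected_1 intro!: connected_continuous_image continuous_intros)
  have img [measurable]: "poly R ` (J k \<inter> {..a}) \<in> sets borel" for k a
    by (intro image_borel is_interval_Int int) simp
  have imgJ [measurable]: "poly R ` J k \<in> sets borel" for k
    by (intro image_borel int)
  have g_meas [measurable]: "g k \<in> borel_measurable borel" for k
    unfolding borel_measurable_iff_le
  proof
    fix a
    have "g k y \<le> a \<longleftrightarrow> y \<in> poly R ` (J k \<inter> {..a}) \<or> 0 \<le> a \<and> y \<notin> poly R ` J k" for y
    proof (cases "y \<in> poly R ` J k")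
      case True
      then obtain x where x: "x \<in> J k" "y = poly R x" by auto
      have "y \<in> poly R ` (J k \<inter> {..a}) \<longleftrightarrow> x \<in> J k \<inter> {..a}"
        unfolding x(2) by (rule inj_on_image_mem_iff[OF inj]) (use x in auto)
      then show ?thesis using x gJ[OF x(1)] True by auto
    qed (auto simp: g_def)
    then have "{y. g k y \<le> a} = poly R ` (J k \<inter> {..a}) \<union> (if 0 \<le> a then - poly R ` J k else {})"
      by auto
    then show "{w \<in> space borel. g k w \<le> a} \<in> sets borel" by simp
  qed
  interpret A: prob_space "arcsine 0 1" by (rule prob_space_arcsine)
  interpret C: sigma_finite_measure "count_space {..N}"
    by (rule sigma_finite_measure_count_space_finite) simp
  let ?M = "count_space {..N} \<Otimes>\<^sub>M arcsine 0 1"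
  let ?w = "\<lambda>(k, y). ennreal (1 / degree R) * indicator (poly R ` J k) y"
  define \<nu> where "\<nu> = distr (density ?M ?w) borel (\<lambda>(k, y). g k y)"
  have [measurable]: "?w \<in> borel_measurable ?M"
    by (rule measurable_pair_measure_countable1) auto
  have [measurable]: "(\<lambda>(k, y). g k y) \<in> borel_measurable ?M"
    by (rule measurable_pair_measure_countable1) auto
  \<comment> \<open>At a critical value the fibre contains points of \<open>Z\<close>, which no
    piece covers. There are finitely many such values and the arcsine law ignores them.\<close>
  have crit: "AE y in arcsine 0 1. y \<notin> poly R ` Z"
    using AE_arcsine_notin_finite[of "poly R ` Z"] Z by auto
  show thesis
  proof
    show "sets \<nu> = sets borel" by (simp add: \<nu>_def)
    fix f :: "real \<Rightarrow> ennreal" assume [measurable]: "f \<in> borel_measurable borel"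
    have "(\<integral>\<^sup>+x. f x \<partial>\<nu>) = (\<integral>\<^sup>+p. ?w p * f (case p of (k, y) \<Rightarrow> g k y) \<partial>?M)"
      unfolding \<nu>_def by (subst nn_integral_distr) (auto simp: nn_integral_density)
    also have "\<dots> = (\<integral>\<^sup>+k. \<integral>\<^sup>+y. ?w (k, y) * f (g k y) \<partial>arcsine 0 1 \<partial>count_space {..N})"
      by (subst A.nn_integral_fst[symmetric]) auto
    also have "\<dots> = (\<Sum>k\<le>N. \<integral>\<^sup>+y. ennreal (1 / degree R) * (indicator (poly R ` J k) y * f (g k y)) \<partial>arcsine 0 1)"
      by (simp add: nn_integral_count_space_finite mult.assoc)
    also have "\<dots> = ennreal (1 / degree R) * (\<Sum>k\<le>N. \<integral>\<^sup>+y. indicator (poly R ` J k) y * f (g k y) \<partial>arcsine 0 1)"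
      by (simp add: nn_integral_cmult sum_distrib_left)
    also have "(\<Sum>k\<le>N. \<integral>\<^sup>+y. indicator (poly R ` J k) y * f (g k y) \<partial>arcsine 0 1) =
        (\<integral>\<^sup>+y. (\<Sum>k\<le>N. indicator (poly R ` J k) y * f (g k y)) \<partial>arcsine 0 1)"
      by (rule nn_integral_sum[symmetric]) measurable
    also have "(\<integral>\<^sup>+y. (\<Sum>k\<le>N. indicator (poly R ` J k) y * f (g k y)) \<partial>arcsine 0 1) =
        (\<integral>\<^sup>+y. (\<Sum>x | poly R x = y. f x) \<partial>arcsine 0 1)"
    proof (rule nn_integral_cong_AE)
      show "AE y in arcsine 0 1. (\<Sum>k\<le>N. indicator (poly R ` J k) y * f (g k y)) = (\<Sum>x | poly R x = y. f x)"
        using crit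
      proof eventually_elim
        case (elim y)
        let ?I = "{k\<in>{..N}. y \<in> poly R ` J k}"
        have gy: "g k y \<in> J k" "poly R (g k y) = y" if "k \<in> ?I" for k
          using that gJ by auto
        have bij: "bij_betw (\<lambda>k. g k y) ?I {x. poly R x = y}"
          unfolding bij_betw_def
        proof
          show "inj_on (\<lambda>k. g k y) ?I"
          proof (rule inj_onI)
            fix k l assume "k \<in> ?I" "l \<in> ?I" "g k y = g l y"
            then show "k = l" using gy(1)[of k] gy(1)[of l] by (simp add: J_def)
          qed
          show "(\<lambda>k. g k y) ` ?I = {x. poly R x = y}"
          proof (intro equalityI subsetI)
            fix x assume "x \<in> {x. poly R x = y}"
            then have x: "poly R x = y" "x \<notin> Z" using elim by auto
            show "x \<in> (\<lambda>k. g k y) ` ?I"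
              by (rule image_eqI[of _ _ "card {z\<in>Z. z < x}"]) (use x cover[of x] gJ[OF cover(1)[of x]] in auto)
          qed (use gy in auto)
        qed
        have "(\<Sum>k\<le>N. indicator (poly R ` J k) y * f (g k y)) = (\<Sum>k\<in>{..N}. if y \<in> poly R ` J k then f (g k y) else 0)"
          by (intro sum.cong) (auto simp: indicator_def)
        also have "\<dots> = (\<Sum>k\<in>?I. f (g k y))"
          by (subst sum.inter_filter[symmetric]) auto
        also have "\<dots> = (\<Sum>x | poly R x = y. f x)"
          by (rule sum.reindex_bij_betw[OF bij])
        finally show ?case .
      qed
    qed
    finally show "(\<integral>\<^sup>+x. f x \<partial>\<nu>) = ennreal (1 / degree R) * (\<integral>\<^sup>+y. (\<Sum>x | poly R x = y. f x) \<partial>arcsine 0 1)" .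
  qed
qed

section \<open>Polynomials with full real preimage\<close>

lemma poly_fiber:
  fixes p :: "'a :: idom poly"
  assumes "0 < degree p"
  shows "finite {x. poly p x = y}" "card {x. poly p x = y} \<le> degree p"
proof -
  have eq: "{x. poly p x = y} = {x. poly (p - [:y:]) x = 0}" by auto
  have ne: "p - [:y:] \<noteq> 0" using assms by auto
  show "finite {x. poly p x = y}" unfolding eq by (rule poly_roots_finite[OF ne])
  have "card {x. poly p x = y} \<le> degree (p - [:y:])" unfolding eq by (rule card_poly_roots_bound[OF ne])
  also have "\<dots> \<le> degree p" by (intro degree_diff_le) auto
  finally show "card {x. poly p x = y} \<le> degree p" .
qed

text \<open>\<open>B\<close> is a finite set of exceptional values: empty for the polynomial of an
  alternant, the critical values for a polynomial that comes from a preimage representation of K.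
  For the other values y in (-1, 1) all solutions are real and distinct, so \<open>R - y\<close>
  splits over a set of points in [-1, 1].\<close>

locale full_preimage =
  fixes R :: "real poly" and B :: "real set"
  assumes degree_pos: "0 < degree R" and finite_B: "finite B"
    and card_fiber: "y \<in> {-1<..<1} - B \<Longrightarrow> card {x. poly R x = y} = degree R"
    and fiber_subset: "y \<in> {-1<..<1} - B \<Longrightarrow> {x. poly R x = y} \<subseteq> {-1..1}"
begin

lemma finite_fiber: "finite {x. poly R x = y}"
  using degree_pos by (rule poly_fiber)

lemma factorization:
  assumes "y \<in> {-1<..<1} - B"
  shows "R - [:y:] = smult (lead_coeff R) (\<Prod>r | poly R r = y. [:-r, 1:])"
proof -
  have deg: "degree (R - [:y:]) = degree R"
    using degree_pos degree_add_eq_left[of "- [:y:]" R] by (simp del: minus_pCons)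
  have "lead_coeff (R - [:y:]) = lead_coeff R"
    using degree_pos by (simp only: deg coeff_diff) (simp add: coeff_pCons split: nat.split)
  then show ?thesis
    using poly_eq_smult_prod_roots[of "{r. poly R r = y}" "R - [:y:]"] card_fiber[OF assms] finite_fiber[of y] deg by simp
qed

lemma poly_diff_eq_prod:
  assumes "y \<in> {-1<..<1} - B"
  shows "poly R x - y = lead_coeff R * (\<Prod>r | poly R r = y. x - r)"
  using arg_cong[OF factorization[OF assms], of "\<lambda>p. poly p x"] by (simp add: poly_prod)

text \<open>The preimage of [-1, 1] has capacity
  \<open>(2 * \<bar>lead_coeff R\<bar>) powr (- 1 / degree R)\<close>; \<open>level\<close> is
  \<open>ln 2\<close> minus the logarithm of this number.\<close>

definition level :: real where "level = ln 2 + ln (2 * \<bar>lead_coeff R\<bar>) / degree R"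

text \<open>Take x with R x = y1 > 1/2 and factor R - y2 for some y2 < -1/2: the value at x has
  modulus at least 1, while all factors are at most 2. The bound keeps the constants of the
  potential computation nonnegative, so that \<open>ennreal\<close> does not truncate them.\<close>

lemma lead_coeff_bound: "1 \<le> 2 ^ degree R * \<bar>lead_coeff R\<bar>"
proof -
  have "infinite ({1/2<..<1::real} - B)" "infinite ({-1<..<-1/2::real} - B)"
    using finite_B by (auto intro!: Diff_infinite_finite simp: infinite_Ioo)
  then obtain y1 y2 where y: "y1 \<in> {1/2<..<1} - B" "y2 \<in> {-1<..<-1/2} - B"
    by (metis ex_in_conv finite.emptyI)
  then have good: "y1 \<in> {-1<..<1} - B" "y2 \<in> {-1<..<1} - B" by auto
  have "{x. poly R x = y1} \<noteq> {}" using card_fiber[OF good(1)] degree_pos by (metis card.empty less_numeral_extra(3))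
  then obtain x where x: "poly R x = y1" by auto
  then have "x \<in> {-1..1}" using fiber_subset[OF good(1)] by auto
  have "\<bar>x - r\<bar> \<le> 2" if "poly R r = y2" for r
    using fiber_subset[OF good(2)] \<open>x \<in> {-1..1}\<close> that by (auto simp: abs_le_iff dest!: subsetD)
  then have "(\<Prod>r | poly R r = y2. \<bar>x - r\<bar>) \<le> (\<Prod>r | poly R r = y2. 2)"
    by (intro prod_mono) auto
  then have "(\<Prod>r | poly R r = y2. \<bar>x - r\<bar>) \<le> 2 ^ degree R"
    using card_fiber[OF good(2)] by simp
  moreover have "1 \<le> \<bar>poly R x - y2\<bar>" using x y by auto
  ultimately show ?thesis
    unfolding poly_diff_eq_prod[OF good(2)] abs_mult abs_prod
    by (smt (verit) abs_ge_zero mult.commute mult_left_mono)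
qed

lemma ln_lead_coeff_bound: "0 \<le> degree R * ln 2 + ln \<bar>lead_coeff R\<bar>"
proof -
  have "0 \<le> ln (2 ^ degree R * \<bar>lead_coeff R\<bar>)" using lead_coeff_bound by simp
  also have "\<dots> = degree R * ln 2 + ln \<bar>lead_coeff R\<bar>"
    using degree_pos by (subst ln_mult_pos) (auto simp: ln_realpow)
  finally show ?thesis .
qed

lemma level_pos: "0 < level"
proof -
  have "0 < degree R * ln 2 + ln (2 * \<bar>lead_coeff R\<bar>)"
    using degree_pos ln_gt_zero[of "2::real"] ln_lead_coeff_bound
    by (subst ln_mult_pos) (auto simp del: ln_gt_zero_iff)
  also have "\<dots> = degree R * level" using degree_pos by (simp add: level_def field_simps)
  finally show ?thesis using degree_pos by (simp add: zero_less_mult_iff)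
qed

text \<open>The logarithm of the factorization of R x - y. Each of the \<open>degree R\<close>
  kernels on the left carries its own \<open>ln 2\<close>, the one on the right a single
  \<open>ln 2\<close>. In the form of sums the identity includes R x = y, where both sides are
  infinite.\<close>

lemma sum_log_kernel_fiber:
  assumes y: "y \<in> {-1<..<1} - B" and x: "x \<in> {-1..1}" "\<bar>poly R x\<bar> \<le> 1"
  shows "(\<Sum>r | poly R r = y. log_kernel x r) + ennreal (ln 2) =
    log_kernel (poly R x) y + ennreal (degree R * ln 2 + ln \<bar>lead_coeff R\<bar>)"
proof (cases "poly R x = y")
  case True
  then have "(\<Sum>r | poly R r = y. log_kernel x r) = \<top>"
    using finite_fiber[of y] by (subst ennreal_sum_eq_top) (auto simp: log_kernel_def)
  then show ?thesis using True by (simp add: log_kernel_def)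
next
  case False
  let ?F = "{r. poly R r = y}"
  have ne: "x \<noteq> r" if "r \<in> ?F" for r using that False by auto
  have le: "\<bar>x - r\<bar> \<le> 2" if "r \<in> ?F" for r
    using fiber_subset[OF y] x that by (auto simp: abs_le_iff dest!: subsetD)
  have nn: "0 \<le> ln (2 / \<bar>x - r\<bar>)" if "r \<in> ?F" for r
    using le[OF that] ne[OF that] by (auto intro!: ln_ge_zero simp: field_simps)
  have nn2: "0 \<le> ln (2 / \<bar>poly R x - y\<bar>)"
    using False x y by (auto intro!: ln_ge_zero simp: field_simps abs_le_iff)
  note nn3 = ln_lead_coeff_bound
  have L: "lead_coeff R \<noteq> 0" using degree_pos by auto
  have "ln \<bar>poly R x - y\<bar> = ln \<bar>lead_coeff R\<bar> + (\<Sum>r\<in>?F. ln \<bar>x - r\<bar>)"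
    unfolding poly_diff_eq_prod[OF y] abs_mult abs_prod
    using L ne finite_fiber[of y] by (subst ln_mult_pos) (auto intro!: prod_pos ln_prod)
  moreover have "(\<Sum>r\<in>?F. ln (2 / \<bar>x - r\<bar>)) = degree R * ln 2 - (\<Sum>r\<in>?F. ln \<bar>x - r\<bar>)"
    using card_fiber[OF y] ne by (simp add: ln_div sum_subtractf)
  moreover have "ln (2 / \<bar>poly R x - y\<bar>) = ln 2 - ln \<bar>poly R x - y\<bar>" using False by (simp add: ln_div)
  ultimately have eq: "(\<Sum>r\<in>?F. ln (2 / \<bar>x - r\<bar>)) + ln 2 = ln (2 / \<bar>poly R x - y\<bar>) + (degree R * ln 2 + ln \<bar>lead_coeff R\<bar>)"
    by simp
  have "(\<Sum>r\<in>?F. log_kernel x r) = ennreal (\<Sum>r\<in>?F. ln (2 / \<bar>x - r\<bar>))"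
    using ne nn by (subst sum_ennreal[symmetric]) (auto simp: log_kernel_def intro!: sum.cong)
  then have "(\<Sum>r\<in>?F. log_kernel x r) + ennreal (ln 2) = ennreal ((\<Sum>r\<in>?F. ln (2 / \<bar>x - r\<bar>)) + ln 2)"
    using nn by (subst ennreal_plus) (auto intro: sum_nonneg)
  then show ?thesis using False nn2 nn3 unfolding eq by (simp add: log_kernel_def)
qed

definition pullback :: "real measure" where
  "pullback = (SOME \<nu>. sets \<nu> = sets borel \<and> (\<forall>f\<in>borel_measurable borel.
       (\<integral>\<^sup>+x. f x \<partial>\<nu>) = ennreal (1 / degree R) * (\<integral>\<^sup>+y. (\<Sum>x | poly R x = y. f x) \<partial>arcsine 0 1)))"

lemma sets_pullback [simp, measurable_cong]: "sets pullback = sets borel"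
  and nn_integral_pullback: "f \<in> borel_measurable borel \<Longrightarrow>
    (\<integral>\<^sup>+x. f x \<partial>pullback) = ennreal (1 / degree R) * (\<integral>\<^sup>+y. (\<Sum>x | poly R x = y. f x) \<partial>arcsine 0 1)"
proof -
  have "\<exists>\<nu>. sets \<nu> = sets borel \<and> (\<forall>f\<in>borel_measurable borel.
       (\<integral>\<^sup>+x. f x \<partial>\<nu>) = ennreal (1 / degree R) * (\<integral>\<^sup>+y. (\<Sum>x | poly R x = y. f x) \<partial>arcsine 0 1))"
    using polynomial_pullback_exists[OF degree_pos] by metis
  from someI_ex[OF this] show "sets pullback = sets borel" and "f \<in> borel_measurable borel \<Longrightarrow>
    (\<integral>\<^sup>+x. f x \<partial>pullback) = ennreal (1 / degree R) * (\<integral>\<^sup>+y. (\<Sum>x | poly R x = y. f x) \<partial>arcsine 0 1)"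
    unfolding pullback_def by auto
qed

lemma AE_arcsine_good: "AE y in arcsine 0 1. y \<in> {-1<..<1} - B"
  by (rule AE_arcsine_notin_finite[OF finite_B])

lemma emeasure_pullback:
  assumes "A \<in> sets borel"
  shows "emeasure pullback A = ennreal (1 / degree R) * (\<integral>\<^sup>+y. of_nat (card {x\<in>A. poly R x = y}) \<partial>arcsine 0 1)"
proof -
  have "(\<Sum>x | poly R x = y. indicator A x :: ennreal) = of_nat (card {x\<in>A. poly R x = y})" for y
    using finite_fiber[of y] by (simp add: indicator_def sum.If_cases Int_def conj_commute)
  then show ?thesis
    using assms nn_integral_pullback[of "indicator A"] by simp
qed

text \<open>Each value shares its mass equally among its preimages, so counting the solutions in A
  bounds the mass of A. This is the source of the masses \<open>2 / (2 * n + 1)\<close> and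
  \<open>1 / (2 * n + 1)\<close>.\<close>

lemma emeasure_pullback_le:
  assumes "A \<in> sets borel" "\<And>y. y \<in> {-1<..<1} - B \<Longrightarrow> card {x\<in>A. poly R x = y} \<le> c"
  shows "emeasure pullback A \<le> ennreal (real c / degree R)"
proof -
  interpret A: prob_space "arcsine 0 1" by (rule prob_space_arcsine)
  have "(\<integral>\<^sup>+y. of_nat (card {x\<in>A. poly R x = y}) \<partial>arcsine 0 1) \<le> (\<integral>\<^sup>+y. of_nat c \<partial>arcsine 0 1)"
    by (rule nn_integral_mono_AE) (use AE_arcsine_good in eventually_elim, use assms(2) in \<open>simp add: of_nat_mono\<close>)
  also have "\<dots> = ennreal (real c)" by (simp add: A.emeasure_space_1 ennreal_of_nat_eq_real_of_nat)
  finally show ?thesis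
    unfolding emeasure_pullback[OF assms(1)]
    using mult_left_mono[of _ "ennreal (real c)" "ennreal (1 / degree R)"] by (simp flip: ennreal_mult)
qed

lemma real_prob_on_pullback: "real_prob_on pullback {x\<in>{-1..1}. \<bar>poly R x\<bar> \<le> 1}"
proof -
  interpret A: prob_space "arcsine 0 1" by (rule prob_space_arcsine)
  have [simp]: "space pullback = UNIV" using sets_eq_imp_space_eq[OF sets_pullback] by simp
  let ?E = "{x\<in>{-1..1}. \<bar>poly R x\<bar> \<le> 1}"
  have [measurable]: "?E \<in> sets borel"
    by measurable
  have "(\<integral>\<^sup>+y. of_nat (card {x\<in>UNIV. poly R x = y}) \<partial>arcsine 0 1) = (\<integral>\<^sup>+y. of_nat (degree R) \<partial>arcsine 0 1)"
    by (rule nn_integral_cong_AE) (use AE_arcsine_good in \<open>eventually_elim, simp add: card_fiber\<close>)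
  then have "emeasure pullback UNIV = ennreal (1 / degree R) * (\<integral>\<^sup>+y. of_nat (degree R) \<partial>arcsine 0 1)"
    by (simp only: emeasure_pullback[OF space_in_borel])
  then have "prob_space pullback"
    using degree_pos
    by (intro prob_spaceI) (simp add: A.emeasure_space_1 ennreal_of_nat_eq_real_of_nat flip: ennreal_mult)
  moreover have "AE x in pullback. x \<in> ?E"
  proof (rule AE_I')
    have "card {x \<in> - ?E. poly R x = y} \<le> 0" if "y \<in> {-1<..<1} - B" for y
    proof -
      have "{x \<in> - ?E. poly R x = y} = {}" using fiber_subset[OF that] that by auto
      then show ?thesis by (simp only: card.empty)
    qed
    then have "emeasure pullback (- ?E) \<le> ennreal (real 0 / degree R)"
      by (intro emeasure_pullback_le) auto
    then show "- ?E \<in> null_sets pullback" by (auto simp: null_sets_def)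
  qed auto
  ultimately show ?thesis by (simp add: real_prob_on_def)
qed

text \<open>Averaging the fibre identity over y leaves on the right the arcsine potential at R x,
  which is \<open>ln 4\<close> because R x lies in [-1, 1]; everything else is independent of
  x.\<close>

lemma potential_pullback:
  assumes x: "x \<in> {-1..1}" "\<bar>poly R x\<bar> \<le> 1"
  shows "(\<integral>\<^sup>+t. log_kernel x t \<partial>pullback) = ennreal level"
proof -
  interpret A: prob_space "arcsine 0 1" by (rule prob_space_arcsine)
  have [simp]: "space (arcsine 0 1) = UNIV" using sets_eq_imp_space_eq[OF sets_arcsine] by simp
  let ?S = "\<lambda>y. \<Sum>r | poly R r = y. log_kernel x r"
  let ?B = "degree R * ln 2 + ln \<bar>lead_coeff R\<bar>"
  note B = ln_lead_coeff_bound
  have pot: "(\<integral>\<^sup>+y. log_kernel (poly R x) y \<partial>arcsine 0 1) = ennreal (ln 4)"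
    using potential_arcsine[of 1 "poly R x" 0] x by simp
  have ae: "AE y in arcsine 0 1. ?S y = log_kernel (poly R x) y + ennreal ?B - ennreal (ln 2)"
    using AE_arcsine_good
  proof eventually_elim
    case (elim y)
    show ?case unfolding sum_log_kernel_fiber[OF elim x, symmetric] by simp
  qed
  \<comment> \<open>Subtraction in \<open>ennreal\<close> is truncated; this minorant makes it exact
    before the integral is split.\<close>
  have ge: "AE y in arcsine 0 1. ennreal (ln 2) \<le> log_kernel (poly R x) y + ennreal ?B"
    using AE_arcsine_good
  proof eventually_elim
    case (elim y)
    show ?case unfolding sum_log_kernel_fiber[OF elim x, symmetric] by simp
  qed
  have "(\<integral>\<^sup>+y. ?S y \<partial>arcsine 0 1) = (\<integral>\<^sup>+y. (log_kernel (poly R x) y + ennreal ?B) - ennreal (ln 2) \<partial>arcsine 0 1)"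
    by (rule nn_integral_cong_AE[OF ae])
  also have "\<dots> = (\<integral>\<^sup>+y. log_kernel (poly R x) y + ennreal ?B \<partial>arcsine 0 1) - (\<integral>\<^sup>+y. ennreal (ln 2) \<partial>arcsine 0 1)"
    by (rule nn_integral_diff) (use ge A.emeasure_space_1 in auto)
  also have "(\<integral>\<^sup>+y. log_kernel (poly R x) y + ennreal ?B \<partial>arcsine 0 1) = ennreal (ln 4) + ennreal ?B"
    using A.emeasure_space_1 by (subst nn_integral_add) (auto simp: pot)
  also have "(\<integral>\<^sup>+y. ennreal (ln 2) \<partial>arcsine 0 1) = ennreal (ln 2)"
    using A.emeasure_space_1 by simp
  also have "ennreal (ln 4) + ennreal ?B - ennreal (ln 2) = ennreal (ln 4 + ?B - ln 2)"
    using B by (simp add: ennreal_minus flip: ennreal_plus)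
  also have "ln 4 + ?B - ln 2 = degree R * level"
  proof -
    have "ln (4::real) = 2 * ln 2" using ln_realpow[of 2 2] by simp
    moreover have "ln (2 * \<bar>lead_coeff R\<bar>) = ln 2 + ln \<bar>lead_coeff R\<bar>"
      using degree_pos by (subst ln_mult_pos) auto
    ultimately show ?thesis using degree_pos by (simp add: level_def field_simps)
  qed
  finally have "(\<integral>\<^sup>+y. ?S y \<partial>arcsine 0 1) = ennreal (degree R * level)" .
  then show ?thesis
    using degree_pos level_pos by (simp add: nn_integral_pullback flip: ennreal_mult)
qed

end

section \<open>Weighted Chebyshev polynomials and alternation\<close>

lemma poly_map_poly_Re: "poly (map_poly Re P) x = Re (poly P (complex_of_real x))"
  by (induction P) (simp_all add: map_poly_pCons)

lemma poly_map_poly_of_real: "poly (map_poly complex_of_real p) (complex_of_real x) = complex_of_real (poly p x)"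
  by (induction p) (simp_all add: map_poly_pCons)

section \<open>Interpolation and convergent subsequences\<close>

definition lagrange_basis :: "real set \<Rightarrow> real \<Rightarrow> real poly" where
  "lagrange_basis S s = smult (1 / (\<Prod>t\<in>S - {s}. s - t)) (\<Prod>t\<in>S - {s}. [:-t, 1:])"

lemma poly_lagrange_basis:
  assumes "finite S" "s \<in> S" "t \<in> S"
  shows "poly (lagrange_basis S s) t = (if s = t then 1 else 0)"
  using assms by (auto simp: lagrange_basis_def poly_prod prod_zero_iff)

lemma degree_lagrange_basis:
  assumes "finite S" "s \<in> S"
  shows "degree (lagrange_basis S s) < card S"
proof -
  have "degree (lagrange_basis S s) \<le> degree (\<Prod>t\<in>S - {s}. [:-t, 1:])"
    unfolding lagrange_basis_def by (rule degree_smult_le)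
  also have "\<dots> \<le> card (S - {s})"
    using degree_prod_sum_le[of "S - {s}" "\<lambda>t. [:-t, 1:]"] assms by (simp add: o_def)
  also have "\<dots> < card S" using assms by (intro psubset_card_mono) auto
  finally show ?thesis .
qed

lemma lagrange_interpolation:
  assumes "finite S" "degree p < card S"
  shows "p = (\<Sum>s\<in>S. smult (poly p s) (lagrange_basis S s))"
proof (rule ccontr)
  let ?q = "p - (\<Sum>s\<in>S. smult (poly p s) (lagrange_basis S s))"
  assume "p \<noteq> (\<Sum>s\<in>S. smult (poly p s) (lagrange_basis S s))"
  then have q: "?q \<noteq> 0" by simp
  have "degree ?q < card S"
    using assms degree_lagrange_basis[OF assms(1)]
    by (intro degree_diff_less degree_sum_less) (auto intro: le_less_trans[OF degree_smult_le])
  moreover have "S \<subseteq> {x. poly ?q x = 0}"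
    using assms(1) by (auto simp: poly_sum poly_lagrange_basis if_distrib sum.delta cong: if_cong sum.cong)
  then have "card S \<le> card {x. poly ?q x = 0}" by (intro card_mono poly_roots_finite q)
  then have "card S \<le> degree ?q" using card_poly_roots_bound[OF q] by simp
  ultimately show False by simp
qed

lemma finite_family_convergent_subsequence:
  fixes c :: "nat \<Rightarrow> 'a \<Rightarrow> real"
  assumes "finite S" "\<And>s. s \<in> S \<Longrightarrow> Bseq (\<lambda>k. c k s)"
  shows "\<exists>r l. strict_mono r \<and> (\<forall>s\<in>S. (\<lambda>k. c (r k) s) \<longlonglongrightarrow> l s)"
  using assms
proof (induction S rule: finite_induct)
  case empty
  show ?case using strict_mono_id by blast
next
  case (insert s S)
  then obtain r l where r: "strict_mono (r :: nat \<Rightarrow> nat)" "\<forall>s\<in>S. (\<lambda>k. c (r k) s) \<longlonglongrightarrow> l s"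
    by (metis insertCI)
  have "bounded (range (\<lambda>k. c (r k) s))"
    using insert.prems[of s] by (auto simp: Bseq_def bounded_iff)
  then obtain a r' where r': "strict_mono (r' :: nat \<Rightarrow> nat)" "((\<lambda>k. c (r k) s) \<circ> r') \<longlonglongrightarrow> a"
    using bounded_imp_convergent_subsequence by blast
  have "(\<lambda>k. c ((r \<circ> r') k) t) \<longlonglongrightarrow> (l(s := a)) t" if "t \<in> insert s S" for t
  proof (cases "t = s")
    case True
    then show ?thesis using r' by (simp add: o_def)
  next
    case False
    then have "((\<lambda>k. c (r k) t) \<circ> r') \<longlonglongrightarrow> l t"
      using that r r' by (intro LIMSEQ_subseq_LIMSEQ) auto
    then show ?thesis using False by (simp add: o_def)
  qed
  moreover have "strict_mono (r \<circ> r')" using r r' by (auto simp: strict_mono_o)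
  ultimately show ?case by blast
qed

section \<open>Existence of a minimizing polynomial\<close>

locale weighted_chebyshev =
  fixes K :: "real set" and w :: "real \<Rightarrow> real" and n :: nat
  assumes compact_K: "compact K" and cont_w: "continuous_on K w" and w_nonneg: "\<And>x. x \<in> K \<Longrightarrow> 0 \<le> w x"
    and infinite_support: "infinite {x\<in>K. w x \<noteq> 0}"
begin

lemma K_ne: "K \<noteq> {}"
  using infinite_support by auto

lemma bdd_above_weighted: "bdd_above ((\<lambda>x. w x * cmod (poly P (complex_of_real x))) ` K)"
  by (intro bounded_imp_bdd_above compact_imp_bounded compact_continuous_image compact_K continuous_intros cont_w)

lemma weighted_norm_upper: "x \<in> K \<Longrightarrow> w x * cmod (poly P (complex_of_real x)) \<le> weighted_norm w K P"
  unfolding weighted_norm_def by (intro cSUP_upper bdd_above_weighted)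

lemma weighted_norm_least: "(\<And>x. x \<in> K \<Longrightarrow> w x * cmod (poly P (complex_of_real x)) \<le> c) \<Longrightarrow> weighted_norm w K P \<le> c"
  unfolding weighted_norm_def by (intro cSUP_least K_ne)

lemma weighted_norm_nonneg: "0 \<le> weighted_norm w K P"
proof -
  obtain x where "x \<in> K" using K_ne by auto
  then show ?thesis using weighted_norm_upper[of x P] w_nonneg[of x] by (meson mult_nonneg_nonneg norm_ge_zero order_trans)
qed

lemma cheb_t_le: "degree P = n \<Longrightarrow> lead_coeff P = 1 \<Longrightarrow> cheb_t K w n \<le> weighted_norm w K P"
  unfolding cheb_t_def by (intro cINF_lower bdd_belowI2[of _ 0] weighted_norm_nonneg) auto

lemma monic_of_real:
  assumes "degree p = n" "lead_coeff p = 1"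
  shows "degree (map_poly complex_of_real p) = n" "lead_coeff (map_poly complex_of_real p) = 1"
  using assms by (simp_all add: degree_map_poly coeff_map_poly)

lemma monic_Re:
  assumes "degree P = n" "lead_coeff P = 1"
  shows "degree (map_poly Re P) = n" "lead_coeff (map_poly Re P) = 1"
proof -
  have c: "coeff (map_poly Re P) n = 1" using assms by (simp add: coeff_map_poly)
  then have "n \<le> degree (map_poly Re P)" by (intro le_degree) simp
  then show "degree (map_poly Re P) = n" using map_poly_degree_leq[of Re P] assms by simp
  then show "lead_coeff (map_poly Re P) = 1" using c by simp
qed

text \<open>A monic polynomial of degree n is determined by its values at n nodes of positive
  weight. Along a minimizing sequence these values stay bounded, so a subsequence of them converges,
  and interpolating the limits gives the minimizer.\<close>

lemma minimizer_exists:
  obtains T :: "real poly" where "degree T = n" "lead_coeff T = 1"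
    "\<And>x. x \<in> K \<Longrightarrow> w x * \<bar>poly T x\<bar> \<le> cheb_t K w n"
proof -
  let ?Ps = "{P :: complex poly. degree P = n \<and> lead_coeff P = 1}"
  obtain S where S: "finite S" "card S = n" "S \<subseteq> {x\<in>K. w x \<noteq> 0}"
    using infinite_arbitrarily_large[OF infinite_support] by blast
  have ne: "?Ps \<noteq> {}"
    by (auto intro!: exI[of _ "monom 1 n"] simp: degree_monom_eq)
  have "\<exists>P\<in>?Ps. weighted_norm w K P < cheb_t K w n + 1 / Suc k" for k
    unfolding cheb_t_def
    using ne by (intro cINF_less_iff[THEN iffD1]) (auto intro!: bdd_belowI2[of _ 0] weighted_norm_nonneg)
  then obtain P where P: "\<And>k. degree (P k) = n" "\<And>k. lead_coeff (P k) = 1"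
      "\<And>k. weighted_norm w K (P k) < cheb_t K w n + 1 / Suc k"
    by (metis (mono_tags, lifting) mem_Collect_eq)
  \<comment> \<open>Taking real parts of the coefficients keeps the polynomials monic and does not
    increase their modulus at real points.\<close>
  define p where "p k = map_poly Re (P k)" for k
  have p: "degree (p k) = n" "lead_coeff (p k) = 1" for k
    using monic_Re[OF P(1,2)] by (auto simp: p_def)
  have pw: "w x * \<bar>poly (p k) x\<bar> \<le> cheb_t K w n + 1 / Suc k" if "x \<in> K" for x k
  proof -
    have "w x * \<bar>poly (p k) x\<bar> \<le> w x * cmod (poly (P k) (complex_of_real x))"
      unfolding p_def poly_map_poly_Re using that w_nonneg by (intro mult_left_mono abs_Re_le_cmod) auto
    also have "\<dots> \<le> weighted_norm w K (P k)" by (rule weighted_norm_upper[OF that])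
    finally show ?thesis using P(3)[of k] by simp
  qed
  define node where "node = (\<Prod>s\<in>S. [:-s, 1:])"
  have node: "degree node = n" "lead_coeff node = 1"
  proof -
    show d: "degree node = n" unfolding node_def using S by (simp add: degree_prod_eq_sum_degree)
    show "lead_coeff node = 1" unfolding node_def lead_coeff_prod by simp
  qed
  have poly_node: "poly node s = 0" if "s \<in> S" for s
    using that S by (auto simp: node_def poly_prod prod_zero_iff)
  \<comment> \<open>Subtracting the monic node polynomial, which vanishes on S, brings the degree
    below n, the range of interpolation. For n = 0 there are no nodes and both sides are 1.\<close>
  have rep: "p k = node + (\<Sum>s\<in>S. smult (poly (p k) s) (lagrange_basis S s))" for k
  proof (cases "n = 0")
    case True
    then show ?thesis using p[of k] S node by (auto simp: node_def elim!: degree_eq_zeroE)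
  next
    case False
    have "degree (p k - node) < card S"
    proof -
      have "degree (p k - node) \<le> n" using p node by (intro degree_diff_le) auto
      moreover have "coeff (p k - node) n = 0" using p[of k] node by simp
      ultimately show ?thesis using False S by (metis coeff_0 degree_0 gr0I le_neq_implies_less leading_coeff_0_iff)
    qed
    from lagrange_interpolation[OF S(1) this] show ?thesis
      using poly_node by (simp add: algebra_simps cong: sum.cong)
  qed
  have "Bseq (\<lambda>k. poly (p k) s)" if "s \<in> S" for s
  proof (rule BseqI')
    fix k
    have s: "s \<in> K" "0 < w s" using that S w_nonneg[of s] by (auto simp: less_le)
    have "w s * \<bar>poly (p k) s\<bar> \<le> cheb_t K w n + 1 / Suc k" by (rule pw[OF s(1)])
    also have "\<dots> \<le> cheb_t K w n + 1" by simp
    finally show "norm (poly (p k) s) \<le> (cheb_t K w n + 1) / w s" using s by (simp add: field_simps)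
  qed
  then obtain r l where r: "strict_mono (r :: nat \<Rightarrow> nat)" and l: "\<And>s. s \<in> S \<Longrightarrow> (\<lambda>k. poly (p (r k)) s) \<longlonglongrightarrow> l s"
    using finite_family_convergent_subsequence[OF S(1), of "\<lambda>k s. poly (p k) s"] by blast
  define T where "T = node + (\<Sum>s\<in>S. smult (l s) (lagrange_basis S s))"
  have lim: "(\<lambda>k. poly (p (r k)) x) \<longlonglongrightarrow> poly T x" for x
    unfolding T_def by (subst rep) (auto simp: poly_sum intro!: tendsto_intros l)
  have T: "degree T = n \<and> lead_coeff T = 1"
  proof (cases "n = 0")
    case True
    then show ?thesis using S node by (auto simp: T_def)
  next
    case False
    have "degree (\<Sum>s\<in>S. smult (l s) (lagrange_basis S s)) < degree node"
      using False S degree_lagrange_basis[OF S(1)] node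
      by (intro degree_sum_less) (auto intro: le_less_trans[OF degree_smult_le])
    then show ?thesis unfolding T_def using node by (simp add: degree_add_eq_left lead_coeff_add_le coeff_eq_0)
  qed
  show thesis
  proof
    show "degree T = n" "lead_coeff T = 1" using T by auto
    fix x assume x: "x \<in> K"
    have "(\<lambda>k. w x * \<bar>poly (p (r k)) x\<bar>) \<longlonglongrightarrow> w x * \<bar>poly T x\<bar>"
      by (intro tendsto_intros lim)
    moreover have "(\<lambda>k. cheb_t K w n + 1 / Suc (r k)) \<longlonglongrightarrow> cheb_t K w n + 0"
      using LIMSEQ_subseq_LIMSEQ[OF LIMSEQ_Suc[OF lim_1_over_n[where 'a = real]] r]
      by (intro tendsto_add tendsto_const) (simp add: o_def)
    ultimately show "w x * \<bar>poly T x\<bar> \<le> cheb_t K w n"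
      using pw[OF x] by (intro LIMSEQ_le[of _ _ _ "cheb_t K w n"]) auto
  qed
qed

lemma cheb_t_attained:
  assumes "degree p = n" "lead_coeff p = 1"
  shows "\<exists>x\<in>K. cheb_t K w n \<le> w x * \<bar>poly p x\<bar>"
proof -
  have "continuous_on K (\<lambda>x. w x * \<bar>poly p x\<bar>)" by (intro continuous_intros cont_w)
  then obtain x where x: "x \<in> K" "\<And>y. y \<in> K \<Longrightarrow> w y * \<bar>poly p y\<bar> \<le> w x * \<bar>poly p x\<bar>"
    using continuous_attains_sup[OF compact_K K_ne] by meson
  have "cheb_t K w n \<le> weighted_norm w K (map_poly complex_of_real p)"
    by (intro cheb_t_le monic_of_real assms)
  also have "\<dots> \<le> w x * \<bar>poly p x\<bar>"
    using x by (intro weighted_norm_least) (simp add: poly_map_poly_of_real)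
  finally show ?thesis using x by blast
qed

end

text \<open>Induction that peels off the rightmost block of X and exchanges the roles of X and Y.
  Positivity of q to the right of s is carried along since the peeled block lies there: it fixes the
  sign of the inductive polynomial on that block.\<close>

lemma alternation_or_separation:
  fixes X Y :: "real set"
  assumes "compact X" "compact Y" "X \<inter> Y = {}" "s \<in> X" "\<And>y. y \<in> X \<union> Y \<Longrightarrow> y \<le> s"
  shows "(\<exists>xs :: nat \<Rightarrow> real. (\<forall>i<k. xs i < xs (Suc i)) \<and> (\<forall>i\<le>k. xs i \<in> (if even (k - i) then X else Y)))
    \<or> (\<exists>q :: real poly. degree q < k \<and> (\<forall>x\<in>X. 0 < poly q x) \<and> (\<forall>x\<in>Y. poly q x < 0) \<and> (\<forall>x\<ge>s. 0 < poly q x))"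
  using assms
proof (induction k arbitrary: X Y s)
  case 0
  then show ?case by (intro disjI1 exI[of _ "\<lambda>_. s"]) auto
next
  case (Suc k)
  show ?case
  proof (cases "Y = {}")
    case True
    then show ?thesis by (intro disjI2 exI[of _ 1]) auto
  next
    case False
    obtain t where t: "t \<in> Y" "\<And>y. y \<in> Y \<Longrightarrow> y \<le> t"
      using compact_attains_sup[OF Suc.prems(2) False] by blast
    have ts: "t < s" using t Suc.prems(3-5) by (metis UnI2 disjoint_iff order_less_le)
    have X': "compact (X \<inter> {..t})" "compact (X \<inter> {t..})"
      using Suc.prems(1) by (auto intro: compact_Int_closed)
    have "s \<in> X \<inter> {t..}" using ts Suc.prems by auto
    then obtain u where u: "u \<in> X \<inter> {t..}" "\<And>x. x \<in> X \<inter> {t..} \<Longrightarrow> u \<le> x"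
      using compact_attains_inf[OF X'(2)] by blast
    have tu: "t < u" using u t Suc.prems(3) by (auto simp: less_le)
    have us: "u \<le> s" using u \<open>s \<in> X \<inter> {t..}\<close> by auto
    have "Y \<inter> (X \<inter> {..t}) = {}" "\<And>y. y \<in> Y \<union> X \<inter> {..t} \<Longrightarrow> y \<le> t"
      using t(2) Suc.prems(3) by auto
    note IH = Suc.IH[OF Suc.prems(2) X'(1) this(1) t(1) this(2)]
    then consider (chain) xs :: "nat \<Rightarrow> real" where "\<forall>i<k. xs i < xs (Suc i)" "\<forall>i\<le>k. xs i \<in> (if even (k - i) then Y else X \<inter> {..t})"
      | (sep) q :: "real poly" where "degree q < k" "\<forall>x\<in>Y. 0 < poly q x" "\<forall>x\<in>X \<inter> {..t}. poly q x < 0" "\<forall>x\<ge>t. 0 < poly q x"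
      by blast
    then show ?thesis
    proof cases
      case chain
      define xs' where "xs' i = (if i \<le> k then xs i else s)" for i
      have "xs k \<le> t" using chain(2)[rule_format, of k] t by auto
      then have "xs' i < xs' (Suc i)" if "i < Suc k" for i
        using that chain(1) ts by (auto simp: xs'_def less_Suc_eq)
      moreover have "xs' i \<in> (if even (Suc k - i) then X else Y)" if "i \<le> Suc k" for i
      proof (cases "i \<le> k")
        case True
        then have "even (Suc k - i) \<longleftrightarrow> odd (k - i)" by (simp add: Suc_diff_le)
        then show ?thesis using True chain(2)[rule_format, of i] by (auto simp: xs'_def split: if_splits)
      next
        case False
        then show ?thesis using that Suc.prems(4) by (auto simp: xs'_def not_le le_Suc_eq)
      qed
      ultimately show ?thesis by blast
    next
      case sep
      \<comment> \<open>A new sign change is placed between the last point t of Y and the first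
        point u of X after it. It reverses the signs on the left of t and keeps those on the peeled
        block.\<close>
      define z where "z = (t + u) / 2"
      have z: "t < z" "z < u" using tu by (auto simp: z_def)
      define q' where "q' = [:-z, 1:] * q"
      have pq: "poly q' x = (x - z) * poly q x" for x by (simp add: q'_def algebra_simps)
      have "degree q' < Suc k" using sep(1) degree_mult_le[of "[:-z, 1:]" q] by (simp add: q'_def)
      moreover have "0 < poly q' x" if "x \<in> X" for x
      proof (cases "x \<le> t")
        case True
        then show ?thesis using sep(3) that z unfolding pq by (intro mult_neg_neg) auto
      next
        case False
        then show ?thesis using sep(4) that z u(2)[of x] unfolding pq by (intro mult_pos_pos) auto
      qed
      moreover have "poly q' x < 0" if "x \<in> Y" for x
        using sep(2) that z t(2)[OF that] unfolding pq by (intro mult_neg_pos) auto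
      moreover have "0 < poly q' x" if "x \<ge> s" for x
        using sep(4) that z us ts unfolding pq by (intro mult_pos_pos) auto
      ultimately show ?thesis by blast
    qed
  qed
qed

text \<open>If every \<epsilon> of the form 1 / (k + 1) failed, the failing points would accumulate
  at a point where f has modulus M. There f g is positive, and by continuity it stays so at the
  failing points, where subtracting a small multiple of g must then decrease the modulus of
  f.\<close>

lemma perturbation_decreases_max:
  fixes f g :: "real \<Rightarrow> real"
  assumes K: "compact K" and cont: "continuous_on K f" "continuous_on K g"
    and le: "\<And>x. x \<in> K \<Longrightarrow> \<bar>f x\<bar> \<le> M" and pos: "\<And>x. x \<in> K \<Longrightarrow> \<bar>f x\<bar> = M \<Longrightarrow> 0 < f x * g x"
  shows "\<exists>\<epsilon>>0. \<forall>x\<in>K. \<bar>f x - \<epsilon> * g x\<bar> < M"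
proof (rule ccontr)
  assume "\<not> ?thesis"
  then have "\<forall>k. \<exists>x\<in>K. M \<le> \<bar>f x - (1 / Suc k) * g x\<bar>"
    by (metis not_less of_nat_0_less_iff zero_less_Suc zero_less_divide_1_iff)
  then obtain x where x: "\<And>k. x k \<in> K" "\<And>k. M \<le> \<bar>f (x k) - (1 / Suc k) * g (x k)\<bar>" by metis
  obtain a r where r: "a \<in> K" "strict_mono (r :: nat \<Rightarrow> nat)" "(x \<circ> r) \<longlonglongrightarrow> a"
    using K x(1) unfolding compact_def by blast
  have e: "(\<lambda>k. 1 / real (Suc (r k))) \<longlonglongrightarrow> 0"
    using LIMSEQ_subseq_LIMSEQ[OF LIMSEQ_Suc[OF lim_1_over_n[where 'a = real]] r(2)] by (simp add: o_def)
  have fa: "(\<lambda>k. f (x (r k))) \<longlonglongrightarrow> f a" and ga: "(\<lambda>k. g (x (r k))) \<longlonglongrightarrow> g a"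
    using cont r x(1) by (auto simp: continuous_on_sequentially o_def)
  have "(\<lambda>k. \<bar>f (x (r k)) - (1 / Suc (r k)) * g (x (r k))\<bar>) \<longlonglongrightarrow> \<bar>f a - 0 * g a\<bar>"
    by (intro tendsto_intros e fa ga)
  then have "M \<le> \<bar>f a\<bar>" using x(2) by (intro LIMSEQ_le_const) auto
  then have "0 < f a * g a" using pos[OF r(1)] le[OF r(1)] by simp
  \<comment> \<open>The square of f - \<epsilon> g is f^2 minus \<epsilon> times the quantity
    considered here.\<close>
  moreover have "(\<lambda>k. 2 * (f (x (r k)) * g (x (r k))) - (1 / Suc (r k)) * (g (x (r k)))\<^sup>2) \<longlonglongrightarrow> 2 * (f a * g a) - 0 * (g a)\<^sup>2"
    by (intro tendsto_intros e fa ga)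
  ultimately have "eventually (\<lambda>k. 0 < 2 * (f (x (r k)) * g (x (r k))) - (1 / Suc (r k)) * (g (x (r k)))\<^sup>2) sequentially"
    by (elim order_tendstoD(1)) simp
  then obtain k where k: "0 < 2 * (f (x (r k)) * g (x (r k))) - (1 / Suc (r k)) * (g (x (r k)))\<^sup>2"
    using eventually_happens'[OF sequentially_bot] by blast
  define F G \<epsilon> where "F = f (x (r k))" and "G = g (x (r k))" and "\<epsilon> = 1 / real (Suc (r k))"
  have "0 < \<epsilon>" by (simp add: \<epsilon>_def)
  then have "0 < \<epsilon> * (2 * (F * G) - \<epsilon> * G\<^sup>2)" using k by (simp add: F_def G_def \<epsilon>_def)
  then have "(F - \<epsilon> * G)\<^sup>2 < F\<^sup>2" by (simp add: power2_eq_square algebra_simps)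
  then have "\<bar>F - \<epsilon> * G\<bar> < \<bar>F\<bar>" by (simp add: abs_le_square_iff flip: not_le)
  then show False using x(2)[of "r k"] le[OF x(1)[of "r k"]] by (simp add: F_def G_def \<epsilon>_def)
qed

section \<open>The alternation theorem\<close>

context weighted_chebyshev
begin

text \<open>Without n + 1 alternating extremal points some polynomial of degree below n would have,
  up to a common sign, the sign of T at all extremal points. Subtracting a small multiple of it
  keeps the polynomial monic and strictly lowers the weighted norm, against minimality.\<close>

theorem chebyshev_alternation:
  assumes n: "1 \<le> n"
  obtains T :: "real poly" and xs :: "nat \<Rightarrow> real" and \<sigma> :: real where "degree T = n" "lead_coeff T = 1" "0 < cheb_t K w n"
    "\<And>x. x \<in> K \<Longrightarrow> w x * \<bar>poly T x\<bar> \<le> cheb_t K w n"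
    "\<And>i. i < n \<Longrightarrow> xs i < xs (Suc i)" "\<And>i. i \<le> n \<Longrightarrow> xs i \<in> K" "\<bar>\<sigma>\<bar> = 1"
    "\<And>i. i \<le> n \<Longrightarrow> w (xs i) * poly T (xs i) = \<sigma> * (-1) ^ (n - i) * cheb_t K w n"
proof -
  define M where "M = cheb_t K w n"
  obtain T where T: "degree T = n" "lead_coeff T = 1" "\<And>x. x \<in> K \<Longrightarrow> w x * \<bar>poly T x\<bar> \<le> M"
    using minimizer_exists unfolding M_def by blast
  have "T \<noteq> 0" using T(2) by auto
  then have "infinite ({x\<in>K. w x \<noteq> 0} - {x. poly T x = 0})"
    by (intro Diff_infinite_finite infinite_support poly_roots_finite)
  then have "{x\<in>K. w x \<noteq> 0} - {x. poly T x = 0} \<noteq> {}" by (metis finite.emptyI)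
  then obtain x where x: "x \<in> K" "w x \<noteq> 0" "poly T x \<noteq> 0" by blast
  then have "0 < w x * \<bar>poly T x\<bar>" using w_nonneg[of x] by simp
  then have M: "0 < M" using T(3)[OF x(1)] by linarith
  let ?f = "\<lambda>x. w x * poly T x"
  have f: "continuous_on K ?f" by (intro continuous_intros cont_w)
  have fM: "\<bar>?f x\<bar> \<le> M" if "x \<in> K" for x using T(3)[OF that] w_nonneg[OF that] by (simp add: abs_mult)
  define X where "X \<tau> = {x\<in>K. ?f x = \<tau> * M}" for \<tau> :: real
  have X: "compact (X \<tau>)" for \<tau>
  proof -
    have "closedin (top_of_set K) {x\<in>K. ?f x = \<tau> * M}"
      using continuous_closedin_preimage_constant[OF f] .
    then show ?thesis unfolding X_def using compact_K closedin_compact by blast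
  qed
  have disj: "X 1 \<inter> X (-1) = {}" using M by (auto simp: X_def)
  have "X 1 \<union> X (-1) \<noteq> {}"
  proof -
    obtain x where "x \<in> K" "M \<le> w x * \<bar>poly T x\<bar>" using cheb_t_attained[OF T(1,2)] by (auto simp: M_def)
    then have "\<bar>?f x\<bar> = M" using T(3)[of x] w_nonneg[of x] by (simp add: abs_mult)
    then have "?f x = M \<or> ?f x = - M" by linarith
    then show ?thesis using \<open>x \<in> K\<close> by (auto simp: X_def)
  qed
  then obtain s where s: "s \<in> X 1 \<union> X (-1)" "\<And>y. y \<in> X 1 \<union> X (-1) \<Longrightarrow> y \<le> s"
    using compact_attains_sup[OF compact_Un[OF X X]] by blast
  \<comment> \<open>\<sigma> is the sign of T at the rightmost extremal point; the chain is built so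
    that its last point carries this sign.\<close>
  then obtain \<sigma> :: real where \<sigma>: "\<bar>\<sigma>\<bar> = 1" "s \<in> X \<sigma>" and un: "X \<sigma> \<union> X (- \<sigma>) = X 1 \<union> X (-1)"
    by (auto intro: that[of 1] that[of "-1"])
  have disj': "X \<sigma> \<inter> X (- \<sigma>) = {}" using \<sigma>(1) disj by (auto simp: abs_if split: if_splits)
  have nosep: False if q: "degree q < n" "\<forall>x\<in>X \<sigma>. 0 < poly q x" "\<forall>x\<in>X (- \<sigma>). poly q x < 0" for q :: "real poly"
  proof -
    let ?g = "\<lambda>x. w x * (\<sigma> * poly q x)"
    have "\<exists>\<epsilon>>0. \<forall>x\<in>K. \<bar>?f x - \<epsilon> * ?g x\<bar> < M"
    proof (rule perturbation_decreases_max[OF compact_K f _ fM])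
      show "continuous_on K ?g" by (intro continuous_intros cont_w)
      fix x assume x: "x \<in> K" "\<bar>?f x\<bar> = M"
      then have w: "0 < w x" using M w_nonneg[of x] by (auto simp: less_le)
      have "x \<in> X 1 \<union> X (-1)" using x by (auto simp: X_def abs_if split: if_splits)
      then have "x \<in> X \<sigma> \<or> x \<in> X (- \<sigma>)" unfolding un[symmetric] by auto
      then have "0 < (\<sigma> * ?f x) * poly q x"
      proof
        assume "x \<in> X \<sigma>"
        then have "\<sigma> * ?f x = M" using \<sigma>(1) by (auto simp: X_def abs_if split: if_splits)
        then show ?thesis using M q(2) \<open>x \<in> X \<sigma>\<close> by simp
      next
        assume "x \<in> X (- \<sigma>)"
        then have "\<sigma> * ?f x = - M" using \<sigma>(1) by (auto simp: X_def abs_if split: if_splits)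
        then show ?thesis using M q(3) \<open>x \<in> X (- \<sigma>)\<close> by (simp add: mult_less_0_iff)
      qed
      then have "0 < w x * ((\<sigma> * ?f x) * poly q x)" by (rule mult_pos_pos[OF w])
      then show "0 < ?f x * ?g x" by (simp add: ac_simps)
    qed
    then obtain \<epsilon> where \<epsilon>: "\<And>x. x \<in> K \<Longrightarrow> \<bar>?f x - \<epsilon> * ?g x\<bar> < M" by blast
    define p where "p = T - smult (\<epsilon> * \<sigma>) q"
    have dq: "degree (smult (\<epsilon> * \<sigma>) q) < n" using q(1) by (rule le_less_trans[OF degree_smult_le])
    then have dp: "degree p = n" unfolding p_def using T(1) degree_add_eq_left[of "- smult (\<epsilon> * \<sigma>) q" T] by simp
    have "coeff p n = 1" unfolding p_def coeff_diff using T coeff_eq_0[OF dq] by simp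
    then have "lead_coeff p = 1" by (simp add: dp)
    then obtain x where x: "x \<in> K" "M \<le> w x * \<bar>poly p x\<bar>"
      unfolding M_def using cheb_t_attained[OF dp] by blast
    have "?f x - \<epsilon> * ?g x = w x * poly p x" by (simp add: p_def algebra_simps)
    then have "w x * \<bar>poly p x\<bar> < M" using \<epsilon>[OF x(1)] w_nonneg[OF x(1)] by (simp add: abs_mult)
    then show False using x by simp
  qed
  have top: "y \<le> s" if "y \<in> X \<sigma> \<union> X (- \<sigma>)" for y using s(2) that un by blast
  from alternation_or_separation[OF X X disj' \<sigma>(2) top, of n]
  obtain xs where xs: "\<forall>i<n. xs i < xs (Suc i)" "\<forall>i\<le>n. xs i \<in> (if even (n - i) then X \<sigma> else X (- \<sigma>))"
    using nosep by blast
  show thesis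
  proof
    show "degree T = n" "lead_coeff T = 1" "\<bar>\<sigma>\<bar> = 1" using T \<sigma> by auto
    show "0 < cheb_t K w n" using M by (simp add: M_def)
    show "w x * \<bar>poly T x\<bar> \<le> cheb_t K w n" if "x \<in> K" for x using T(3)[OF that] by (simp add: M_def)
    show "xs i < xs (Suc i)" if "i < n" for i using xs(1) that by blast
    show "xs i \<in> K" if "i \<le> n" for i using xs(2)[rule_format, OF that] by (auto simp: X_def split: if_splits)
    show "w (xs i) * poly T (xs i) = \<sigma> * (-1) ^ (n - i) * cheb_t K w n" if "i \<le> n" for i
      using xs(2)[rule_format, OF that] by (auto simp: X_def M_def split: if_splits)
  qed
qed

end

section \<open>Lower bounds for the energy\<close>

lemma real_prob_on_mono:
  assumes "real_prob_on m A" "A \<subseteq> B"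
  shows "real_prob_on m B"
proof -
  have "AE x in m. x \<in> B"
    using real_prob_on_AE[OF assms(1)] by eventually_elim (use assms(2) in blast)
  then show ?thesis using assms(1) by (simp add: real_prob_on_def)
qed

lemma potential_at_atom:
  assumes "sets m = sets borel" "emeasure m {x} \<noteq> 0"
  shows "(\<integral>\<^sup>+y. log_kernel x y \<partial>m) = \<infinity>"
proof -
  note [measurable_cong] = assms(1)
  have "(\<infinity>::ennreal) = (\<integral>\<^sup>+y. \<infinity> * indicator {x} y \<partial>m)"
    using assms by (subst nn_integral_cmult_indicator) (auto simp: ennreal_top_mult)
  also have "\<dots> \<le> (\<integral>\<^sup>+y. log_kernel x y \<partial>m)"
    by (intro nn_integral_mono) (auto simp: indicator_def log_kernel_def)
  finally show ?thesis by (simp add: top_unique)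
qed

lemma mutual_energy_atom:
  assumes "sets m = sets borel" "emeasure m {x} \<noteq> 0"
  shows "mutual_energy m m = \<infinity>"
proof -
  have "(\<infinity>::ennreal) = (\<integral>\<^sup>+y. \<infinity> * indicator {x} y \<partial>m)"
    using assms by (subst nn_integral_cmult_indicator) (auto simp: ennreal_top_mult)
  also have "\<dots> \<le> mutual_energy m m"
    unfolding mutual_energy_def using potential_at_atom[OF assms]
    by (intro nn_integral_mono) (auto simp: indicator_def)
  finally show ?thesis by (simp add: top_unique)
qed

lemma robin_ge:
  assumes "closed K" "K \<subseteq> {-1..1}" "0 \<le> c" "\<And>m. real_prob_on m K \<Longrightarrow> ennreal c \<le> mutual_energy m m"
  shows "ereal (c - ln 2) \<le> robin (cset K)"
  unfolding robin_def
proof (rule INF_greatest)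
  fix \<mu> assume "\<mu> \<in> {\<mu>. prob_on \<mu> (cset K)}"
  then interpret interval_measure \<mu> K using assms by unfold_locales auto
  have "ereal c \<le> enn2ereal (mutual_energy m m)"
    using assms(4)[OF real_prob_on_m] assms(3) by (simp add: less_eq_ennreal.rep_eq enn2ereal_ennreal)
  then have "ereal c - ereal (ln 2) \<le> enn2ereal (mutual_energy m m) - ereal (ln 2)"
    by (intro ereal_minus_mono) auto
  then show "ereal (c - ln 2) \<le> log_energy \<mu>" by (simp add: log_energy_eq)
qed

lemma robin_le:
  assumes "closed K" "K \<subseteq> {-1..1}" "real_prob_on m K" "mutual_energy m m \<le> ennreal c" "0 \<le> c"
  shows "robin (cset K) \<le> ereal (c - ln 2)"
proof -
  note P = prob_on_distr_of_real[OF assms(3,1,2)]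
  have "robin (cset K) \<le> log_energy (distr m borel complex_of_real)"
    unfolding robin_def by (rule INF_lower) (use P in auto)
  also have "\<dots> \<le> ereal c - ereal (ln 2)"
    unfolding P(2) using assms(4,5)
    by (intro ereal_minus_mono) (auto simp: less_eq_ennreal.rep_eq enn2ereal_ennreal)
  finally show ?thesis by simp
qed

text \<open>A probability measure on a finite set has an atom, and an atom has infinite energy.
  Consequently sets of positive capacity are infinite.\<close>

lemma Cap_finite_eq_0:
  assumes "finite K" "K \<subseteq> {-1..1}"
  shows "Cap (cset K) = 0"
proof -
  have inf: "mutual_energy m m = \<infinity>" if m: "real_prob_on m K" for m
  proof -
    interpret prob_space m using m by (rule real_prob_on_prob_space)
    note [simp] = real_prob_on_sets[OF m]
    have "\<exists>x\<in>K. emeasure m {x} \<noteq> 0"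
    proof (rule ccontr)
      assume "\<not> ?thesis"
      then have "K \<in> null_sets m"
        using null_sets.finite_UN[OF assms(1), of "\<lambda>x. {x}" m] by (auto simp: null_sets_def)
      then have "AE x in m. x \<notin> K" by (rule AE_not_in)
      then have "AE x in m. False" using real_prob_on_AE[OF m] by eventually_elim simp
      then show False by simp
    qed
    then show ?thesis using mutual_energy_atom by auto
  qed
  have "ereal r \<le> robin (cset K)" for r
  proof -
    have "ereal ((\<bar>r\<bar> + ln 2) - ln 2) \<le> robin (cset K)"
      by (rule robin_ge) (use assms inf in \<open>auto simp: finite_imp_closed\<close>)
    then show ?thesis by (simp add: order_trans[of "ereal r" "ereal \<bar>r\<bar>"])
  qed
  then have "robin (cset K) = \<infinity>" by (simp add: ereal_top)
  then show ?thesis by (simp add: Cap_def)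
qed

text \<open>\<open>real_of_ereal\<close> maps minus infinity to 0, so \<open>Cap\<close> can be
  inverted only once that value is excluded; nonnegativity of the kernel bounds \<open>robin\<close>
  below by \<open>- ln 2\<close>.\<close>

lemma robin_eq_ln_Cap:
  assumes "closed K" "K \<subseteq> {-1..1}" "0 < Cap (cset K)"
  shows "robin (cset K) = ereal (- ln (Cap (cset K)))"
proof -
  have "robin (cset K) \<noteq> \<infinity>" using assms(3) by (auto simp: Cap_def)
  moreover have "ereal (0 - ln 2) \<le> robin (cset K)" by (rule robin_ge) (use assms in auto)
  then have "robin (cset K) \<noteq> - \<infinity>" by auto
  ultimately obtain r where "robin (cset K) = ereal r" by (cases "robin (cset K)") auto
  then show ?thesis by (simp add: Cap_def)
qed

section \<open>Energy of measures on the polynomial preimage\<close>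

context full_preimage
begin

lemma finite_measure_pullback: "finite_measure pullback"
  using real_prob_on_finite_measure[OF real_prob_on_pullback] .

lemma mutual_energy_pullback:
  assumes "real_prob_on m {x\<in>{-1..1}. \<bar>poly R x\<bar> \<le> 1}"
  shows "mutual_energy m pullback = ennreal level"
proof -
  interpret prob_space m using assms by (rule real_prob_on_prob_space)
  have "mutual_energy m pullback = (\<integral>\<^sup>+x. ennreal level \<partial>m)"
    unfolding mutual_energy_def
    by (rule nn_integral_cong_AE) (use real_prob_on_AE[OF assms] in \<open>eventually_elim, simp add: potential_pullback\<close>)
  then show ?thesis by (simp add: emeasure_space_1)
qed

text \<open>The constant potential makes both the mixed energy and the energy of
  \<open>pullback\<close> equal to \<open>level\<close>; positivity gives 2 level \<le> I(m, m) +
  level.\<close>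

lemma mutual_energy_ge_level:
  assumes "real_prob_on m {x\<in>{-1..1}. \<bar>poly R x\<bar> \<le> 1}"
  shows "ennreal level \<le> mutual_energy m m"
proof -
  have "2 * ennreal level \<le> mutual_energy m m + ennreal level"
    using mutual_energy_positive[of m pullback] real_prob_on_finite_measure[OF assms] real_prob_on_sets[OF assms]
      finite_measure_pullback mutual_energy_pullback[OF assms] mutual_energy_pullback[OF real_prob_on_pullback]
    by simp
  then have "ennreal level + ennreal level \<le> ennreal level + mutual_energy m m" by (simp add: mult_2 add.commute)
  then show ?thesis by simp
qed

text \<open>Test positivity on m + \<eta> b - (\<nu> + \<eta> a), where \<nu> is
  \<open>pullback\<close> and a, b are arcsine laws of radii \<rho> and \<rho> / 2. The terms with
  \<nu> cancel, since a and b see the same constant potential. What remains is I(m, m) \<ge> level +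
  2 \<eta> (I(m, a) - I(m, b)) - \<eta>^2 ln 2, and m, which avoids the interval, sees a drop of at
  least \<eta> from a to b.\<close>

lemma mutual_energy_gap:
  assumes I: "0 < \<rho>" "{c - \<rho>..c + \<rho>} \<subseteq> {x\<in>{-1..1}. \<bar>poly R x\<bar> \<le> 1}"
  obtains \<delta> where "0 < \<delta>"
    "\<And>m. real_prob_on m ({x\<in>{-1..1}. \<bar>poly R x\<bar> \<le> 1} - {c - \<rho>..c + \<rho>}) \<Longrightarrow> ennreal (level + \<delta>) \<le> mutual_energy m m"
proof -
  \<comment> \<open>The drop guaranteed by \<open>potential_arcsine_less\<close> for these radii,
    used also as the size of the perturbation: the linear gain 2 \<eta>^2 then beats the quadratic
    cost \<eta>^2 ln 2, with more than \<eta>^2 to spare.\<close>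
  define \<eta> where "\<eta> = ln (1 + (\<rho>\<^sup>2 - (\<rho> / 2)\<^sup>2) / 8) / 8"
  have "(\<rho> / 2)\<^sup>2 < \<rho>\<^sup>2" using I by (intro power_strict_mono) auto
  then have \<eta>: "0 < \<eta>" unfolding \<eta>_def by (intro divide_pos_pos ln_gt_zero) auto
  have \<rho>1: "\<rho> \<le> 1" using I(1) subsetD[OF I(2), of "c - \<rho>"] subsetD[OF I(2), of "c + \<rho>"] by auto
  have I1: "{c - \<rho>..c + \<rho>} \<subseteq> {-1..1}" using I(2) by blast
  let ?E = "{x\<in>{-1..1}. \<bar>poly R x\<bar> \<le> 1}"
  let ?a = "arcsine c \<rho>" and ?b = "arcsine c (\<rho> / 2)"
  have supp: "real_prob_on (arcsine c r) {c - \<rho>..c + \<rho>}" if "0 < r" "r \<le> \<rho>" for r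
  proof -
    have "\<bar>r * cos \<theta>\<bar> \<le> \<rho>" for \<theta>
      using that mult_mono[of r \<rho> "\<bar>cos \<theta>\<bar>" 1] by (simp add: abs_mult)
    then have "c + r * cos \<theta> \<in> {c - \<rho>..c + \<rho>}" for \<theta> by (simp add: abs_le_iff) (smt (verit))
    then have "AE x in arcsine c r. x \<in> {c - \<rho>..c + \<rho>}"
      unfolding arcsine_def by (subst AE_distr_iff) auto
    then show ?thesis using prob_space_arcsine by (simp add: real_prob_on_def)
  qed
  have suppE: "real_prob_on (arcsine c r) ?E" if "0 < r" "r \<le> \<rho>" for r
    using supp[OF that] I(2) by (rule real_prob_on_mono)
  have fin: "finite_measure (arcsine c r)" for r
    using prob_space_arcsine by (simp add: prob_space_def)
  have arc: "mutual_energy (arcsine c r) ?a = ennreal (ln (4 / \<rho>))" if "0 < r" "r \<le> \<rho>" for r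
  proof -
    interpret prob_space "arcsine c r" by (rule prob_space_arcsine)
    have "mutual_energy (arcsine c r) ?a = (\<integral>\<^sup>+x. ennreal (ln (4 / \<rho>)) \<partial>arcsine c r)"
      unfolding mutual_energy_def
    proof (rule nn_integral_cong_AE)
      show "AE x in arcsine c r. (\<integral>\<^sup>+y. log_kernel x y \<partial>?a) = ennreal (ln (4 / \<rho>))"
        using real_prob_on_AE[OF supp[OF that]]
        by eventually_elim (use I \<rho>1 in \<open>auto intro!: potential_arcsine simp: abs_le_iff\<close>)
    qed
    then show ?thesis by (simp add: emeasure_space_1)
  qed
  have bb: "mutual_energy ?b ?b = ennreal (ln (8 / \<rho>))"
  proof -
    interpret prob_space ?b by (rule prob_space_arcsine)
    have AE: "AE x in ?b. \<bar>x - c\<bar> \<le> \<rho> / 2"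
    proof -
      have "\<bar>\<rho> / 2 * cos \<theta>\<bar> \<le> \<rho> / 2" for \<theta>
        using I mult_mono[of "\<rho> / 2" "\<rho> / 2" "\<bar>cos \<theta>\<bar>" 1] by (simp add: abs_mult)
      then show ?thesis unfolding arcsine_def by (subst AE_distr_iff) auto
    qed
    have "mutual_energy ?b ?b = (\<integral>\<^sup>+x. ennreal (ln (4 / (\<rho> / 2))) \<partial>?b)"
      unfolding mutual_energy_def
    proof (rule nn_integral_cong_AE)
      show "AE x in ?b. (\<integral>\<^sup>+y. log_kernel x y \<partial>?b) = ennreal (ln (4 / (\<rho> / 2)))"
        using AE by eventually_elim (rule potential_arcsine, use I \<rho>1 in auto)
    qed
    then show ?thesis by (simp add: emeasure_space_1)
  qed
  show thesis
  proof
    show "0 < \<eta> * \<eta>" using \<eta> by simp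
    fix m assume m: "real_prob_on m (?E - {c - \<rho>..c + \<rho>})"
    interpret prob_space m using m by (rule real_prob_on_prob_space)
    have mE: "real_prob_on m ?E" using m by (rule real_prob_on_mono) auto
    note [measurable_cong] = real_prob_on_sets[OF m]
    have fm: "finite_measure m" and sm: "sets m = sets borel"
      using real_prob_on_finite_measure[OF m] real_prob_on_sets[OF m] by auto
    show "ennreal (level + \<eta> * \<eta>) \<le> mutual_energy m m"
    proof (cases "mutual_energy m m = \<top>")
      case False
      then obtain q where q: "mutual_energy m m = ennreal q" "0 \<le> q" by (cases "mutual_energy m m") auto
      have "2 * mutual_energy m ?a \<le> mutual_energy m m + mutual_energy ?a ?a"
        using mutual_energy_positive[OF fm fin sm] by simp
      also have "\<dots> < \<top>" using q arc[of \<rho>] I by simp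
      finally have "mutual_energy m ?a < \<top>" by (auto simp: ennreal_mult_less_top)
      then obtain a where a: "mutual_energy m ?a = ennreal a" "0 \<le> a" by (cases "mutual_energy m ?a") auto
      have le: "mutual_energy m ?b + ennreal \<eta> \<le> mutual_energy m ?a"
      proof -
        interpret pb: prob_space ?b by (rule prob_space_arcsine)
        have "mutual_energy m ?b + ennreal \<eta> = (\<integral>\<^sup>+x. (\<integral>\<^sup>+y. log_kernel x y \<partial>?b) + ennreal \<eta> \<partial>m)"
          unfolding mutual_energy_def by (subst nn_integral_add) (auto simp: emeasure_space_1)
        also have "\<dots> \<le> mutual_energy m ?a"
          unfolding mutual_energy_def
        proof (rule nn_integral_mono_AE)
          show "AE x in m. (\<integral>\<^sup>+y. log_kernel x y \<partial>?b) + ennreal \<eta> \<le> (\<integral>\<^sup>+y. log_kernel x y \<partial>?a)"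
            using real_prob_on_AE[OF m]
          proof eventually_elim
            case (elim x)
            show ?case unfolding \<eta>_def
              by (rule potential_arcsine_less[OF _ _ I1]) (use elim I(1) in \<open>auto simp: abs_if\<close>)
          qed
        qed
        finally show ?thesis .
      qed
      then have "mutual_energy m ?b < \<top>" using a by (metis ennreal_add_less_top ennreal_less_top le_less_trans)
      then obtain b where b: "mutual_energy m ?b = ennreal b" "0 \<le> b" by (cases "mutual_energy m ?b") auto
      have ba: "b + \<eta> \<le> a" using le a b \<eta> by (simp flip: ennreal_plus)
      have L: "0 \<le> ln (4 / \<rho>)" "0 \<le> ln (8 / \<rho>)" using I \<rho>1 by (auto intro!: ln_ge_zero simp: field_simps)
      have ln8: "ln (8 / \<rho>) = ln (4 / \<rho>) + ln 2" using I ln_mult_pos[of "4 / \<rho>" 2] by simp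
      have comm: "mutual_energy pullback ?a = ennreal level"
        using mutual_energy_commute[OF finite_measure_pullback fin] mutual_energy_pullback[OF suppE[of \<rho>]] I by simp
      have "ennreal (2 * (level + \<eta> * a + \<eta> * level + \<eta> * \<eta> * ln (4 / \<rho>))) \<le>
         ennreal ((q + 2 * \<eta> * b + \<eta> * \<eta> * ln (8 / \<rho>)) + (level + 2 * \<eta> * level + \<eta> * \<eta> * ln (4 / \<rho>)))"
        using mutual_energy_positive_perturbed[OF fm finite_measure_pullback fin[of \<rho>] fin[of "\<rho> / 2"] sm, of "ennreal \<eta>"]
          mutual_energy_pullback[OF mE] mutual_energy_pullback[OF suppE[of "\<rho> / 2"]] mutual_energy_pullback[OF real_prob_on_pullback]
          arc[of "\<rho> / 2"] arc[of \<rho>] bb a b q L \<eta> level_pos I comm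
        by (simp add: ennreal_mult)
      then have "2 * (level + \<eta> * a + \<eta> * level + \<eta> * \<eta> * ln (4 / \<rho>)) \<le>
         (q + 2 * \<eta> * b + \<eta> * \<eta> * ln (8 / \<rho>)) + (level + 2 * \<eta> * level + \<eta> * \<eta> * ln (4 / \<rho>))"
        using q b L \<eta> level_pos by (subst (asm) ennreal_le_iff) (auto intro!: add_nonneg_nonneg mult_nonneg_nonneg)
      moreover have "\<eta> * (b + \<eta>) \<le> \<eta> * a" using ba \<eta> by (intro mult_left_mono) auto
      moreover have "\<eta> * \<eta> * ln 2 \<le> \<eta> * \<eta> * 1" using ln_2_less_1 by (intro mult_left_mono) auto
      ultimately have "level + \<eta> * \<eta> \<le> q" unfolding ln8 by (simp add: algebra_simps)
      then show ?thesis using q by (simp add: ennreal_leI)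
    qed simp
  qed
qed

end

section \<open>The polynomial preimage attached to an alternant\<close>

lemma IVT_strict:
  fixes F :: "real \<Rightarrow> real"
  assumes "a < b" "continuous_on {a..b} F" "min (F a) (F b) < v" "v < max (F a) (F b)"
  shows "\<exists>x\<in>{a<..<b}. F x = v"
proof -
  have "\<exists>x. a \<le> x \<and> x \<le> b \<and> F x = v"
  proof (cases "F a \<le> F b")
    case True
    then show ?thesis using IVT'[of F a v b] assms by (auto simp: min_def max_def)
  next
    case False
    then show ?thesis using IVT2'[of F b v a] assms by (auto simp: min_def max_def split: if_splits)
  qed
  then obtain x where x: "a \<le> x" "x \<le> b" "F x = v" by blast
  moreover have "x \<noteq> a" "x \<noteq> b" using assms(3,4) x(3) by auto
  ultimately show ?thesis by (intro bexI[of _ x]) auto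
qed

locale alternant =
  fixes T :: "real poly" and M :: real and n :: nat and xs :: "nat \<Rightarrow> real" and \<sigma> :: real
  assumes deg_T: "degree T = n" and monic_T: "lead_coeff T = 1" and M_pos: "0 < M"
    and xs_less: "\<And>i. i < n \<Longrightarrow> xs i < xs (Suc i)" and xs_mem: "\<And>i. i \<le> n \<Longrightarrow> xs i \<in> {-1..1}" and \<sigma>: "\<bar>\<sigma>\<bar> = 1"
    and alternation: "\<And>i. i \<le> n \<Longrightarrow> sqrt (1 - xs i) * poly T (xs i) = \<sigma> * (-1) ^ (n - i) * M"
begin

text \<open>The orientation-reversing affine map of \<open>[0, M\<^sup>2]\<close> onto [-1, 1] is
  applied to the squared weighted polynomial: the alternation points go to -1, the zeros of T and
  the point 1 go to 1.\<close>

definition R :: "real poly" where "R = [:1:] - smult (2 / M\<^sup>2) ([:1, -1:] * T\<^sup>2)"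

lemma poly_R: "poly R x = 1 - 2 * ((1 - x) * (poly T x)\<^sup>2 / M\<^sup>2)"
  by (simp add: R_def field_simps)

lemma degree_R: "degree R = 2 * n + 1" and lead_coeff_R: "\<bar>lead_coeff R\<bar> = 2 / M\<^sup>2"
proof -
  let ?Q = "smult (2 / M\<^sup>2) ([:1, -1:] * T\<^sup>2)"
  have T0: "T \<noteq> 0" using monic_T by auto
  have dQ: "degree ?Q = 2 * n + 1"
    using T0 M_pos by (simp add: degree_mult_eq degree_power_eq deg_T del: mult_pCons_left)
  have lQ: "lead_coeff ?Q = - (2 / M\<^sup>2)"
    using monic_T by (simp add: lead_coeff_mult lead_coeff_power del: mult_pCons_left)
  show d: "degree R = 2 * n + 1"
    unfolding R_def using dQ degree_add_eq_right[of "[:1:]" "- ?Q"] by simp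
  have "lead_coeff R = coeff [:1:] (2 * n + 1) - lead_coeff ?Q"
    unfolding d unfolding R_def dQ by simp
  then show "\<bar>lead_coeff R\<bar> = 2 / M\<^sup>2" unfolding lQ by simp
qed

lemma xs_mono: "i \<le> j \<Longrightarrow> j \<le> n \<Longrightarrow> xs i \<le> xs j"
proof (induction j)
  case (Suc j)
  then show ?case using xs_less[of j] by (cases "i = Suc j") (auto simp: le_Suc_eq)
qed simp

lemma xs_n_less_1: "xs n < 1"
proof -
  have "sqrt (1 - xs n) * poly T (xs n) \<noteq> 0" using alternation[of n] M_pos \<sigma> by auto
  then have "xs n \<noteq> 1" by auto
  then show ?thesis using xs_mem[of n] by auto
qed

section \<open>Counting solutions between alternation points\<close>

definition cell :: "nat \<Rightarrow> real set" where
  "cell i = {xs i<..<(if i < n then xs (Suc i) else 1)}"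

definition fiber_in :: "real \<Rightarrow> nat \<Rightarrow> real set" where
  "fiber_in y i = {x\<in>cell i. poly R x = y}"

lemma cell_subset: "i \<le> n \<Longrightarrow> cell i \<subseteq> {-1<..<1}"
  using xs_mem[of i] xs_mem[of "Suc i"] by (auto simp: cell_def)

lemma cell_less: "i < j \<Longrightarrow> j \<le> n \<Longrightarrow> x \<in> cell i \<Longrightarrow> x' \<in> cell j \<Longrightarrow> x < xs j \<and> xs j < x'"
  using xs_mono[of "Suc i" j] by (auto simp: cell_def)

lemma finite_fiber: "finite {x. poly R x = y}"
  by (rule poly_fiber(1)) (simp add: degree_R)

lemma card_fiber_le: "card {x. poly R x = y} \<le> 2 * n + 1"
  using poly_fiber(2)[of R y] by (simp add: degree_R)

text \<open>On x \<le> 1, R x = y follows once the weighted polynomial F equals s M or - s M.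
  Between consecutive alternation points F crosses both values; on the last cell it only runs from
  \<sigma> M to F 1 = 0 and crosses the one with the sign \<sigma>.\<close>

lemma card_fiber_in_ge:
  assumes y: "y \<in> {-1<..<1}" and i: "i \<le> n"
  shows "(if i < n then 2 else 1) \<le> card (fiber_in y i)"
proof -
  define F where "F x = sqrt (1 - x) * poly T x" for x
  define s where "s = sqrt ((1 - y) / 2)"
  have s: "0 < s" "s < 1" "s\<^sup>2 = (1 - y) / 2" using y by (auto simp: s_def)
  have cont: "continuous_on S F" for S unfolding F_def by (intro continuous_intros)
  have root: "poly R x = y" if "x \<le> 1" "(F x)\<^sup>2 = (s * M)\<^sup>2" for x
  proof -
    have "(1 - x) * (poly T x)\<^sup>2 = (F x)\<^sup>2" using that by (simp add: F_def power_mult_distrib)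
    also have "\<dots> = (1 - y) / 2 * M\<^sup>2" using that s by (simp add: power_mult_distrib)
    finally have "(1 - x) * (poly T x)\<^sup>2 / M\<^sup>2 = (1 - y) / 2" using M_pos by simp
    then show ?thesis unfolding poly_R by simp
  qed
  have sM: "0 < s * M" "s * M < M" using s M_pos by auto
  show ?thesis
  proof (cases "i < n")
    case True
    have F1: "F (xs i) = \<sigma> * (-1) ^ (n - i) * M" "F (xs (Suc i)) = - (\<sigma> * (-1) ^ (n - i) * M)"
      using alternation[of i] alternation[of "Suc i"] True
      by (auto simp: F_def Suc_diff_Suc[symmetric] simp del: power_Suc2)
    have "\<bar>\<sigma> * (-1) ^ (n - i) * M\<bar> = M" using \<sigma> M_pos by (simp add: abs_mult power_abs)
    then have "min (F (xs i)) (F (xs (Suc i))) = - M" "max (F (xs i)) (F (xs (Suc i))) = M"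
      unfolding F1 by (auto simp: min_def max_def abs_if split: if_splits)
    then have "\<exists>x\<in>{xs i<..<xs (Suc i)}. F x = s * M" "\<exists>x\<in>{xs i<..<xs (Suc i)}. F x = - (s * M)"
      using sM xs_less[OF True] cont by (auto intro!: IVT_strict)
    then obtain a b where ab: "a \<in> cell i" "b \<in> cell i" "F a = s * M" "F b = - (s * M)"
      using True by (auto simp: cell_def)
    moreover have "a \<noteq> b" using ab sM by auto
    moreover have "a \<le> 1" "b \<le> 1" using ab cell_subset[OF i] by auto
    ultimately have sub: "{a, b} \<subseteq> fiber_in y i" by (auto simp: fiber_in_def intro!: root)
    have "card {a, b} \<le> card (fiber_in y i)"
      by (rule card_mono[OF _ sub]) (auto simp: fiber_in_def intro: finite_subset[OF _ finite_fiber[of y]])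
    then show ?thesis using True \<open>a \<noteq> b\<close> by simp
  next
    case False
    then have [simp]: "i = n" using i by simp
    define v where "v = \<sigma> * (s * M)"
    have F1: "F (xs n) = \<sigma> * M" "F 1 = 0" using alternation[of n] by (auto simp: F_def)
    have "\<sigma> = 1 \<or> \<sigma> = -1" using \<sigma> by linarith
    then have "min (F (xs n)) (F 1) < v" "v < max (F (xs n)) (F 1)"
      unfolding F1 v_def using sM by auto
    then obtain a where a: "a \<in> {xs n<..<1}" "F a = v"
      using IVT_strict[OF xs_n_less_1 cont] by blast
    have "v\<^sup>2 = (s * M)\<^sup>2" using \<open>\<sigma> = 1 \<or> \<sigma> = -1\<close> by (auto simp: v_def)
    then have sub: "{a} \<subseteq> fiber_in y i" using a by (auto simp: fiber_in_def cell_def intro!: root)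
    have "card {a} \<le> card (fiber_in y i)"
      by (rule card_mono[OF _ sub]) (auto simp: fiber_in_def intro: finite_subset[OF _ finite_fiber[of y]])
    then show ?thesis by simp
  qed
qed

text \<open>The lower bounds for the cells add up to 2 n + 1, the degree of R, so none of them can
  be exceeded and no solution lies outside the cells.\<close>

lemma fiber_structure:
  assumes y: "y \<in> {-1<..<1}"
  shows "card {x. poly R x = y} = 2 * n + 1" "{x. poly R x = y} = (\<Union>i\<le>n. fiber_in y i)"
    "i \<le> n \<Longrightarrow> card (fiber_in y i) = (if i < n then 2 else 1)"
proof -
  let ?lb = "\<lambda>i. if i < n then 2 else 1 :: nat"
  have sub: "(\<Union>i\<le>n. fiber_in y i) \<subseteq> {x. poly R x = y}" by (auto simp: fiber_in_def)
  have fin: "finite (fiber_in y i)" for i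
    using finite_subset[OF _ finite_fiber[of y]] by (auto simp: fiber_in_def)
  have disj: "fiber_in y i \<inter> fiber_in y j = {}" if "i \<le> n" "j \<le> n" "i < j" for i j
    using cell_less[OF that(3,2)] by (force simp: fiber_in_def)
  have disj': "fiber_in y i \<inter> fiber_in y j = {}" if "i \<le> n" "j \<le> n" "i \<noteq> j" for i j
    using disj[of i j] disj[of j i] that by (metis Int_commute linorder_neqE_nat)
  have card: "card (\<Union>i\<le>n. fiber_in y i) = (\<Sum>i\<le>n. card (fiber_in y i))"
    by (rule card_UN_disjoint) (use fin disj' in auto)
  have "(\<Sum>i\<le>n. ?lb i) = (\<Sum>i<n. ?lb i) + ?lb n"
    by (simp add: lessThan_Suc_atMost[symmetric])
  also have "(\<Sum>i<n. ?lb i) = (\<Sum>i<n. 2)" by (intro sum.cong) auto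
  finally have lb: "(\<Sum>i\<le>n. ?lb i) = 2 * n + 1" by simp
  have ge: "(\<Sum>i\<le>n. ?lb i) \<le> (\<Sum>i\<le>n. card (fiber_in y i))"
    by (intro sum_mono card_fiber_in_ge[OF y]) auto
  have le: "(\<Sum>i\<le>n. card (fiber_in y i)) \<le> card {x. poly R x = y}"
    unfolding card[symmetric] by (rule card_mono[OF finite_fiber sub])
  show c: "card {x. poly R x = y} = 2 * n + 1" using ge le lb card_fiber_le[of y] by simp
  have eq: "(\<Sum>i\<le>n. card (fiber_in y i)) = (\<Sum>i\<le>n. ?lb i)" using ge le lb card_fiber_le[of y] by simp
  show "{x. poly R x = y} = (\<Union>i\<le>n. fiber_in y i)"
    using card_subset_eq[OF finite_fiber sub] eq lb c card by simp
  show "i \<le> n \<Longrightarrow> card (fiber_in y i) = ?lb i"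
    using sum_mono_inv[OF eq[symmetric], of i] card_fiber_in_ge[OF y] by simp
qed

sublocale full_preimage R "{}"
proof
  fix y :: real assume "y \<in> {-1<..<1} - {}"
  then have y: "y \<in> {-1<..<1}" by simp
  show "card {x. poly R x = y} = degree R" using fiber_structure(1)[OF y] by (simp add: degree_R)
  show "{x. poly R x = y} \<subseteq> {-1..1}"
    unfolding fiber_structure(2)[OF y] using cell_subset by (force simp: fiber_in_def)
qed (auto simp: degree_R)

lemma level_eq: "level = ln 2 + ln (4 / M\<^sup>2) / (2 * n + 1)"
  unfolding level_def lead_coeff_R by (simp add: degree_R)

text \<open>Solutions in two different cells have an alternation point between them, which an
  interval containing both would contain as well; so all solutions in I lie in one cell.\<close>

lemma card_fiber_interval:
  assumes y: "y \<in> {-1<..<1}" and I: "is_interval I" "\<And>i. i \<le> n \<Longrightarrow> xs i \<notin> I"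
  shows "card {x\<in>I. poly R x = y} \<le> 2"
proof (cases "{x\<in>I. poly R x = y} = {}")
  case False
  then obtain x where x: "x \<in> I" "poly R x = y" by auto
  then have "x \<in> (\<Union>i\<le>n. fiber_in y i)" using fiber_structure(2)[OF y] by blast
  then obtain i where i: "i \<le> n" "x \<in> fiber_in y i" by blast
  have "{x\<in>I. poly R x = y} \<subseteq> fiber_in y i"
  proof
    fix x' assume x': "x' \<in> {x\<in>I. poly R x = y}"
    then have "x' \<in> (\<Union>i\<le>n. fiber_in y i)" using fiber_structure(2)[OF y] by blast
    then obtain j where j: "j \<le> n" "x' \<in> fiber_in y j" by blast
    have "i = j"
    proof (rule ccontr)
      assume "i \<noteq> j"
      then consider "i < j" | "j < i" by linarith
      then show False
      proof cases
        case 1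
        then have "x < xs j" "xs j < x'" using cell_less[OF 1] i j by (auto simp: fiber_in_def)
        then have "xs j \<in> I" using I(1)[unfolded is_interval_1, rule_format, of x x' "xs j"] x x' by auto
        then show False using I(2) j by blast
      next
        case 2
        then have "x' < xs i" "xs i < x" using cell_less[OF 2] i j by (auto simp: fiber_in_def)
        then have "xs i \<in> I" using I(1)[unfolded is_interval_1, rule_format, of x' x "xs i"] x x' by auto
        then show False using I(2) i by blast
      qed
    qed
    then show "x' \<in> fiber_in y i" using j by simp
  qed
  then have "card {x\<in>I. poly R x = y} \<le> card (fiber_in y i)"
    by (rule card_mono[rotated]) (auto simp: fiber_in_def intro: finite_subset[OF _ finite_fiber[of y]])
  then show ?thesis using fiber_structure(3)[OF y i(1)] by (auto split: if_splits)
next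
  case True
  then show ?thesis by (simp only: card.empty)
qed

lemma card_fiber_last:
  assumes y: "y \<in> {-1<..<1}" and b: "xs n \<le> b"
  shows "card {x\<in>{b<..}. poly R x = y} \<le> 1"
proof -
  have "{x\<in>{b<..}. poly R x = y} \<subseteq> fiber_in y n"
  proof
    fix x assume x: "x \<in> {x\<in>{b<..}. poly R x = y}"
    then have "x \<in> (\<Union>i\<le>n. fiber_in y i)" using fiber_structure(2)[OF y] by blast
    then obtain i where i: "i \<le> n" "x \<in> fiber_in y i" by blast
    have "i = n"
    proof (rule ccontr)
      assume "i \<noteq> n"
      then have "x < xs (Suc i)" "Suc i \<le> n" using i by (auto simp: fiber_in_def cell_def)
      then have "x < xs n" using xs_mono[of "Suc i" n] by simp
      then show False using x b by simp
    qed
    then show "x \<in> fiber_in y n" using i by simp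
  qed
  then have "card {x\<in>{b<..}. poly R x = y} \<le> card (fiber_in y n)"
    by (rule card_mono[rotated]) (auto simp: fiber_in_def intro: finite_subset[OF _ finite_fiber[of y]])
  then show ?thesis using fiber_structure(3)[OF y, of n] by simp
qed

lemma fiber_first:
  assumes y: "y \<in> {-1<..<1}"
  shows "{x\<in>{..xs 0}. poly R x = y} = {}"
proof -
  have False if x: "x \<le> xs 0" "poly R x = y" for x
  proof -
    have "x \<in> (\<Union>i\<le>n. fiber_in y i)" using fiber_structure(2)[OF y] x by blast
    then obtain i where "i \<le> n" "xs i < x" by (auto simp: fiber_in_def cell_def)
    then show False using xs_mono[of 0 i] x by simp
  qed
  then show ?thesis by auto
qed

end

section \<open>Approximation and reality of preimages\<close>

context full_preimage
begin

lemma near_open_value: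
  assumes "v \<in> {-1..1}" "0 < e"
  shows "\<exists>y\<in>{-1<..<1} - B. \<bar>v - y\<bar> < e"
proof -
  have "infinite ({max (-1) (v - e)<..<min 1 (v + e)} - B)"
    using assms finite_B by (intro Diff_infinite_finite) (auto simp: infinite_Ioo)
  then obtain y where "y \<in> {max (-1) (v - e)<..<min 1 (v + e)} - B" by (metis ex_in_conv finite.emptyI)
  then show ?thesis by (intro bexI[of _ y]) auto
qed

text \<open>If all solutions of R r = y kept distance e from x, the factorization would bound the
  distance of R x and y below by a positive constant; take y closer to R x than that.\<close>

lemma near_open_fiber:
  assumes "\<bar>poly R x\<bar> \<le> 1" "0 < e"
  shows "\<exists>r. \<bar>x - r\<bar> < e \<and> poly R r \<in> {-1<..<1} - B"
proof (rule ccontr)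
  assume *: "\<not> ?thesis"
  have "R \<noteq> 0" using degree_pos by auto
  then have L: "0 < \<bar>lead_coeff R\<bar> * e ^ degree R" using assms by simp
  then obtain y where y: "y \<in> {-1<..<1} - B" "\<bar>poly R x - y\<bar> < \<bar>lead_coeff R\<bar> * e ^ degree R"
    using near_open_value[of "poly R x" "\<bar>lead_coeff R\<bar> * e ^ degree R"] assms by (auto simp: abs_le_iff)
  have "e \<le> \<bar>x - r\<bar>" if "poly R r = y" for r using * y that by (auto simp: not_less)
  then have "(\<Prod>r | poly R r = y. e) \<le> (\<Prod>r | poly R r = y. \<bar>x - r\<bar>)"
    using assms by (intro prod_mono) auto
  then have "\<bar>lead_coeff R\<bar> * e ^ degree R \<le> \<bar>poly R x - y\<bar>"
    unfolding poly_diff_eq_prod[OF y(1)] abs_mult abs_prod using card_fiber[OF y(1)]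
    by (intro mult_left_mono) auto
  then show False using y by simp
qed

text \<open>The same estimate in the plane: a point z has distance at least the modulus of
  \<open>Im z\<close> from every real root, while admissible values y come arbitrarily close to
  v.\<close>

lemma preimage_real:
  assumes "poly (map_poly complex_of_real R) z = complex_of_real v" "v \<in> {-1..1}"
  shows "Im z = 0"
proof (rule ccontr)
  assume Im: "Im z \<noteq> 0"
  have "R \<noteq> 0" using degree_pos by auto
  then have "0 < \<bar>lead_coeff R\<bar> * \<bar>Im z\<bar> ^ degree R" using Im by simp
  then obtain y where y: "y \<in> {-1<..<1} - B" "\<bar>v - y\<bar> < \<bar>lead_coeff R\<bar> * \<bar>Im z\<bar> ^ degree R"
    using near_open_value[OF assms(2)] by blast
  let ?F = "{r. poly R r = y}"
  define p where "p = map_poly complex_of_real R - [:complex_of_real y:]"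
  have dR: "degree (map_poly complex_of_real R) = degree R" by (simp add: degree_map_poly)
  then have dp: "degree p = degree R"
    using degree_pos degree_add_eq_left[of "- [:complex_of_real y:]" "map_poly complex_of_real R"]
    by (simp add: p_def del: minus_pCons)
  have lp: "lead_coeff p = complex_of_real (lead_coeff R)"
    unfolding dp unfolding p_def using degree_pos by (simp add: coeff_map_poly coeff_pCons split: nat.split)
  have inj: "inj_on complex_of_real ?F" by (simp add: inj_on_def)
  have fact: "p = smult (lead_coeff p) (\<Prod>r\<in>complex_of_real ` ?F. [:-r, 1:])"
  proof (rule poly_eq_smult_prod_roots)
    show "card (complex_of_real ` ?F) = degree p" unfolding card_image[OF inj] dp by (rule card_fiber[OF y(1)])
  qed (use finite_fiber[of y] in \<open>auto simp: p_def poly_map_poly_of_real\<close>)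
  have "poly p z = poly (smult (lead_coeff p) (\<Prod>r\<in>complex_of_real ` ?F. [:-r, 1:])) z"
    by (rule arg_cong[OF fact, of "\<lambda>q. poly q z"])
  also have "\<dots> = lead_coeff p * (\<Prod>r\<in>complex_of_real ` ?F. z - r)"
    by (simp add: poly_prod)
  finally have "complex_of_real (v - y) = complex_of_real (lead_coeff R) * (\<Prod>r\<in>?F. z - complex_of_real r)"
    unfolding lp prod.reindex[OF inj] using assms(1) by (simp add: p_def)
  then have "\<bar>v - y\<bar> = \<bar>lead_coeff R\<bar> * (\<Prod>r\<in>?F. cmod (z - complex_of_real r))"
    by (metis norm_mult norm_of_real prod_norm)
  also have "\<dots> \<ge> \<bar>lead_coeff R\<bar> * (\<Prod>r\<in>?F. \<bar>Im z\<bar>)"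
  proof (intro mult_left_mono prod_mono conjI)
    show "\<bar>Im z\<bar> \<le> cmod (z - complex_of_real r)" for r
      using abs_Im_le_cmod[of "z - complex_of_real r"] by simp
  qed auto
  finally show False using y card_fiber[OF y(1)] by simp
qed

end

section \<open>The lower bound for the Widom factor\<close>

lemma ln_widom_bound:
  assumes "0 < C"
  shows "ln (2 * sqrt C * C ^ n) = ln 2 + (real n + 1/2) * ln C"
proof -
  have "ln (2 * sqrt C * C ^ n) = ln 2 + ln (sqrt C) + ln (C ^ n)"
    using assms by (simp add: ln_mult_pos)
  then show ?thesis using assms by (simp add: ln_sqrt ln_realpow algebra_simps)
qed

lemma ln_four_div_square:
  fixes M :: real
  assumes "0 < M"
  shows "ln (4 / M\<^sup>2) = 2 * (ln 2 - ln M)"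
proof -
  have "4 / M\<^sup>2 = (2 / M)\<^sup>2" by (simp add: power_divide)
  then show ?thesis using assms by (simp add: ln_realpow ln_div)
qed

text \<open>Compares the capacities of the polynomial preimage and of K: for capacity C of K, (M^2 /
  4) to the power 1 / (2 n + 1) is at least C exactly if M is at least 2 C^(n + 1/2).\<close>

lemma level_le_iff:
  assumes "0 < C" "0 < M"
  shows "ln (4 / M\<^sup>2) / (2 * real n + 1) \<le> - ln C \<longleftrightarrow> 2 * sqrt C * C ^ n \<le> M"
    and "ln (4 / M\<^sup>2) / (2 * real n + 1) = - ln C \<longleftrightarrow> 2 * sqrt C * C ^ n = M"
proof -
  have pos: "0 < 2 * sqrt C * C ^ n" using assms by simp
  note l4 = ln_four_div_square[OF assms(2)]
  have "ln (4 / M\<^sup>2) / (2 * real n + 1) \<le> - ln C \<longleftrightarrow> ln (2 * sqrt C * C ^ n) \<le> ln M"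
    unfolding l4 ln_widom_bound[OF assms(1)] by (subst pos_divide_le_eq) (auto simp: algebra_simps)
  then show "ln (4 / M\<^sup>2) / (2 * real n + 1) \<le> - ln C \<longleftrightarrow> 2 * sqrt C * C ^ n \<le> M"
    using pos assms by simp
  have "ln (4 / M\<^sup>2) / (2 * real n + 1) = - ln C \<longleftrightarrow> ln (2 * sqrt C * C ^ n) = ln M"
    unfolding l4 ln_widom_bound[OF assms(1)] by (subst divide_eq_eq) (auto simp: algebra_simps)
  then show "ln (4 / M\<^sup>2) / (2 * real n + 1) = - ln C \<longleftrightarrow> 2 * sqrt C * C ^ n = M"
    using pos assms by simp
qed

lemma poly_eq_on_infinite_reals:
  fixes p q :: "complex poly"
  assumes "infinite A" "\<And>x. x \<in> A \<Longrightarrow> poly p (complex_of_real x) = poly q (complex_of_real x)"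
  shows "p = q"
proof (rule ccontr)
  assume "p \<noteq> q"
  then have "finite {z. poly (p - q) z = 0}" by (intro poly_roots_finite) simp
  moreover have "complex_of_real ` A \<subseteq> {z. poly (p - q) z = 0}" using assms(2) by auto
  ultimately have "finite (complex_of_real ` A)" by (rule finite_subset[rotated])
  then show False using assms(1) by (simp add: finite_image_iff inj_on_def)
qed

lemma pderiv_map_poly_of_real:
  "pderiv (map_poly complex_of_real p) = map_poly complex_of_real (pderiv p)"
  by (rule poly_eqI) (simp add: coeff_pderiv coeff_map_poly)

section \<open>The extremal problem with weight sqrt (1 - x)\<close>

locale sqrt_weight_problem =
  fixes K :: "real set" and n :: nat
  assumes compact: "compact K" and K_subset: "K \<subseteq> {-1..1}" and Cap_pos: "0 < Cap (cset K)" and n_pos: "1 \<le> n"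
begin

abbreviation w :: "real \<Rightarrow> real" where "w \<equiv> \<lambda>x. sqrt (1 - x)"

lemma closed_K: "closed K"
  using compact by (rule compact_imp_closed)

lemma infinite_K: "infinite K"
  using Cap_finite_eq_0[of K] K_subset Cap_pos by auto

sublocale weighted_chebyshev K w n
proof
  have "{x\<in>K. w x \<noteq> 0} = K - {1}" by auto
  then show "infinite {x\<in>K. w x \<noteq> 0}" using infinite_K by simp
  show "0 \<le> w x" if "x \<in> K" for x using that K_subset by auto
qed (auto intro!: continuous_intros compact)

lemma alternant_exists:
  obtains T xs \<sigma> where "alternant T (cheb_t K w n) n xs \<sigma>" "\<And>i. i \<le> n \<Longrightarrow> xs i \<in> K"
    "K \<subseteq> {x\<in>{-1..1}. \<bar>poly (alternant.R T (cheb_t K w n)) x\<bar> \<le> 1}"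
proof (rule chebyshev_alternation[OF n_pos])
  let ?M = "cheb_t K w n"
  fix T xs \<sigma> assume T: "degree T = n" "lead_coeff T = 1" "0 < ?M"
    "\<And>x. x \<in> K \<Longrightarrow> w x * \<bar>poly T x\<bar> \<le> ?M"
    "\<And>i. i < n \<Longrightarrow> xs i < xs (Suc i)" "\<And>i. i \<le> n \<Longrightarrow> xs i \<in> K" "\<bar>\<sigma>\<bar> = 1"
    "\<And>i. i \<le> n \<Longrightarrow> w (xs i) * poly T (xs i) = \<sigma> * (-1) ^ (n - i) * ?M"
  interpret alternant T ?M n xs \<sigma>
    using T subsetD[OF K_subset T(6)] by unfold_locales auto
  have "\<bar>poly R x\<bar> \<le> 1" if "x \<in> K" for x
  proof -
    have "(w x * \<bar>poly T x\<bar>)\<^sup>2 \<le> ?M\<^sup>2"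
      using T(4)[OF that] w_nonneg[OF that] by (intro power_mono) auto
    moreover have "(w x * \<bar>poly T x\<bar>)\<^sup>2 = (1 - x) * (poly T x)\<^sup>2"
      using that K_subset by (auto simp: power_mult_distrib)
    moreover have "0 \<le> (1 - x) * (poly T x)\<^sup>2" using that K_subset by auto
    ultimately have "0 \<le> (1 - x) * (poly T x)\<^sup>2 / ?M\<^sup>2" "(1 - x) * (poly T x)\<^sup>2 / ?M\<^sup>2 \<le> 1"
      using T(3) by (auto simp: divide_le_eq)
    then show ?thesis unfolding poly_R by (simp add: abs_le_iff)
  qed
  then show thesis using that[OF alternant_axioms T(6)] K_subset by blast
qed

lemma robin_eq: "robin (cset K) = ereal (- ln (Cap (cset K)))"
  using closed_K K_subset Cap_pos by (rule robin_eq_ln_Cap)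

theorem cheb_t_ge: "2 * sqrt (Cap (cset K)) * Cap (cset K) ^ n \<le> cheb_t K w n"
proof -
  obtain T xs \<sigma> where T: "alternant T (cheb_t K w n) n xs \<sigma>"
    "K \<subseteq> {x\<in>{-1..1}. \<bar>poly (alternant.R T (cheb_t K w n)) x\<bar> \<le> 1}"
    by (rule alternant_exists)
  interpret alternant T "cheb_t K w n" n xs \<sigma> by fact
  have "ereal (level - ln 2) \<le> robin (cset K)"
    using closed_K K_subset level_pos T(2)
    by (intro robin_ge) (auto intro!: mutual_energy_ge_level elim: real_prob_on_mono)
  then show ?thesis
    unfolding robin_eq level_eq by (simp add: level_le_iff(1)[OF Cap_pos M_pos, symmetric] add.commute)
qed

theorem cheb_t_eq_imp_preimage:
  assumes "cheb_t K w n = 2 * sqrt (Cap (cset K)) * Cap (cset K) ^ n"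
  shows "\<exists>S :: complex poly. degree S = n \<and> cset K = {z. (1 - z) * (poly S z)\<^sup>2 \<in> complex_of_real ` {0..1}}"
proof -
  define M where "M = cheb_t K w n"
  obtain T xs \<sigma> where T: "alternant T M n xs \<sigma>"
    "K \<subseteq> {x\<in>{-1..1}. \<bar>poly (alternant.R T M) x\<bar> \<le> 1}"
    unfolding M_def by (rule alternant_exists)
  interpret alternant T M n xs \<sigma> by fact
  let ?E = "{x\<in>{-1..1}. \<bar>poly R x\<bar> \<le> 1}"
  have rob: "robin (cset K) = ereal (level - ln 2)"
    unfolding robin_eq level_eq using level_le_iff(2)[OF Cap_pos M_pos, of n] assms by (simp add: M_def add.commute)
  have R_E: "x \<in> K" if x: "\<bar>poly R x\<bar> \<le> 1" for x
  proof (rule ccontr)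
    assume "x \<notin> K"
    then obtain e where e: "0 < e" "ball x e \<inter> K = {}"
      using closed_K open_contains_ball[of "- K"] by (metis ComplI disjoint_eq_subset_Compl open_Compl)
    \<comment> \<open>At x itself the modulus of R may be 1, so x need not have a neighbourhood
      inside the preimage. A nearby point r with R r in (-1, 1) is still off K and has one.\<close>
    obtain r where r: "\<bar>x - r\<bar> < e" "poly R r \<in> {-1<..<1}"
      using near_open_fiber[OF x e(1)] by auto
    have "r \<in> (\<Union>i\<le>n. fiber_in (poly R r) i)" using fiber_structure(2)[OF r(2)] by blast
    then obtain i where "i \<le> n" "r \<in> cell i" by (auto simp: fiber_in_def)
    then have r1: "r \<in> {-1<..<1}" using cell_subset by blast
    have "open (ball x e \<inter> {-1<..<1} \<inter> poly R -` {-1<..<1})"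
      by (intro open_Int open_vimage) (auto intro!: continuous_intros)
    moreover have "r \<in> ball x e \<inter> {-1<..<1} \<inter> poly R -` {-1<..<1}"
      using r r1 by (auto simp: dist_real_def)
    ultimately obtain d where d: "0 < d" "cball r d \<subseteq> ball x e \<inter> {-1<..<1} \<inter> poly R -` {-1<..<1}"
      using open_contains_cball by blast
    have cb: "cball r d = {r - d..r + d}" by (rule cball_eq_atLeastAtMost)
    have sub: "{r - d..r + d} \<subseteq> ?E" using d(2) unfolding cb by (auto simp: abs_le_iff less_imp_le)
    obtain \<delta> where \<delta>: "0 < \<delta>" "\<And>m. real_prob_on m (?E - {r - d..r + d}) \<Longrightarrow> ennreal (level + \<delta>) \<le> mutual_energy m m"
      using mutual_energy_gap[OF d(1) sub] by blast
    have K_sub: "K \<subseteq> ?E - {r - d..r + d}" using T(2) e(2) d(2) unfolding cb by blast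
    have "ereal (level + \<delta> - ln 2) \<le> robin (cset K)"
    proof (rule robin_ge[OF closed_K K_subset])
      show "ennreal (level + \<delta>) \<le> mutual_energy m m" if "real_prob_on m K" for m
        by (rule \<delta>(2)[OF real_prob_on_mono[OF that K_sub]])
    qed (use level_pos \<delta> in simp)
    then show False using rob \<delta>(1) by simp
  qed
  define S where "S = map_poly complex_of_real (smult (1 / M) T)"
  have "degree S = n" using deg_T M_pos by (simp add: S_def degree_map_poly)
  moreover have "cset K = {z. (1 - z) * (poly S z)\<^sup>2 \<in> complex_of_real ` {0..1}}"
  proof (intro equalityI subsetI)
    have real: "(1 - complex_of_real x) * (poly S (complex_of_real x))\<^sup>2 = complex_of_real ((1 - poly R x) / 2)" for x
      unfolding S_def poly_map_poly_of_real poly_R using M_pos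
      by (simp add: power_mult_distrib power_divide)
    fix z
    {
      assume "z \<in> cset K"
      then obtain x where x: "x \<in> K" "z = complex_of_real x" by auto
      then have "(1 - poly R x) / 2 \<in> {0..1}" using T(2) by (auto simp: abs_le_iff)
      then show "z \<in> {z. (1 - z) * (poly S z)\<^sup>2 \<in> complex_of_real ` {0..1}}"
        unfolding mem_Collect_eq x(2) real by (rule imageI)
    next
      assume "z \<in> {z. (1 - z) * (poly S z)\<^sup>2 \<in> complex_of_real ` {0..1}}"
      then obtain t where t: "t \<in> {0..1}" "(1 - z) * (poly S z)\<^sup>2 = complex_of_real t" by auto
      \<comment> \<open>An identity known at real points, lifted to polynomials so that it can be
        evaluated at complex z.\<close>
      have eqR: "map_poly complex_of_real R = [:1:] - smult 2 ([:1, -1:] * S\<^sup>2)"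
      proof (rule poly_eq_on_infinite_reals[OF infinite_UNIV_char_0])
        fix x :: real
        have "poly ([:1:] - smult 2 ([:1, -1:] * S\<^sup>2)) (complex_of_real x) =
            1 - 2 * ((1 - complex_of_real x) * (poly S (complex_of_real x))\<^sup>2)"
          by (simp add: algebra_simps)
        also have "\<dots> = complex_of_real (poly R x)" unfolding real by (simp add: field_simps)
        finally show "poly (map_poly complex_of_real R) (complex_of_real x) =
            poly ([:1:] - smult 2 ([:1, -1:] * S\<^sup>2)) (complex_of_real x)"
          by (simp only: poly_map_poly_of_real)
      qed
      have "poly (map_poly complex_of_real R) z = complex_of_real (1 - 2 * t)"
      proof -
        have "poly ([:1:] - smult 2 ([:1, -1:] * S\<^sup>2)) z = 1 - 2 * ((1 - z) * (poly S z)\<^sup>2)"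
          by (simp add: algebra_simps)
        then show ?thesis unfolding eqR t(2) by simp
      qed
      then have "Im z = 0" by (rule preimage_real) (use t in auto)
      then obtain x where x: "z = complex_of_real x" by (metis complex_is_Real_iff Reals_cases)
      then have "complex_of_real ((1 - poly R x) / 2) = complex_of_real t" using t(2) real by simp
      then have "(1 - poly R x) / 2 = t" by (simp only: of_real_eq_iff)
      then have "\<bar>poly R x\<bar> \<le> 1" using t(1) by (simp add: abs_le_iff)
      then show "z \<in> cset K" using R_E x by blast
    }
  qed
  ultimately show ?thesis by blast
qed

text \<open>Put R = 1 - 2 (1 - z) S^2. It is real on the infinite set K, so its coefficients are
  real even if those of S are not, and all solutions of R z = y for y in [-1, 1] lie in K. The
  pullback of the arcsine law thus lives on K and bounds its capacity below, while S divided by its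
  leading coefficient is a monic competitor of weighted norm at most \<open>1 / s\<close>.\<close>

theorem preimage_imp_cheb_t_le:
  assumes S: "degree S = n" and KS: "cset K = {z. (1 - z) * (poly S z)\<^sup>2 \<in> complex_of_real ` {0..1}}"
  shows "cheb_t K w n \<le> 2 * sqrt (Cap (cset K)) * Cap (cset K) ^ n"
proof -
  define s where "s = cmod (lead_coeff S)"
  have S0: "S \<noteq> 0" using S n_pos by auto
  then have s: "0 < s" by (simp add: s_def)
  define Q where "Q = [:1, -1:] * S\<^sup>2"
  have pQ: "poly Q z = (1 - z) * (poly S z)\<^sup>2" for z by (simp add: Q_def algebra_simps)
  have dQ: "degree Q = 2 * n + 1" unfolding Q_def using S0 S by (simp add: degree_mult_eq degree_power_eq del: mult_pCons_left)
  have lQ: "cmod (lead_coeff Q) = s\<^sup>2"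
    unfolding Q_def by (simp add: lead_coeff_mult lead_coeff_power s_def norm_mult norm_power del: mult_pCons_left)
  define Rc where "Rc = [:1:] - smult 2 Q"
  have pRc: "poly Rc z = 1 - 2 * ((1 - z) * (poly S z)\<^sup>2)" for z by (simp add: Rc_def pQ)
  have dRc: "degree Rc = 2 * n + 1"
    unfolding Rc_def using dQ degree_add_eq_right[of "[:1:]" "- smult 2 Q"] by simp
  have "coeff Rc (2 * n + 1) = - (2 * lead_coeff Q)" unfolding dQ by (simp add: Rc_def)
  then have lRc: "cmod (lead_coeff Rc) = 2 * s\<^sup>2" unfolding dRc by (simp add: norm_mult lQ)
  have mem: "z \<in> cset K" if "poly Rc z = complex_of_real v" "v \<in> {-1..1}" for z v
  proof -
    have "(1 - z) * (poly S z)\<^sup>2 = complex_of_real ((1 - v) / 2)" using that(1) by (simp add: pRc algebra_simps)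
    moreover have "(1 - v) / 2 \<in> {0..1}" using that(2) by auto
    ultimately show ?thesis unfolding KS by (metis imageI mem_Collect_eq)
  qed
  define R where "R = map_poly Re Rc"
  have RcR: "map_poly complex_of_real R = Rc"
  proof (rule poly_eq_on_infinite_reals[OF infinite_K])
    fix x assume "x \<in> K"
    then have "complex_of_real x \<in> cset K" by simp
    then obtain t where "(1 - complex_of_real x) * (poly S (complex_of_real x))\<^sup>2 = complex_of_real t" unfolding KS by auto
    then have "poly Rc (complex_of_real x) = complex_of_real (1 - 2 * t)" by (simp add: pRc)
    then show "poly (map_poly complex_of_real R) (complex_of_real x) = poly Rc (complex_of_real x)"
      by (simp add: poly_map_poly_of_real R_def poly_map_poly_Re)
  qed
  have PR: "poly Rc (complex_of_real x) = complex_of_real (poly R x)" for x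
    by (simp add: RcR[symmetric] poly_map_poly_of_real)
  have dR: "degree R = 2 * n + 1" using dRc unfolding RcR[symmetric] by (simp add: degree_map_poly)
  have lR: "\<bar>lead_coeff R\<bar> = 2 * s\<^sup>2" using lRc unfolding RcR[symmetric] by (simp add: degree_map_poly coeff_map_poly)
  \<comment> \<open>At a value outside \<open>B\<close> every real solution is simple. As all
    complex solutions are real, the factorization into distinct roots shows that there are 2 n + 1
    of them.\<close>
  define B where "B = poly R ` {x. poly (pderiv R) x = 0}"
  have memK: "x \<in> K" if "\<bar>poly R x\<bar> \<le> 1" for x
    using mem[of "complex_of_real x" "poly R x"] PR that by (auto simp: abs_le_iff)
  interpret full_preimage R B
  proof
    show "0 < degree R" using dR by simp
    have "pderiv R \<noteq> 0" using dR by (simp add: pderiv_eq_0_iff)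
    then show "finite B" unfolding B_def by (intro finite_imageI poly_roots_finite)
    fix y assume y: "y \<in> {-1<..<1} - B"
    show "{x. poly R x = y} \<subseteq> {-1..1}" using memK y K_subset by (auto simp: abs_le_iff)
    define p where "p = Rc - [:complex_of_real y:]"
    have dp: "degree p = 2 * n + 1"
      using dRc degree_add_eq_left[of "- [:complex_of_real y:]" Rc] by (simp add: p_def del: minus_pCons)
    have roots: "{z. poly p z = 0} = complex_of_real ` {x. poly R x = y}"
    proof (intro equalityI subsetI)
      fix z assume "z \<in> {z. poly p z = 0}"
      then have z: "poly Rc z = complex_of_real y" by (simp add: p_def)
      then have "z \<in> cset K" using mem y by auto
      then obtain x where "z = complex_of_real x" by auto
      then show "z \<in> complex_of_real ` {x. poly R x = y}" using z PR by auto
    qed (use PR in \<open>auto simp: p_def\<close>)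
    have "rsquarefree p"
      unfolding rsquarefree_roots
    proof (intro allI notI, elim conjE)
      fix a assume a: "poly p a = 0" "poly (pderiv p) a = 0"
      then obtain x where x: "a = complex_of_real x" "poly R x = y" using roots by blast
      have "pderiv p = map_poly complex_of_real (pderiv R)"
        by (simp add: p_def RcR[symmetric] pderiv_diff pderiv_map_poly_of_real)
      then have "poly (pderiv R) x = 0" using a(2) x(1) by (simp add: poly_map_poly_of_real)
      then show False using x y by (auto simp: B_def)
    qed
    from complex_poly_decompose_rsquarefree[OF this]
    have "degree p = degree (\<Prod>z | poly p z = 0. [:-z, 1:])"
      using dp by (metis degree_smult_eq leading_coeff_0_iff degree_0 add_is_0 one_neq_zero)
    also have "\<dots> = card {z. poly p z = 0}" by (simp add: degree_prod_eq_sum_degree)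
    also have "\<dots> = card {x. poly R x = y}" unfolding roots by (intro card_image) (simp add: inj_on_def)
    finally show "card {x. poly R x = y} = degree R" using dp dR by simp
  qed
  have "real_prob_on pullback K"
    by (rule real_prob_on_mono[OF real_prob_on_pullback]) (use memK in auto)
  then have "robin (cset K) \<le> ereal (level - ln 2)"
    using closed_K K_subset level_pos mutual_energy_pullback[OF real_prob_on_pullback] by (intro robin_le) auto
  \<comment> \<open>Here \<open>1 / s\<close> plays the role of the Chebyshev norm: the leading
    coefficient of R has modulus \<open>2 * s\<^sup>2\<close>, where the alternant had
    \<open>2 / M\<^sup>2\<close>.\<close>
  then have "- ln (Cap (cset K)) \<le> ln (4 / (1 / s)\<^sup>2) / (2 * real n + 1)"
    unfolding robin_eq level_def lR by (simp add: dR field_simps)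
  then have "1 / s \<le> 2 * sqrt (Cap (cset K)) * Cap (cset K) ^ n"
    using level_le_iff[OF Cap_pos, of "1 / s" n] s by (auto simp: not_le dest!: less_imp_le)
  moreover have "cheb_t K w n \<le> weighted_norm w K (smult (1 / lead_coeff S) S)"
    using S S0 by (intro cheb_t_le) auto
  moreover have "weighted_norm w K (smult (1 / lead_coeff S) S) \<le> 1 / s"
  proof (rule weighted_norm_least)
    fix x assume x: "x \<in> K"
    then have "complex_of_real x \<in> cset K" by simp
    then obtain t where t: "t \<in> {0..1}" "(1 - complex_of_real x) * (poly S (complex_of_real x))\<^sup>2 = complex_of_real t"
      unfolding KS by auto
    have "cmod (1 - complex_of_real x) = 1 - x"
      using x K_subset by (subst of_real_1[symmetric], subst of_real_diff[symmetric], subst norm_of_real) auto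
    then have "(w x * cmod (poly S (complex_of_real x)))\<^sup>2 = cmod (complex_of_real t)"
      using x K_subset unfolding t(2)[symmetric] by (auto simp: norm_mult norm_power power_mult_distrib)
    also have "\<dots> \<le> 1\<^sup>2" using t(1) by simp
    finally have "w x * cmod (poly S (complex_of_real x)) \<le> 1" by (rule power2_le_imp_le) simp
    then show "w x * cmod (poly (smult (1 / lead_coeff S) S) (complex_of_real x)) \<le> 1 / s"
      using s by (simp add: s_def norm_mult norm_divide field_simps)
  qed
  ultimately show ?thesis by linarith
qed

end

section \<open>Existence of the equilibrium measure\<close>

text \<open>Off the diagonal the kernel is continuous. On the diagonal it is infinite, and nearby
  values exceed any v as soon as the distance is below \<open>2 * exp (- (v + 1))\<close>.\<close>

lemma log_kernel_lsc:
  assumes a: "a \<longlonglongrightarrow> x" and b: "b \<longlonglongrightarrow> y"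
  shows "log_kernel x y \<le> liminf (\<lambda>k. log_kernel (a k) (b k))"
proof (cases "x = y")
  case True
  show ?thesis
    unfolding le_Liminf_iff
  proof (intro allI impI)
    fix u assume "u < log_kernel x y"
    then obtain v where v: "u = ennreal v" "0 \<le> v" using True by (cases u) (auto simp: log_kernel_def)
    have "(\<lambda>k. \<bar>a k - b k\<bar>) \<longlonglongrightarrow> \<bar>x - y\<bar>" by (intro tendsto_intros a b)
    then have "eventually (\<lambda>k. \<bar>a k - b k\<bar> < 2 * exp (- (v + 1))) sequentially"
      using True by (intro order_tendstoD(2)[where a = "2 * exp (- (v + 1))"]) auto
    then show "eventually (\<lambda>k. u < log_kernel (a k) (b k)) sequentially"
    proof eventually_elim
      case (elim k)
      show ?case
      proof (cases "a k = b k")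
        case False
        have "exp (v + 1) * \<bar>a k - b k\<bar> < exp (v + 1) * (2 * exp (- (v + 1)))"
          using elim by (intro mult_strict_left_mono) auto
        also have "\<dots> = 2" by (simp only: exp_minus) simp
        finally have "exp (v + 1) < 2 / \<bar>a k - b k\<bar>" using False by (simp add: field_simps)
        then have "v + 1 < ln (2 / \<bar>a k - b k\<bar>)" using False by (metis exp_less_cancel_iff exp_ln zero_less_abs_iff zero_less_divide_iff zero_less_numeral right_minus_eq)
        then have "ennreal v < ennreal (ln (2 / \<bar>a k - b k\<bar>))" using v by (intro ennreal_lessI) auto
        then show ?thesis using False v by (simp add: log_kernel_def)
      qed (simp add: log_kernel_def v)
    qed
  qed
next
  case False
  have "(\<lambda>k. a k - b k) \<longlonglongrightarrow> x - y" by (intro tendsto_intros a b)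
  then have ev: "eventually (\<lambda>k. a k - b k \<noteq> 0) sequentially"
    using False by (intro tendsto_imp_eventually_ne) auto
  have "(\<lambda>k. ennreal (ln (2 / \<bar>a k - b k\<bar>))) \<longlonglongrightarrow> ennreal (ln (2 / \<bar>x - y\<bar>))"
    using False by (intro tendsto_intros a b) auto
  then have "(\<lambda>k. log_kernel (a k) (b k)) \<longlonglongrightarrow> log_kernel x y"
    using False by (subst tendsto_cong[where g = "\<lambda>k. ennreal (ln (2 / \<bar>a k - b k\<bar>))"])
      (use ev in \<open>auto simp: log_kernel_def elim!: eventually_mono\<close>)
  then show ?thesis by (simp add: lim_imp_Liminf)
qed

text \<open>The measures live on a bounded set, so a subsequence converges weakly. Skorohod's
  representation replaces it by random variables converging pointwise; semicontinuity of the kernel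
  and Fatou's lemma, applied in each variable, bound the limit energy. As K is closed, the limit
  stays on K.\<close>

lemma minimal_energy_measure_exists:
  assumes K: "closed K" "K \<subseteq> {-1..1}" and m: "\<And>k. real_prob_on (m k) K"
    and lim: "(\<lambda>k. c k) \<longlonglongrightarrow> L" and le: "\<And>k. mutual_energy (m k) (m k) \<le> c k"
  shows "\<exists>M. real_prob_on M K \<and> mutual_energy M M \<le> L"
proof -
  have rd: "real_distribution (m k)" for k
  proof -
    interpret prob_space "m k" using m by (rule real_prob_on_prob_space)
    show ?thesis
      by unfold_locales (use real_prob_on_sets[OF m] in \<open>auto dest: sets_eq_imp_space_eq\<close>)
  qed
  have "measure (m k) {-2<..1} = 1" for k
  proof -
    interpret prob_space "m k" using m by (rule real_prob_on_prob_space)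
    have "AE x in m k. x \<in> {-2<..1}" using real_prob_on_AE[OF m] by eventually_elim (use K in auto)
    then show ?thesis using real_prob_on_sets[OF m] by (subst (asm) AE_in_set_eq_1) auto
  qed
  then have "-2 < (1::real) \<and> (\<forall>k. 1 - \<epsilon> < measure (m k) {-2<..1})" if "0 < \<epsilon>" for \<epsilon>
    using that by simp
  then have "tight m" unfolding tight_def using rd by blast
  then obtain r M where r: "strict_mono (r :: nat \<Rightarrow> nat)" and M: "real_distribution M" and wc: "weak_conv_m (m \<circ> id \<circ> r) M"
    using tight_imp_convergent_subsubsequence[of m id] strict_mono_id by blast
  have rd': "\<And>k. real_distribution ((m \<circ> id \<circ> r) k)" using rd by simp
  obtain \<Omega> :: "real measure" and Y Z where \<Omega>: "prob_space \<Omega>" "\<And>k. Y k \<in> borel_measurable \<Omega>"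
      "\<And>k. distr \<Omega> borel (Y k) = m (r k)" "Z \<in> borel_measurable \<Omega>" "distr \<Omega> borel Z = M"
      "\<And>x. x \<in> space \<Omega> \<Longrightarrow> (\<lambda>k. Y k x) \<longlonglongrightarrow> Z x"
  proof -
    from Skorohod[OF rd' M wc] obtain \<Omega> :: "real measure" and Y Z where "prob_space \<Omega> \<and>
      (\<forall>k. Y k \<in> borel_measurable \<Omega>) \<and> (\<forall>k. distr \<Omega> borel (Y k) = (m \<circ> id \<circ> r) k) \<and>
      Z \<in> \<Omega> \<rightarrow>\<^sub>M lborel \<and> distr \<Omega> borel Z = M \<and> (\<forall>x \<in> space \<Omega>. (\<lambda>k. Y k x) \<longlonglongrightarrow> Z x)"
      by blast
    then show thesis by (intro that[of \<Omega> Y Z]) auto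
  qed
  interpret \<Omega>: prob_space \<Omega> by fact
  note [measurable] = \<Omega>(2,4)
  have energy: "mutual_energy (distr \<Omega> borel f) (distr \<Omega> borel f) = (\<integral>\<^sup>+s. \<integral>\<^sup>+t. log_kernel (f s) (f t) \<partial>\<Omega> \<partial>\<Omega>)"
    if [measurable]: "f \<in> borel_measurable \<Omega>" for f
  proof -
    interpret D: prob_space "distr \<Omega> borel f" by (rule \<Omega>.prob_space_distr) fact
    show ?thesis unfolding mutual_energy_def
      by (subst nn_integral_distr, measurable, subst nn_integral_distr) auto
  qed
  have "mutual_energy M M = (\<integral>\<^sup>+s. \<integral>\<^sup>+t. log_kernel (Z s) (Z t) \<partial>\<Omega> \<partial>\<Omega>)"
    using energy[OF \<Omega>(4)] \<Omega>(5) by simp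
  also have "\<dots> \<le> (\<integral>\<^sup>+s. \<integral>\<^sup>+t. liminf (\<lambda>k. log_kernel (Y k s) (Y k t)) \<partial>\<Omega> \<partial>\<Omega>)"
    by (intro nn_integral_mono log_kernel_lsc \<Omega>(6))
  also have "\<dots> \<le> (\<integral>\<^sup>+s. liminf (\<lambda>k. \<integral>\<^sup>+t. log_kernel (Y k s) (Y k t) \<partial>\<Omega>) \<partial>\<Omega>)"
    by (intro nn_integral_mono nn_integral_liminf) measurable
  also have "\<dots> \<le> liminf (\<lambda>k. \<integral>\<^sup>+s. \<integral>\<^sup>+t. log_kernel (Y k s) (Y k t) \<partial>\<Omega> \<partial>\<Omega>)"
    by (intro nn_integral_liminf) measurable
  also have "\<dots> = liminf (\<lambda>k. mutual_energy (m (r k)) (m (r k)))"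
    using energy[OF \<Omega>(2)] \<Omega>(3) by simp
  also have "\<dots> \<le> liminf (\<lambda>k. c (r k))"
    by (intro Liminf_mono always_eventually allI le)
  also have "\<dots> = L"
    using LIMSEQ_subseq_LIMSEQ[OF lim r] by (intro lim_imp_Liminf) (auto simp: o_def)
  finally have "mutual_energy M M \<le> L" .
  moreover have "real_prob_on M K"
  proof -
    have "AE s in \<Omega>. Y k s \<in> K" for k
      using real_prob_on_AE[OF m[of "r k"]] K(1) unfolding \<Omega>(3)[symmetric] by (subst (asm) AE_distr_iff) auto
    then have "AE s in \<Omega>. \<forall>k. Y k s \<in> K" by (simp add: AE_all_countable)
    then have "AE s in \<Omega>. Z s \<in> K"
      using AE_space
    proof eventually_elim
      case (elim s)
      show ?case using closed_sequentially[OF K(1), of "\<lambda>k. Y k s" "Z s"] elim \<Omega>(6) by simp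
    qed
    then have "AE x in M. x \<in> K" using K(1) unfolding \<Omega>(5)[symmetric] by (subst AE_distr_iff) auto
    moreover have "prob_space M" using M by (simp add: real_distribution_def)
    moreover have "sets M = sets borel" unfolding \<Omega>(5)[symmetric] by simp
    ultimately show ?thesis by (simp add: real_prob_on_def)
  qed
  ultimately show ?thesis by blast
qed

text \<open>The equilibrium measure is defined by choice, and the chosen object is known to be a
  measure on K only once some minimizer exists.\<close>

theorem prob_on_equilibrium_measure:
  assumes K: "closed K" "K \<subseteq> {-1..1}" and cap: "0 < Cap (cset K)"
  shows "prob_on (equilibrium_measure (cset K)) (cset K)"
proof -
  define r where "r = - ln (Cap (cset K))"
  have rob: "robin (cset K) = ereal r" unfolding r_def using assms by (intro robin_eq_ln_Cap)
  have "\<exists>\<mu>. prob_on \<mu> (cset K) \<and> log_energy \<mu> < ereal (r + 1 / Suc k)" for k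
  proof -
    have "robin (cset K) < ereal (r + 1 / Suc k)" unfolding rob by simp
    then show ?thesis unfolding robin_def by (auto simp: INF_less_iff)
  qed
  then obtain \<mu> where \<mu>: "\<And>k. prob_on (\<mu> k) (cset K)" "\<And>k. log_energy (\<mu> k) < ereal (r + 1 / Suc k)" by metis
  have im: "interval_measure (\<mu> k) K" for k using \<mu>(1) K by unfold_locales
  define c where "c k = ennreal (r + ln 2 + 1 / Suc k)" for k
  have lt: "mutual_energy (real_marginal (\<mu> k)) (real_marginal (\<mu> k)) \<le> c k" for k
  proof (cases "mutual_energy (real_marginal (\<mu> k)) (real_marginal (\<mu> k))")
    case (real q)
    then have "ereal q - ereal (ln 2) < ereal (r + 1 / Suc k)"
      using \<mu>(2)[of k] unfolding interval_measure.log_energy_eq[OF im] by (simp add: enn2ereal_ennreal)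
    then have "q \<le> r + ln 2 + 1 / Suc k" by simp
    then show ?thesis using real by (simp add: c_def ennreal_leI)
  next
    case top
    then show ?thesis
      using \<mu>(2)[of k] unfolding interval_measure.log_energy_eq[OF im] by simp
  qed
  have "c \<longlonglongrightarrow> ennreal (r + ln 2 + 0)"
    unfolding c_def using LIMSEQ_Suc[OF lim_1_over_n[where 'a = real]]
    by (intro tendsto_ennrealI tendsto_add tendsto_const) simp
  then obtain M where M: "real_prob_on M K" "mutual_energy M M \<le> ennreal (r + ln 2)"
    using minimal_energy_measure_exists[where c = c, OF K interval_measure.real_prob_on_m[OF im] _ lt] by auto
  have nn: "0 \<le> r + ln 2"
  proof -
    have "ereal (0 - ln 2) \<le> robin (cset K)" by (rule robin_ge) (use K in auto)
    then show ?thesis unfolding rob by simp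
  qed
  note P = prob_on_distr_of_real[OF M(1) K]
  have "enn2ereal (mutual_energy M M) \<le> ereal (r + ln 2)"
    using M(2) nn by (simp add: less_eq_ennreal.rep_eq enn2ereal_ennreal)
  then have "enn2ereal (mutual_energy M M) - ereal (ln 2) \<le> ereal (r + ln 2) - ereal (ln 2)"
    by (intro ereal_minus_mono) auto
  then have "log_energy (distr M borel complex_of_real) \<le> robin (cset K)"
    unfolding P(2) rob by simp
  moreover have "robin (cset K) \<le> log_energy (distr M borel complex_of_real)"
    unfolding robin_def by (rule INF_lower) (use P in auto)
  ultimately have "\<exists>\<mu>. prob_on \<mu> (cset K) \<and> log_energy \<mu> = robin (cset K)" using P(1) by auto
  then show ?thesis unfolding equilibrium_measure_def by (rule someI2_ex) auto
qed

section \<open>The Green function in the gaps\<close>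

locale equilibrium_potential =
  fixes K :: "real set" and m :: "real measure" and \<Gamma> :: real
  assumes compact_K: "compact K" and K_sub: "K \<subseteq> {-1..1}" and m: "real_prob_on m K" and \<Gamma>: "0 \<le> \<Gamma>"
    and pot_K: "\<And>x. x \<in> K \<Longrightarrow> (\<integral>\<^sup>+t. log_kernel x t \<partial>m) = ennreal \<Gamma>"
begin

sublocale prob_space m
  using m by (rule real_prob_on_prob_space)

lemma sets_m [simp, measurable_cong]: "sets m = sets borel"
  using m by (rule real_prob_on_sets)

lemma space_m [simp]: "space m = UNIV"
  using sets_eq_imp_space_eq[OF sets_m] by simp

lemma AE_K: "AE t in m. t \<in> K"
  using m by (rule real_prob_on_AE)

lemma dist_le_2: "x \<in> {-1..1} \<Longrightarrow> t \<in> K \<Longrightarrow> \<bar>x - t\<bar> \<le> 2"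
  using K_sub by (auto simp: abs_le_iff dest!: subsetD)

lemma separated:
  assumes "x \<notin> K"
  shows "\<exists>\<delta>>0. \<forall>t\<in>K. \<delta> \<le> \<bar>x - t\<bar>"
proof -
  obtain e where "0 < e" "ball x e \<subseteq> - K"
    using open_contains_ball[of "- K"] compact_imp_closed[OF compact_K] assms by (metis ComplI open_Compl)
  then show ?thesis by (intro exI[of _ e]) (auto simp: dist_real_def subset_eq not_less[symmetric])
qed

lemma potential_finite:
  assumes "x \<in> {-1..1}"
  shows "(\<integral>\<^sup>+t. log_kernel x t \<partial>m) < \<top>"
proof (cases "x \<in> K")
  case True
  then show ?thesis using pot_K by simp
next
  case False
  then obtain \<delta> where \<delta>: "0 < \<delta>" "\<And>t. t \<in> K \<Longrightarrow> \<delta> \<le> \<bar>x - t\<bar>" using separated by blast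
  have "(\<integral>\<^sup>+t. log_kernel x t \<partial>m) \<le> (\<integral>\<^sup>+t. ennreal (ln (2 / \<delta>)) \<partial>m)"
  proof (rule nn_integral_mono_AE)
    show "AE t in m. log_kernel x t \<le> ennreal (ln (2 / \<delta>))"
      using AE_K
    proof eventually_elim
      case (elim t)
      then show ?case using \<delta>(2)[OF elim] \<delta>(1) False
        by (auto simp: log_kernel_def intro!: ennreal_leI ln_mono divide_left_mono mult_pos_pos)
    qed
  qed
  then show ?thesis using emeasure_space_1 by (simp add: le_less_trans)
qed

lemma no_atom: "x \<in> {-1..1} \<Longrightarrow> AE t in m. t \<noteq> x"
proof (rule AE_I')
  assume "x \<in> {-1..1}"
  then have "emeasure m {x} = 0"
    using potential_at_atom[OF sets_m, of x] potential_finite[of x] by (metis infinity_ennreal_def less_irrefl)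
  then show "{x} \<in> null_sets m" by (simp add: null_sets_def)
qed auto

text \<open>The Green function of K on [-1, 1], written with a real integral so that it can be
  differentiated off K.\<close>

definition g :: "real \<Rightarrow> real" where
  "g x = \<Gamma> - (\<integral>t. ln (2 / \<bar>x - t\<bar>) \<partial>m)"

lemma integral_eq_potential:
  assumes "x \<in> {-1..1}"
  shows "(\<integral>t. ln (2 / \<bar>x - t\<bar>) \<partial>m) = enn2real (\<integral>\<^sup>+t. log_kernel x t \<partial>m)"
proof -
  have "(\<integral>t. ln (2 / \<bar>x - t\<bar>) \<partial>m) = enn2real (\<integral>\<^sup>+t. ennreal (ln (2 / \<bar>x - t\<bar>)) \<partial>m)"
  proof (rule integral_eq_nn_integral)
    show "AE t in m. 0 \<le> ln (2 / \<bar>x - t\<bar>)"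
      using AE_K no_atom[OF assms]
    proof eventually_elim
      case (elim t)
      then show ?case using dist_le_2[OF assms, of t] by (intro ln_ge_zero) (auto simp: field_simps)
    qed
  qed measurable
  also have "(\<integral>\<^sup>+t. ennreal (ln (2 / \<bar>x - t\<bar>)) \<partial>m) = (\<integral>\<^sup>+t. log_kernel x t \<partial>m)"
    by (rule nn_integral_cong_AE) (use no_atom[OF assms] in \<open>eventually_elim, simp add: log_kernel_def\<close>)
  finally show ?thesis .
qed

lemma g_plus_potential:
  assumes "x \<in> {-1..1}"
  shows "g x = \<Gamma> - enn2real (\<integral>\<^sup>+t. log_kernel x t \<partial>m)"
  by (simp add: g_def integral_eq_potential[OF assms])

lemma g_K: "x \<in> K \<Longrightarrow> g x = 0"
  using K_sub \<Gamma> by (subst g_plus_potential) (auto simp: pot_K)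

section \<open>Derivative and concavity of the Green function\<close>

definition D :: "real \<Rightarrow> real" where
  "D x = (\<integral>t. 1 / (x - t) \<partial>m)"

lemma integrable_D:
  assumes "x \<notin> K"
  shows "integrable m (\<lambda>t. 1 / (x - t))"
proof -
  obtain \<delta> where \<delta>: "0 < \<delta>" "\<And>t. t \<in> K \<Longrightarrow> \<delta> \<le> \<bar>x - t\<bar>" using separated[OF assms] by blast
  show ?thesis
  proof (rule integrable_const_bound[where B = "1 / \<delta>"])
    show "AE t in m. norm (1 / (x - t)) \<le> 1 / \<delta>"
      using AE_K
    proof eventually_elim
      case (elim t)
      have "1 / \<bar>x - t\<bar> \<le> 1 / \<delta>"
        using \<delta>(1) \<delta>(2)[OF elim] by (intro divide_left_mono mult_pos_pos) auto
      then show ?case by simp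
    qed
  qed measurable
qed

lemma integrable_ln:
  assumes "x \<notin> K"
  shows "integrable m (\<lambda>t. ln (2 / \<bar>x - t\<bar>))"
proof -
  obtain \<delta> where \<delta>: "0 < \<delta>" "\<And>t. t \<in> K \<Longrightarrow> \<delta> \<le> \<bar>x - t\<bar>" using separated[OF assms] by blast
  show ?thesis
  proof (rule integrable_const_bound[where B = "\<bar>ln (2 / \<delta>)\<bar> + \<bar>ln (2 / (\<bar>x\<bar> + 1))\<bar>"])
    show "AE t in m. norm (ln (2 / \<bar>x - t\<bar>)) \<le> \<bar>ln (2 / \<delta>)\<bar> + \<bar>ln (2 / (\<bar>x\<bar> + 1))\<bar>"
      using AE_K
    proof eventually_elim
      case (elim t)
      have t: "\<delta> \<le> \<bar>x - t\<bar>" "\<bar>x - t\<bar> \<le> \<bar>x\<bar> + 1"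
        using \<delta>(2)[OF elim] elim K_sub by (auto simp: abs_le_iff abs_if dest!: subsetD)
      then have "ln (2 / \<bar>x - t\<bar>) \<le> ln (2 / \<delta>)" "ln (2 / (\<bar>x\<bar> + 1)) \<le> ln (2 / \<bar>x - t\<bar>)"
        using \<delta>(1) by (auto intro!: ln_mono divide_left_mono mult_pos_pos)
      then show ?case unfolding real_norm_def by linarith
    qed
  qed measurable
qed

text \<open>With u = h / (x - t) the error of the linear approximation under the integral is ln (1 +
  u) - u, at most 2 u^2. As K keeps a distance \<delta> from x, this is uniform in t for h up to
  \<delta> / 2.\<close>

lemma has_derivative_g:
  assumes "x \<notin> K"
  shows "(g has_real_derivative D x) (at x)"
proof -
  obtain \<delta> where \<delta>: "0 < \<delta>" "\<And>t. t \<in> K \<Longrightarrow> \<delta> \<le> \<bar>x - t\<bar>" using separated[OF assms] by blast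
  have bound: "\<bar>(g (x + h) - g x) / h - D x\<bar> \<le> 2 / \<delta>\<^sup>2 * \<bar>h\<bar>" if h: "h \<noteq> 0" "\<bar>h\<bar> \<le> \<delta> / 2" for h
  proof -
    have far: "\<delta> / 2 \<le> \<bar>x + h - t\<bar>" if "t \<in> K" for t using \<delta>(2)[OF that] h by linarith
    then have xh: "x + h \<notin> K" using \<delta>(1) by force
    let ?f = "\<lambda>t. ln (2 / \<bar>x - t\<bar>) - ln (2 / \<bar>x + h - t\<bar>) - h * (1 / (x - t))"
    have int: "integrable m ?f"
      by (intro Bochner_Integration.integrable_diff integrable_ln integrable_mult_right integrable_D assms xh)
    have eq: "g (x + h) - g x - h * D x = (\<integral>t. ?f t \<partial>m)"
    proof -
      have "(\<integral>t. ?f t \<partial>m) = (\<integral>t. ln (2 / \<bar>x - t\<bar>) \<partial>m) - (\<integral>t. ln (2 / \<bar>x + h - t\<bar>) \<partial>m) - (\<integral>t. h * (1 / (x - t)) \<partial>m)"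
        using integrable_ln[OF assms] integrable_ln[OF xh] integrable_D[OF assms]
        by (subst Bochner_Integration.integral_diff) (auto intro!: integrable_mult_right simp del: times_divide_eq_right)
      also have "(\<integral>t. h * (1 / (x - t)) \<partial>m) = h * D x" unfolding D_def by (rule integral_mult_right_zero)
      finally show ?thesis by (simp add: g_def)
    qed
    have pt: "\<bar>?f t\<bar> \<le> 2 * h\<^sup>2 / \<delta>\<^sup>2" if t: "t \<in> K" for t
    proof -
      define u where "u = h / (x - t)"
      have xt: "\<delta> \<le> \<bar>x - t\<bar>" "x - t \<noteq> 0" using \<delta>(2)[OF t] \<delta>(1) by auto
      have u: "\<bar>u\<bar> \<le> \<bar>h\<bar> / \<delta>" unfolding u_def abs_divide using xt \<delta>(1) by (intro divide_left_mono) auto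
      also have hd: "\<bar>h\<bar> / \<delta> \<le> 1 / 2" using h(2) \<delta>(1) by (simp add: field_simps)
      finally have u2: "\<bar>u\<bar> \<le> 1 / 2" .
      then have pos: "0 < 1 + u" by linarith
      have fac: "x + h - t = (x - t) * (1 + u)" using xt by (simp add: u_def field_simps)
      have "ln (2 / \<bar>x - t\<bar>) - ln (2 / \<bar>x + h - t\<bar>) = ln (1 + u)"
        unfolding fac abs_mult using xt pos by (simp add: ln_div ln_mult)
      then have "?f t = ln (1 + u) - u" by (simp add: u_def)
      also have "\<bar>ln (1 + u) - u\<bar> \<le> 2 * u\<^sup>2" by (rule abs_ln_one_plus_x_minus_x_bound[OF u2])
      also have "u\<^sup>2 \<le> (\<bar>h\<bar> / \<delta>)\<^sup>2" using u by (metis abs_ge_zero power2_abs power_mono)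
      finally show ?thesis by (simp add: power_divide)
    qed
    have "\<bar>\<integral>t. ?f t \<partial>m\<bar> \<le> (\<integral>t. \<bar>?f t\<bar> \<partial>m)" by (rule integral_abs_bound)
    also have "\<dots> \<le> (\<integral>t. 2 * h\<^sup>2 / \<delta>\<^sup>2 \<partial>m)"
    proof (rule integral_mono_AE)
      show "AE t in m. \<bar>?f t\<bar> \<le> 2 * h\<^sup>2 / \<delta>\<^sup>2" using AE_K by eventually_elim (rule pt)
    qed (use int in auto)
    also have "\<dots> = 2 * h\<^sup>2 / \<delta>\<^sup>2" using prob_space by simp
    finally have B: "\<bar>g (x + h) - g x - h * D x\<bar> \<le> 2 * h\<^sup>2 / \<delta>\<^sup>2" unfolding eq .
    have E: "\<bar>(g (x + h) - g x) / h - D x\<bar> = \<bar>g (x + h) - g x - h * D x\<bar> / \<bar>h\<bar>"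
      using h by (simp add: field_simps flip: abs_divide)
    have "\<bar>(g (x + h) - g x) / h - D x\<bar> \<le> (2 * h\<^sup>2 / \<delta>\<^sup>2) / \<bar>h\<bar>"
      unfolding E by (rule divide_right_mono[OF B]) simp
    also have "\<dots> = 2 / \<delta>\<^sup>2 * \<bar>h\<bar>" using h by (simp add: field_simps power2_eq_square)
    finally show ?thesis .
  qed
  have "((\<lambda>h. (g (x + h) - g x) / h - D x) \<longlongrightarrow> 0) (at 0)"
  proof (rule Lim_null_comparison)
    show "\<forall>\<^sub>F h in at 0. norm ((g (x + h) - g x) / h - D x) \<le> 2 / \<delta>\<^sup>2 * \<bar>h\<bar>"
      unfolding eventually_at using bound \<delta>(1) by (intro exI[of _ "\<delta> / 2"]) (auto simp: dist_real_def)
    show "((\<lambda>h. 2 / \<delta>\<^sup>2 * \<bar>h\<bar>) \<longlongrightarrow> 0) (at 0)"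
      using \<delta>(1) by (auto intro!: tendsto_eq_intros)
  qed
  then show ?thesis unfolding DERIV_def by (simp add: LIM_zero_iff)
qed

text \<open>Dominated convergence at a point of K. By \<open>far\<close>, the kernel at the
  approximating points is at most the kernel at the limit or at most
  \<open>ln (2 / \<delta>)\<close>, so the sum of both dominates; it is integrable because the
  potential is finite on K.\<close>

lemma g_sequentially:
  assumes x0: "x0 \<in> K" and x: "x \<longlonglongrightarrow> x0" "\<And>k. x k \<in> {-1..1}" and \<delta>: "0 < \<delta>"
    and far: "\<And>k t. t \<in> K \<Longrightarrow> \<bar>x0 - t\<bar> \<le> \<bar>x k - t\<bar> \<or> \<delta> \<le> \<bar>x k - t\<bar>"
  shows "(\<lambda>k. g (x k)) \<longlonglongrightarrow> g x0"
proof -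
  have x01: "x0 \<in> {-1..1}" using x0 K_sub by auto
  have bd: "log_kernel (x k) t \<le> log_kernel x0 t + ennreal (ln (2 / \<delta>))" if "t \<in> K" for k t
  proof (cases "x0 = t")
    case False
    then have *: "log_kernel (x k) t \<le> log_kernel x0 t \<or> log_kernel (x k) t \<le> ennreal (ln (2 / \<delta>))"
      using far[OF that, of k] \<delta>
      by (auto simp: log_kernel_def intro!: ennreal_leI ln_mono divide_left_mono mult_pos_pos)
    then show ?thesis by (auto intro: add_increasing add_increasing2)
  qed (simp add: log_kernel_def)
  have "(\<lambda>k. \<integral>\<^sup>+t. log_kernel (x k) t \<partial>m) \<longlonglongrightarrow> (\<integral>\<^sup>+t. log_kernel x0 t \<partial>m)"
  proof (rule nn_integral_dominated_convergence[where w = "\<lambda>t. log_kernel x0 t + ennreal (ln (2 / \<delta>))"])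
    show "AE t in m. log_kernel (x k) t \<le> log_kernel x0 t + ennreal (ln (2 / \<delta>))" for k
      using AE_K by eventually_elim (rule bd)
    show "(\<integral>\<^sup>+t. log_kernel x0 t + ennreal (ln (2 / \<delta>)) \<partial>m) < \<infinity>"
      using potential_finite[OF x01] emeasure_space_1 by (subst nn_integral_add) auto
    show "AE t in m. (\<lambda>k. log_kernel (x k) t) \<longlonglongrightarrow> log_kernel x0 t"
      using no_atom[OF x01]
    proof eventually_elim
      case (elim t)
      have ev: "\<forall>\<^sub>F k in sequentially. x k \<noteq> t" using x(1) elim by (intro tendsto_imp_eventually_ne) auto
      have "(\<lambda>k. ennreal (ln (2 / \<bar>x k - t\<bar>))) \<longlonglongrightarrow> ennreal (ln (2 / \<bar>x0 - t\<bar>))"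
        using elim by (intro tendsto_intros x) auto
      then show ?case
        using elim by (subst tendsto_cong[where g = "\<lambda>k. ennreal (ln (2 / \<bar>x k - t\<bar>))"])
          (use ev in \<open>auto simp: log_kernel_def elim!: eventually_mono\<close>)
    qed
  qed auto
  then have "(\<lambda>k. enn2real (\<integral>\<^sup>+t. log_kernel (x k) t \<partial>m)) \<longlonglongrightarrow> enn2real (\<integral>\<^sup>+t. log_kernel x0 t \<partial>m)"
    using potential_finite[OF x01] by (intro tendsto_enn2real) (auto simp: less_top)
  then show ?thesis
    unfolding g_plus_potential[OF x(2)] g_plus_potential[OF x01] by (intro tendsto_diff tendsto_const)
qed

lemma continuous_on_g:
  assumes S: "S \<subseteq> {-1..1}" "x0 \<in> S \<inter> K" "S \<inter> K \<subseteq> {x0}" and \<delta>: "0 < \<delta>"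
    and far: "\<And>x t. x \<in> S \<Longrightarrow> t \<in> K \<Longrightarrow> \<bar>x0 - t\<bar> \<le> \<bar>x - t\<bar> \<or> \<delta> \<le> \<bar>x - t\<bar>"
  shows "continuous_on S g"
  unfolding continuous_on_eq_continuous_within
proof
  fix y assume y: "y \<in> S"
  show "continuous (at y within S) g"
  proof (cases "y \<in> K")
    case False
    then show ?thesis using DERIV_isCont[OF has_derivative_g] continuous_at_imp_continuous_at_within by blast
  next
    case True
    then have [simp]: "y = x0" using S y by auto
    show ?thesis
      unfolding continuous_within_sequentially o_def \<open>y = x0\<close>
      using g_sequentially[of x0 _ \<delta>] S \<delta> far by (meson IntD2 subsetD)
  qed
qed

text \<open>Strict concavity of g between points of K: every t in K lies outside [x, y], so (x - t)
  (y - t) is positive, and it is at most 4. Hence the integrands differ by at least (y - x) /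
  4.\<close>

lemma D_strict_decreasing:
  assumes xy: "x < y" "x \<in> {-1..1}" "y \<in> {-1..1}" and free: "{x..y} \<inter> K = {}"
  shows "D y < D x"
proof -
  have nK: "x \<notin> K" "y \<notin> K" using xy IntI[of x "{x..y}" K] IntI[of y "{x..y}" K] free by auto
  have "(y - x) / 4 = (\<integral>t. (y - x) / 4 \<partial>m)" using prob_space by simp
  also have "\<dots> \<le> (\<integral>t. 1 / (x - t) - 1 / (y - t) \<partial>m)"
  proof (rule integral_mono_AE)
    show "AE t in m. (y - x) / 4 \<le> 1 / (x - t) - 1 / (y - t)"
      using AE_K
    proof eventually_elim
      case (elim t)
      then have "t < x \<or> y < t" using IntI[of t "{x..y}" K] free by fastforce
      then have pos: "0 < (x - t) * (y - t)" using xy by (auto intro: mult_pos_pos mult_neg_neg)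
      have "\<bar>(x - t) * (y - t)\<bar> \<le> 2 * 2"
        unfolding abs_mult using xy dist_le_2[OF _ elim] by (intro mult_mono) auto
      then have "(y - x) / 4 \<le> (y - x) / ((x - t) * (y - t))"
        using pos xy by (intro divide_left_mono) auto
      also have "\<dots> = 1 / (x - t) - 1 / (y - t)"
      proof -
        have "x - t \<noteq> 0" "y - t \<noteq> 0" using pos by auto
        then show ?thesis by (simp add: diff_frac_eq)
      qed
      finally show ?case .
    qed
  qed (use integrable_D nK in auto)
  also have "\<dots> = D x - D y" unfolding D_def using integrable_D nK by simp
  finally show ?thesis using xy by simp
qed

text \<open>g is continuous on the closed gap and vanishes at both ends, so Rolle's theorem yields a
  critical point. Strict decrease of the derivative makes it unique and g strictly monotone on
  either side of it.\<close>

lemma gap_maximum: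
  assumes gap: "\<alpha> \<in> K" "\<beta> \<in> K" "\<alpha> < \<beta>" "{\<alpha><..<\<beta>} \<inter> K = {}"
  obtains c where "c \<in> {\<alpha><..<\<beta>}" "(g has_real_derivative 0) (at c)" "0 < g c"
    "\<And>x. x \<in> {\<alpha><..<\<beta>} \<Longrightarrow> 0 \<le> g x" "\<And>x. x \<in> {\<alpha><..<\<beta>} \<Longrightarrow> x \<noteq> c \<Longrightarrow> g x < g c"
    "\<And>x. x \<in> {\<alpha><..<\<beta>} \<Longrightarrow> (g has_real_derivative 0) (at x) \<Longrightarrow> x = c"
proof -
  have ab: "\<alpha> \<in> {-1..1}" "\<beta> \<in> {-1..1}" using gap K_sub by auto
  have free: "x \<notin> K" if "x \<in> {\<alpha><..<\<beta>}" for x using gap(4) that by blast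
  have out: "t \<le> \<alpha> \<or> \<beta> \<le> t" if "t \<in> K" for t
    using IntI[of t "{\<alpha><..<\<beta>}" K] gap(4) that by fastforce
  define \<mu> where "\<mu> = (\<alpha> + \<beta>) / 2"
  have \<mu>: "\<alpha> < \<mu>" "\<mu> < \<beta>" using gap(3) by (auto simp: \<mu>_def)
  \<comment> \<open>The domination condition is one-sided, hence the split at the midpoint: from the
    left half, points of K left of the gap are at least as far as from \<alpha>, those on the right
    are at distance at least \<beta> - \<mu>.\<close>
  have "continuous_on {\<alpha>..\<mu>} g"
  proof (rule continuous_on_g[of _ \<alpha> "\<beta> - \<mu>"])
    show "\<bar>\<alpha> - t\<bar> \<le> \<bar>x - t\<bar> \<or> \<beta> - \<mu> \<le> \<bar>x - t\<bar>" if "x \<in> {\<alpha>..\<mu>}" "t \<in> K" for x t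
      using out[OF that(2)] that(1) by auto
    show "{\<alpha>..\<mu>} \<inter> K \<subseteq> {\<alpha>}" using out \<mu> by fastforce
  qed (use ab \<mu> gap in auto)
  moreover have "continuous_on {\<mu>..\<beta>} g"
  proof (rule continuous_on_g[of _ \<beta> "\<mu> - \<alpha>"])
    show "\<bar>\<beta> - t\<bar> \<le> \<bar>x - t\<bar> \<or> \<mu> - \<alpha> \<le> \<bar>x - t\<bar>" if "x \<in> {\<mu>..\<beta>}" "t \<in> K" for x t
      using out[OF that(2)] that(1) by auto
    show "{\<mu>..\<beta>} \<inter> K \<subseteq> {\<beta>}" using out \<mu> by fastforce
  qed (use ab \<mu> gap in auto)
  ultimately have "continuous_on ({\<alpha>..\<mu>} \<union> {\<mu>..\<beta>}) g" by (intro continuous_on_closed_Un) auto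
  moreover have "{\<alpha>..\<mu>} \<union> {\<mu>..\<beta>} = {\<alpha>..\<beta>}" using \<mu> by auto
  ultimately have cont: "continuous_on {\<alpha>..\<beta>} g" by simp
  have der: "(g has_real_derivative D x) (at x)" if "x \<in> {\<alpha><..<\<beta>}" for x
    using has_derivative_g free that by blast
  have dec: "D y < D x" if "x \<in> {\<alpha><..<\<beta>}" "y \<in> {\<alpha><..<\<beta>}" "x < y" for x y
    using that ab free by (intro D_strict_decreasing) auto
  obtain c where c: "\<alpha> < c" "c < \<beta>" "(g has_real_derivative 0) (at c)"
  proof -
    have "\<exists>z. \<alpha> < z \<and> z < \<beta> \<and> DERIV g z :> 0"
    proof (rule Rolle[OF gap(3) _ cont])
      show "g \<alpha> = g \<beta>" using g_K gap by simp
      show "g differentiable (at x)" if "\<alpha> < x" "x < \<beta>" for x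
        using der[of x] that by (auto simp: real_differentiable_def)
    qed
    then show thesis using that by blast
  qed
  have Dc: "D c = 0" using DERIV_unique[OF der[of c] c(3)] c by auto
  have inc: "g x < g y" if "\<alpha> \<le> x" "x < y" "y \<le> c" for x y
  proof (rule DERIV_pos_imp_increasing_open[OF that(2)])
    show "\<exists>d. DERIV g z :> d \<and> 0 < d" if "x < z" "z < y" for z
      using der[of z] dec[of z c] that \<open>\<alpha> \<le> x\<close> \<open>y \<le> c\<close> c Dc by (intro exI[of _ "D z"]) auto
    show "continuous_on {x..y} g" using that c by (intro continuous_on_subset[OF cont]) auto
  qed
  have decr: "g y < g x" if "c \<le> x" "x < y" "y \<le> \<beta>" for x y
  proof (rule DERIV_neg_imp_decreasing_open[OF that(2)])
    show "\<exists>d. DERIV g z :> d \<and> d < 0" if "x < z" "z < y" for z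
      using der[of z] dec[of c z] that \<open>c \<le> x\<close> \<open>y \<le> \<beta>\<close> c Dc by (intro exI[of _ "D z"]) auto
    show "continuous_on {x..y} g" using that c by (intro continuous_on_subset[OF cont]) auto
  qed
  have g0: "g \<alpha> = 0" "g \<beta> = 0" using g_K gap by auto
  show thesis
  proof
    show "c \<in> {\<alpha><..<\<beta>}" "(g has_real_derivative 0) (at c)" using c by auto
    show "0 < g c" using inc[of \<alpha> c] c g0 by simp
    show "0 \<le> g x" if "x \<in> {\<alpha><..<\<beta>}" for x
      using inc[of \<alpha> x] decr[of x \<beta>] that g0 by (cases "x \<le> c") auto
    show "g x < g c" if "x \<in> {\<alpha><..<\<beta>}" "x \<noteq> c" for x
      using inc[of x c] decr[of c x] that by (cases "x < c") auto
    show "x = c" if "x \<in> {\<alpha><..<\<beta>}" "(g has_real_derivative 0) (at x)" for x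
    proof -
      have "D x = 0" using DERIV_unique[OF der that(2)] that(1) by simp
      then show ?thesis using dec[of x c] dec[of c x] that(1) c Dc by (cases x c rule: linorder_cases) auto
    qed
  qed
qed

lemma right_end_increasing:
  assumes b: "b \<in> K" "b < 1" "\<And>t. t \<in> K \<Longrightarrow> t \<le> b" and xy: "b \<le> x" "x < y" "y \<le> 1"
  shows "g x < g y"
proof (rule DERIV_pos_imp_increasing_open[OF xy(2)])
  have cont: "continuous_on {b..1} g"
  proof (rule continuous_on_g[of _ b 1])
    show "\<bar>b - t\<bar> \<le> \<bar>x - t\<bar> \<or> 1 \<le> \<bar>x - t\<bar>" if "x \<in> {b..1}" "t \<in> K" for x t
      using b(3)[OF that(2)] that(1) by auto
    show "{b..1} \<inter> K \<subseteq> {b}" using b(3) by force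
  qed (use b K_sub in auto)
  then show "continuous_on {x..y} g" using xy by (intro continuous_on_subset[OF cont]) auto
  fix z assume z: "x < z" "z < y"
  then have zK: "z \<notin> K" using b(3) xy by force
  \<comment> \<open>All of K lies to the left of z and within distance 2, so the integrand of
    \<open>D z\<close> is at least 1/2.\<close>
  have "1 / 2 = (\<integral>t. (1 / 2 :: real) \<partial>m)" using prob_space by simp
  also have "\<dots> \<le> D z" unfolding D_def
  proof (rule integral_mono_AE)
    show "AE t in m. 1 / 2 \<le> 1 / (z - t)"
      using AE_K
    proof eventually_elim
      case (elim t)
      have "z \<in> {-1..1}" using z xy b K_sub by auto
      then have "\<bar>z - t\<bar> \<le> 2" using dist_le_2 elim by blast
      then show ?case using b(3)[OF elim] z xy by (intro divide_left_mono) auto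
    qed
  qed (use integrable_D[OF zK] in auto)
  finally show "\<exists>d. DERIV g z :> d \<and> 0 < d" using has_derivative_g[OF zK] by (intro exI[of _ "D z"]) auto
qed

end

section \<open>Gaps as open intervals\<close>

lemma connected_component_complement:
  fixes K :: "real set"
  assumes K: "closed K" and x: "x \<notin> K" "K \<inter> {..x} \<noteq> {}" "K \<inter> {x..} \<noteq> {}"
  obtains \<alpha> \<beta> where "\<alpha> \<in> K" "\<beta> \<in> K" "\<alpha> < x" "x < \<beta>" "{\<alpha><..<\<beta>} \<inter> K = {}"
    "connected_component_set (UNIV - K) x = {\<alpha><..<\<beta>}"
proof -
  define \<alpha> \<beta> where "\<alpha> = Sup (K \<inter> {..x})" and "\<beta> = Inf (K \<inter> {x..})"
  have "\<alpha> \<in> K \<inter> {..x}" unfolding \<alpha>_def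
    using x K by (intro closed_contains_Sup) (auto intro!: bdd_aboveI[of _ x])
  then have \<alpha>: "\<alpha> \<in> K" "\<alpha> < x" using x by (auto simp: less_le)
  have "\<beta> \<in> K \<inter> {x..}" unfolding \<beta>_def
    using x K by (intro closed_contains_Inf) (auto intro!: bdd_belowI[of _ x])
  then have \<beta>: "\<beta> \<in> K" "x < \<beta>" using x by (auto simp: less_le)
  have free: "{\<alpha><..<\<beta>} \<inter> K = {}"
  proof -
    have False if t: "t \<in> K" "\<alpha> < t" "t < \<beta>" for t
    proof (cases "t \<le> x")
      case True
      then have "t \<le> \<alpha>" unfolding \<alpha>_def using t by (intro cSup_upper) (auto intro!: bdd_aboveI[of _ x])
      then show False using t by simp
    next
      case False
      then have "\<beta> \<le> t" unfolding \<beta>_def using t by (intro cInf_lower) (auto intro!: bdd_belowI[of _ x])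
      then show False using t by simp
    qed
    then show ?thesis by auto
  qed
  let ?C = "connected_component_set (UNIV - K) x"
  have "?C = {\<alpha><..<\<beta>}"
  proof
    show "{\<alpha><..<\<beta>} \<subseteq> ?C" by (rule connected_component_maximal) (use \<alpha> \<beta> free in auto)
    have int: "is_interval ?C" by (simp add: is_interval_connected_1 connected_connected_component)
    have sub: "?C \<subseteq> UNIV - K" by (rule connected_component_subset)
    have xC: "x \<in> ?C" using x by simp
    show "?C \<subseteq> {\<alpha><..<\<beta>}"
    proof
      fix y assume y: "y \<in> ?C"
      have "\<alpha> < y"
      proof (rule ccontr)
        assume "\<not> \<alpha> < y"
        then have "\<alpha> \<in> ?C" using int[unfolded is_interval_1, rule_format, OF y xC, of \<alpha>] \<alpha> by simp
        then show False using sub \<alpha> by blast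
      qed
      moreover have "y < \<beta>"
      proof (rule ccontr)
        assume "\<not> y < \<beta>"
        then have "\<beta> \<in> ?C" using int[unfolded is_interval_1, rule_format, OF xC y, of \<beta>] \<beta> by simp
        then show False using sub \<beta> by blast
      qed
      ultimately show "y \<in> {\<alpha><..<\<beta>}" by simp
    qed
  qed
  then show thesis using that \<alpha> \<beta> free by blast
qed

lemma gaps_cases:
  assumes "closed K" "I \<in> gaps K"
  obtains \<alpha> \<beta> where "\<alpha> \<in> K" "\<beta> \<in> K" "\<alpha> < \<beta>" "{\<alpha><..<\<beta>} \<inter> K = {}" "I = {\<alpha><..<\<beta>}"
proof -
  from assms(2) obtain x where x: "x \<notin> K" "I = connected_component_set (UNIV - K) x" and bd: "bounded I"
    by (auto simp: gaps_def components_iff)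
  have "K \<inter> {..x} \<noteq> {}"
  proof
    assume "K \<inter> {..x} = {}"
    then have "{..x} \<subseteq> I" unfolding x(2) by (intro connected_component_maximal) auto
    then have "bounded {..x}" using bd bounded_subset by blast
    then obtain B where "\<forall>y\<in>{..x}. \<bar>y\<bar> \<le> B" by (auto simp: bounded_real)
    then have "\<bar>min x (- \<bar>B\<bar> - 1)\<bar> \<le> B" by (rule bspec) simp
    then show False by (auto simp: abs_if min_def split: if_splits)
  qed
  moreover have "K \<inter> {x..} \<noteq> {}"
  proof
    assume "K \<inter> {x..} = {}"
    then have "{x..} \<subseteq> I" unfolding x(2) by (intro connected_component_maximal) auto
    then have "bounded {x..}" using bd bounded_subset by blast
    then obtain B where "\<forall>y\<in>{x..}. \<bar>y\<bar> \<le> B" by (auto simp: bounded_real)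
    then have "\<bar>max x (\<bar>B\<bar> + 1)\<bar> \<le> B" by (rule bspec) simp
    then show False by (auto simp: abs_if max_def split: if_splits)
  qed
  ultimately show thesis
    using connected_component_complement[OF assms(1) x(1)] x(2) that by (metis order.strict_trans)
qed

lemma mem_gaps:
  assumes "closed K" "x \<notin> K" "a \<in> K" "b \<in> K" "a < x" "x < b"
  shows "\<exists>I\<in>gaps K. x \<in> I"
proof -
  obtain \<alpha> \<beta> where *: "\<alpha> < x" "x < \<beta>" "connected_component_set (UNIV - K) x = {\<alpha><..<\<beta>}"
    using connected_component_complement[OF assms(1,2)] assms(3-6)
    by (metis IntI atLeast_iff atMost_iff empty_iff less_imp_le)
  then have "{\<alpha><..<\<beta>} \<in> gaps K"
    unfolding gaps_def components_iff using assms(2) by auto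
  then show ?thesis using * by auto
qed

lemma countable_gaps:
  assumes "closed K"
  shows "countable (gaps K)"
proof (rule countable_disjoint_open_subsets)
  show "open S" if "S \<in> gaps K" for S using gaps_cases[OF assms that] by (metis open_greaterThanLessThan)
  show "disjoint (gaps K)"
    unfolding disjoint_def gaps_def using components_nonoverlap by blast
qed

section \<open>The upper bound for the Widom factor\<close>

text \<open>Strictness has two sources. If A is null, the left-hand side is 0 and the right-hand
  side positive. Otherwise C - h is positive on A off c, hence almost everywhere on A, and its
  integral over A is the deficit.\<close>

lemma nn_integral_less_of_strict_bound:
  fixes h :: "'a \<Rightarrow> real"
  assumes [measurable]: "A \<in> sets M" "h \<in> borel_measurable M" and c: "AE x in M. x \<noteq> c"
    and q: "emeasure M A \<le> ennreal q" "0 < q" and C: "0 < C"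
    and h: "\<And>x. x \<in> A \<Longrightarrow> 0 \<le> h x" "\<And>x. x \<in> A \<Longrightarrow> x \<noteq> c \<Longrightarrow> h x < C" "h c \<le> C"
  shows "(\<integral>\<^sup>+x. ennreal (h x) * indicator A x \<partial>M) < ennreal (C * q)"
proof (cases "emeasure M A = 0")
  case True
  then have "(\<integral>\<^sup>+x. ennreal (h x) * indicator A x \<partial>M) = 0"
    by (intro nn_integral_null_set) (auto simp: null_sets_def)
  then show ?thesis using q C by simp
next
  case False
  let ?h = "\<lambda>x. ennreal (h x) * indicator A x" and ?u = "\<lambda>x. ennreal (C - h x) * indicator A x"
  have le: "h x \<le> C" if "x \<in> A" for x using h(2)[OF that] h(3) by (cases "x = c") auto
  have "?h x + ?u x = ennreal C * indicator A x" for x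
    using h(1) le by (auto simp: indicator_def simp flip: ennreal_plus)
  then have "(\<integral>\<^sup>+x. ?h x \<partial>M) + (\<integral>\<^sup>+x. ?u x \<partial>M) = (\<integral>\<^sup>+x. ennreal C * indicator A x \<partial>M)"
    by (subst nn_integral_add[symmetric]) auto
  also have "\<dots> = ennreal C * emeasure M A" by (rule nn_integral_cmult_indicator) measurable
  finally have sum: "(\<integral>\<^sup>+x. ?h x \<partial>M) + (\<integral>\<^sup>+x. ?u x \<partial>M) = ennreal C * emeasure M A" .
  have u: "(\<integral>\<^sup>+x. ?u x \<partial>M) \<noteq> 0"
  proof
    assume "(\<integral>\<^sup>+x. ?u x \<partial>M) = 0"
    then have "AE x in M. ?u x = 0" by (subst (asm) nn_integral_0_iff_AE) auto
    then have "AE x in M. x \<notin> A" using c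
    proof eventually_elim
      case (elim x)
      then show ?case using h(2)[of x] by (auto simp: indicator_def ennreal_eq_0_iff split: if_splits)
    qed
    then show False using False by (subst (asm) AE_iff_measurable[OF _ refl]) (auto simp: Int_def[symmetric])
  qed
  have "ennreal C * emeasure M A \<le> ennreal C * ennreal q" using q by (intro mult_left_mono) auto
  then have fin: "ennreal C * emeasure M A < \<top>" by (rule le_less_trans) (simp add: ennreal_mult_less_top)
  then have "(\<integral>\<^sup>+x. ?h x \<partial>M) < \<top>" unfolding sum[symmetric] by (simp add: le_less_trans)
  then have "(\<integral>\<^sup>+x. ?h x \<partial>M) < (\<integral>\<^sup>+x. ?h x \<partial>M) + (\<integral>\<^sup>+x. ?u x \<partial>M)"
    using u by (auto simp: ennreal_add_left_cancel_less zero_less_iff_neq_zero)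
  also have "\<dots> = ennreal C * emeasure M A" by (rule sum)
  also have "\<dots> \<le> ennreal C * ennreal q" using q by (intro mult_left_mono) auto
  finally show ?thesis using C q by (simp add: ennreal_mult)
qed

lemma ennreal_le_diff_of_less:
  fixes a b :: ennreal
  assumes "a < b" "b < \<top>"
  obtains \<delta> :: ennreal where "0 < \<delta>" "a + \<delta> = b"
proof (rule that[of "b - a"])
  show "0 < b - a" using assms by (simp add: diff_gt_0_iff_gt_ennreal)
  show "a + (b - a) = b" using assms by (simp add: add_diff_inverse_ennreal less_imp_le)
qed

section \<open>The equilibrium potential of a regular set\<close>

context sqrt_weight_problem
begin

abbreviation "C \<equiv> Cap (cset K)"
abbreviation "eq_measure \<equiv> real_marginal (equilibrium_measure (cset K))"
abbreviation "pw_bound \<equiv> greenR K 1 / 2 + enn2real (PW K)"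

lemma interval_measure_equilibrium: "interval_measure (equilibrium_measure (cset K)) K"
  using prob_on_equilibrium_measure[OF closed_K K_subset Cap_pos] closed_K K_subset by unfold_locales

lemma green_eq:
  assumes "x \<in> {-1..1}"
  shows "green (cset K) (complex_of_real x) =
    ereal (- ln C) - (enn2ereal (\<integral>\<^sup>+t. log_kernel x t \<partial>eq_measure) - ereal (ln 2))"
  unfolding green_def interval_measure.log_potential_eq[OF interval_measure_equilibrium assms] ..

text \<open>Vanishing of the Green function at every point of K says that the potential has the
  value \<open>ln 2 - ln C\<close> there, without exceptional points.\<close>

lemma equilibrium_potential_regular:
  assumes "regular_real K"
  shows "equilibrium_potential K eq_measure (ln 2 - ln C)"
proof -
  have pot: "(\<integral>\<^sup>+t. log_kernel x t \<partial>eq_measure) = ennreal (ln 2 - ln C) \<and> 0 \<le> ln 2 - ln C" if "x \<in> K" for x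
  proof -
    have "green (cset K) (complex_of_real x) = 0" using assms that by (auto simp: regular_real_def)
    then have *: "ereal (- ln C) - (enn2ereal (\<integral>\<^sup>+t. log_kernel x t \<partial>eq_measure) - ereal (ln 2)) = 0"
      using that K_subset by (subst (asm) green_eq) auto
    show ?thesis
    proof (cases "\<integral>\<^sup>+t. log_kernel x t \<partial>eq_measure")
      case (real q)
      then have "- ln C - (q - ln 2) = 0" using * by (simp add: enn2ereal_ennreal zero_ereal_def)
      then have "q = ln 2 - ln C" by simp
      then show ?thesis using real by simp
    next
      case top
      then show ?thesis using * by simp
    qed
  qed
  moreover have "K \<noteq> {}" using infinite_K by auto
  ultimately show ?thesis
    using interval_measure.real_prob_on_m[OF interval_measure_equilibrium] compact K_subset
    by unfold_locales auto
qed

end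

locale regular_problem = sqrt_weight_problem +
  assumes regular: "regular_real K" and pw: "parreau_widom K"
begin

sublocale equilibrium_potential K eq_measure "ln 2 - ln C"
  using regular by (rule equilibrium_potential_regular)

lemma greenR_eq: "x \<in> {-1..1} \<Longrightarrow> greenR K x = g x"
proof -
  assume x: "x \<in> {-1..1}"
  obtain q where q: "(\<integral>\<^sup>+t. log_kernel x t \<partial>eq_measure) = ennreal q" "0 \<le> q"
    using potential_finite[OF x] by (cases "\<integral>\<^sup>+t. log_kernel x t \<partial>eq_measure") auto
  show ?thesis
    unfolding greenR_def green_eq[OF x] g_plus_potential[OF x] q(1) using q(2) by (simp add: enn2ereal_ennreal)
qed

lemma crit_point_gap:
  assumes "I \<in> gaps K"
  shows "crit_point K I \<in> I" "0 < g (crit_point K I)" "I \<subseteq> {-1..1}" "is_interval I" "I \<inter> K = {}"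
    "\<And>x. x \<in> I \<Longrightarrow> 0 \<le> g x" "\<And>x. x \<in> I \<Longrightarrow> x \<noteq> crit_point K I \<Longrightarrow> g x < g (crit_point K I)"
proof -
  obtain \<alpha> \<beta> where gap: "\<alpha> \<in> K" "\<beta> \<in> K" "\<alpha> < \<beta>" "{\<alpha><..<\<beta>} \<inter> K = {}" and I: "I = {\<alpha><..<\<beta>}"
    using gaps_cases[OF closed_K assms] by blast
  have sub: "I \<subseteq> {-1..1}" using subsetD[OF K_subset gap(1)] subsetD[OF K_subset gap(2)] unfolding I by auto
  \<comment> \<open>\<open>greenR\<close> is identified with g on [-1, 1] only; a gap is an open
    subset of that interval, so the derivatives agree.\<close>
  have der: "(greenR K has_real_derivative d) (at x) \<longleftrightarrow> (g has_real_derivative d) (at x)" if "x \<in> I" for x d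
  proof (rule DERIV_cong_ev)
    have "eventually (\<lambda>x. x \<in> I) (nhds x)" using that unfolding I by (intro eventually_nhds_in_open) auto
    then show "eventually (\<lambda>x. greenR K x = g x) (nhds x)"
      by eventually_elim (use sub greenR_eq in auto)
  qed auto
  obtain c where c: "c \<in> I" "(g has_real_derivative 0) (at c)" "0 < g c"
    "\<And>x. x \<in> I \<Longrightarrow> 0 \<le> g x" "\<And>x. x \<in> I \<Longrightarrow> x \<noteq> c \<Longrightarrow> g x < g c"
    "\<And>x. x \<in> I \<Longrightarrow> (g has_real_derivative 0) (at x) \<Longrightarrow> x = c"
    unfolding I by (rule gap_maximum[OF gap]) blast
  \<comment> \<open>The definite description in \<open>crit_point\<close> takes its meaning from the
    uniqueness of the critical point.\<close>
  have "crit_point K I = c"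
    unfolding crit_point_def
  proof (rule the_equality)
    show "c \<in> I \<and> (greenR K has_real_derivative 0) (at c)" using c(1,2) der[OF c(1)] by simp
    show "x = c" if "x \<in> I \<and> (greenR K has_real_derivative 0) (at x)" for x
      using that der c(6) by blast
  qed
  then show "crit_point K I \<in> I" "0 < g (crit_point K I)" "I \<subseteq> {-1..1}" "is_interval I" "I \<inter> K = {}"
    "\<And>x. x \<in> I \<Longrightarrow> 0 \<le> g x" "\<And>x. x \<in> I \<Longrightarrow> x \<noteq> crit_point K I \<Longrightarrow> g x < g (crit_point K I)"
    using c(1,3-5) sub gap(4) by (simp_all add: I is_interval_oo)
qed

lemma PW_eq: "PW K = (\<integral>\<^sup>+I. ennreal (g (crit_point K I)) \<partial>count_space (gaps K))"
  unfolding PW_def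
  by (rule nn_integral_cong) (use crit_point_gap(1,3) greenR_eq in \<open>auto simp: subset_eq\<close>)

lemma PW_finite: "PW K < \<top>"
  using pw by (simp add: parreau_widom_def)

definition b :: real where "b = Sup K"

lemma b_mem: "b \<in> K" and b_upper: "t \<in> K \<Longrightarrow> t \<le> b"
proof -
  have ne: "K \<noteq> {}" and bdd: "bdd_above K" using infinite_K compact by (auto intro: bounded_imp_bdd_above compact_imp_bounded)
  show "b \<in> K" unfolding b_def by (rule closed_contains_Sup[OF ne bdd closed_K])
  show "t \<in> K \<Longrightarrow> t \<le> b" unfolding b_def using bdd by (rule cSup_upper[rotated])
qed

lemma b_le_1: "b \<le> 1"
  using b_mem K_subset by auto

lemma g_last:
  assumes "x \<in> {b<..1}"
  shows "0 \<le> g x" "x \<noteq> 1 \<Longrightarrow> g x < g 1"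
proof -
  have b1: "b < 1" using assms by auto
  show "0 \<le> g x" using right_end_increasing[OF b_mem b1 b_upper, of b x] assms g_K[OF b_mem] by auto
  show "x \<noteq> 1 \<Longrightarrow> g x < g 1" using right_end_increasing[OF b_mem b1 b_upper, of x 1] assms by auto
qed

lemma g_1: "0 \<le> g 1" "b < 1 \<Longrightarrow> 0 < g 1"
proof -
  show "b < 1 \<Longrightarrow> 0 < g 1"
    using right_end_increasing[OF b_mem _ b_upper, of b 1] g_K[OF b_mem] by auto
  then show "0 \<le> g 1" using b_le_1 g_K[OF b_mem] by (cases "b < 1") auto
qed

lemma borel_g [measurable]: "g \<in> borel_measurable borel"
  unfolding g_def by measurable

text \<open>The exponent \<open>(n + 1/2) * (\<Gamma>\<^sub>K - \<Gamma>\<^sub>E)\<close> of the Widom factor is the integral of the Green function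
  of \<open>K\<close> against \<open>(n + 1/2)\<close> times the equilibrium measure of the polynomial preimage \<open>E\<close>.\<close>

lemma widom_exponent:
  obtains X where "cheb_t K w n = 2 * sqrt C * C ^ n * exp X" "X \<le> pw_bound"
    "gaps K \<noteq> {} \<or> b < 1 \<Longrightarrow> X < pw_bound"
proof (rule alternant_exists)
  fix T xs \<sigma> assume T: "alternant T (cheb_t K w n) n xs \<sigma>" and xsK: "\<And>i. i \<le> n \<Longrightarrow> xs i \<in> K"
    and K_le: "K \<subseteq> {x\<in>{-1..1}. \<bar>poly (alternant.R T (cheb_t K w n)) x\<bar> \<le> 1}"
  define M where "M = cheb_t K w n"
  interpret A: alternant T M n xs \<sigma> using T unfolding M_def .
  note KE = K_le[folded M_def]
  define \<nu> where "\<nu> = A.pullback"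
  define d :: real where "d = 2 * real n + 1"
  have d: "0 < d" "real (degree A.R) = d" by (simp_all add: d_def A.degree_R)
  have fin: "finite_measure \<nu>" unfolding \<nu>_def by (rule A.finite_measure_pullback)
  have sets_\<nu> [simp, measurable_cong]: "sets \<nu> = sets borel" by (simp add: \<nu>_def)
  interpret \<nu>: prob_space \<nu> unfolding \<nu>_def using A.real_prob_on_pullback by (rule real_prob_on_prob_space)
  have [measurable]: "I \<in> sets borel" if "I \<in> gaps K" for I
    using crit_point_gap(4)[OF that] by (rule real_interval_borel_measurable)
  \<comment> \<open>Finite energy excludes atoms, so the critical point of a gap carries no
    mass.\<close>
  have atom: "AE x in \<nu>. x \<noteq> c" for c
  proof (rule AE_I')
    have "mutual_energy \<nu> \<nu> \<noteq> \<infinity>"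
      unfolding \<nu>_def by (simp add: A.mutual_energy_pullback[OF A.real_prob_on_pullback])
    then have "emeasure \<nu> {c} = 0" using mutual_energy_atom[OF sets_\<nu>] by blast
    then show "{c} \<in> null_sets \<nu>" by (simp add: null_sets_def)
  qed auto
  \<comment> \<open>The alternation points belong to K, so a gap contains none of them and at most
    two solutions of each equation.\<close>
  have \<nu>_gap: "emeasure \<nu> I \<le> ennreal (2 / d)" if "I \<in> gaps K" for I
  proof -
    have "xs i \<notin> I" if "i \<le> n" for i using xsK[OF that] crit_point_gap(5)[OF \<open>I \<in> gaps K\<close>] by blast
    then have "emeasure \<nu> I \<le> ennreal (real 2 / degree A.R)"
      unfolding \<nu>_def using that crit_point_gap(4)[OF that]
      by (intro A.emeasure_pullback_le) (auto intro!: A.card_fiber_interval)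
    then show ?thesis by (simp add: d)
  qed
  have \<nu>_last: "emeasure \<nu> {b<..1} \<le> ennreal (1 / d)"
  proof -
    have "emeasure \<nu> {b<..1} \<le> emeasure \<nu> {b<..}" by (intro emeasure_mono) auto
    also have "\<dots> \<le> ennreal (real 1 / degree A.R)"
      unfolding \<nu>_def
    proof (rule A.emeasure_pullback_le)
      show "card {x\<in>{b<..}. poly A.R x = y} \<le> 1" if "y \<in> {-1<..<1} - {}" for y
        using that b_upper[OF xsK[of n]] by (intro A.card_fiber_last) auto
    qed simp
    finally show ?thesis by (simp add: d)
  qed
  \<comment> \<open>No solution lies left of the first alternation point, a point of K. Hence the
    part of [-1, 1] below K has no mass and contributes no term to the bound.\<close>
  have "emeasure \<nu> {..xs 0} \<le> ennreal (real 0 / degree A.R)"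
    unfolding \<nu>_def
  proof (rule A.emeasure_pullback_le)
    fix y :: real assume "y \<in> {-1<..<1} - {}"
    then show "card {x\<in>{..xs 0}. poly A.R x = y} \<le> 0" by (subst A.fiber_first) auto
  qed simp
  then have "AE x in \<nu>. x \<notin> {..xs 0}" by (intro AE_not_in) (auto simp: null_sets_def)
  then have AE_parts: "AE x in \<nu>. x \<in> {-1..1} \<and> (x \<in> K \<or> (\<exists>I\<in>gaps K. x \<in> I) \<or> x \<in> {b<..1})"
    using real_prob_on_AE[OF A.real_prob_on_pullback[folded \<nu>_def]]
  proof eventually_elim
    case (elim x)
    show ?case using elim mem_gaps[OF closed_K _ xsK[of 0] b_mem, of x] b_mem by (cases "x < b"; cases "x = b") auto
  qed
  have g_nonneg: "AE x in \<nu>. 0 \<le> g x"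
    using AE_parts by eventually_elim (use g_K crit_point_gap(6) g_last(1) in auto)
  define \<Gamma> where "\<Gamma> = ln 2 - ln C"
  have \<Gamma>0: "0 \<le> \<Gamma>" unfolding \<Gamma>_def by (rule \<Gamma>)
  \<comment> \<open>Integrate g + potential = \<Gamma> against \<nu>. By symmetry the potential of
    the equilibrium measure integrates to the potential of \<nu> against that measure, which lives
    on K inside the preimage and so sees the constant \<open>level\<close>.\<close>
  have G: "(\<integral>\<^sup>+x. ennreal (g x) \<partial>\<nu>) + ennreal A.level = ennreal \<Gamma>"
  proof -
    have "(\<integral>\<^sup>+x. \<integral>\<^sup>+t. log_kernel x t \<partial>eq_measure \<partial>\<nu>) = mutual_energy eq_measure \<nu>"
      unfolding mutual_energy_def[symmetric]
      by (rule mutual_energy_commute[OF fin finite_measure_axioms]) simp_all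
    also have "\<dots> = ennreal A.level"
      unfolding \<nu>_def by (rule A.mutual_energy_pullback[OF real_prob_on_mono[OF m KE]])
    finally have "(\<integral>\<^sup>+x. ennreal (g x) \<partial>\<nu>) + ennreal A.level =
        (\<integral>\<^sup>+x. ennreal (g x) + (\<integral>\<^sup>+t. log_kernel x t \<partial>eq_measure) \<partial>\<nu>)"
      by (subst nn_integral_add) auto
    also have "\<dots> = (\<integral>\<^sup>+x. ennreal \<Gamma> \<partial>\<nu>)"
    proof (rule nn_integral_cong_AE)
      show "AE x in \<nu>. ennreal (g x) + (\<integral>\<^sup>+t. log_kernel x t \<partial>eq_measure) = ennreal \<Gamma>"
        using AE_parts g_nonneg
      proof eventually_elim
        case (elim x)
        then have x: "x \<in> {-1..1}" by simp
        obtain q where q: "(\<integral>\<^sup>+t. log_kernel x t \<partial>eq_measure) = ennreal q" "0 \<le> q"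
          using potential_finite[OF x] by (cases "\<integral>\<^sup>+t. log_kernel x t \<partial>eq_measure") auto
        have "g x = \<Gamma> - q" using q by (simp add: g_plus_potential[OF x] \<Gamma>_def)
        then show ?case using q elim(2) by (simp flip: ennreal_plus)
      qed
    qed
    also have "\<dots> = ennreal \<Gamma>" by (simp add: \<nu>.emeasure_space_1)
    finally show ?thesis .
  qed
  define Y where "Y = \<Gamma> - A.level"
  have GY: "(\<integral>\<^sup>+x. ennreal (g x) \<partial>\<nu>) = ennreal Y" and Y0: "0 \<le> Y"
  proof -
    have "ennreal A.level \<le> ennreal \<Gamma>" unfolding G[symmetric] by simp
    then show "0 \<le> Y" using \<Gamma>0 by (simp add: Y_def)
    have "(\<integral>\<^sup>+x. ennreal (g x) \<partial>\<nu>) = ennreal \<Gamma> - ennreal A.level" unfolding G[symmetric] by simp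
    then show "(\<integral>\<^sup>+x. ennreal (g x) \<partial>\<nu>) = ennreal Y" using A.level_pos by (simp add: Y_def ennreal_minus)
  qed
  define a where "a I = (\<integral>\<^sup>+x. ennreal (g x) * indicator I x \<partial>\<nu>)" for I
  have a_gap: "a I < ennreal (g (crit_point K I) * (2 / d))" if "I \<in> gaps K" for I
    unfolding a_def
    by (rule nn_integral_less_of_strict_bound[OF _ _ atom \<nu>_gap[OF that]])
      (use that crit_point_gap[OF that] d in auto)
  have a_last: "a {b<..1} \<le> ennreal (g 1 * (1 / d)) \<and> (b < 1 \<longrightarrow> a {b<..1} < ennreal (g 1 * (1 / d)))"
  proof (cases "b < 1")
    case True
    have "a {b<..1} < ennreal (g 1 * (1 / d))"
      unfolding a_def
      by (rule nn_integral_less_of_strict_bound[OF _ _ atom \<nu>_last]) (use g_last g_1 True d in auto)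
    then show ?thesis by auto
  next
    case False
    then have "{b<..1} = {}" by auto
    then show ?thesis using False by (simp add: a_def)
  qed
  have le: "ennreal Y \<le> (\<integral>\<^sup>+I. a I \<partial>count_space (gaps K)) + a {b<..1}"
  proof -
    have "ennreal Y \<le> (\<integral>\<^sup>+x. (\<integral>\<^sup>+I. ennreal (g x) * indicator I x \<partial>count_space (gaps K)) + ennreal (g x) * indicator {b<..1} x \<partial>\<nu>)"
      unfolding GY[symmetric]
    proof (rule nn_integral_mono_AE)
      show "AE x in \<nu>. ennreal (g x) \<le> (\<integral>\<^sup>+I. ennreal (g x) * indicator I x \<partial>count_space (gaps K)) + ennreal (g x) * indicator {b<..1} x"
        using AE_parts
      proof eventually_elim
        case (elim x)
        then consider "x \<in> K" | I where "I \<in> gaps K" "x \<in> I" | "x \<in> {b<..1}" by blast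
        then show ?case
        proof cases
          case 2
          then have "ennreal (g x) \<le> (\<integral>\<^sup>+I. ennreal (g x) * indicator I x \<partial>count_space (gaps K))"
            using nn_integral_ge_point[of I "gaps K" "\<lambda>I. ennreal (g x) * indicator I x"] by simp
          then show ?thesis by (rule add_increasing2[rotated]) simp
        qed (auto simp: g_K)
      qed
    qed
    also have "\<dots> = (\<integral>\<^sup>+x. \<integral>\<^sup>+I. ennreal (g x) * indicator I x \<partial>count_space (gaps K) \<partial>\<nu>) + a {b<..1}"
      unfolding a_def
    proof (rule nn_integral_add)
      show "(\<lambda>x. \<integral>\<^sup>+I. ennreal (g x) * indicator I x \<partial>count_space (gaps K)) \<in> borel_measurable \<nu>"
      proof -
        interpret S: sigma_finite_measure "count_space (gaps K)"
          by (rule sigma_finite_measure_count_space_countable) (rule countable_gaps[OF closed_K])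
        have "(\<lambda>(I, x). ennreal (g x) * indicator I x) \<in> borel_measurable (count_space (gaps K) \<Otimes>\<^sub>M \<nu>)"
          by (rule measurable_pair_measure_countable1[OF countable_gaps[OF closed_K]]) simp
        then have "(\<lambda>(x, I). ennreal (g x) * indicator I x) \<in> borel_measurable (\<nu> \<Otimes>\<^sub>M count_space (gaps K))"
          by (subst (asm) measurable_pair_swap_iff) (simp add: split_beta')
        then show ?thesis by (rule S.borel_measurable_nn_integral)
      qed
    qed measurable
    also have "(\<integral>\<^sup>+x. \<integral>\<^sup>+I. ennreal (g x) * indicator I x \<partial>count_space (gaps K) \<partial>\<nu>) = (\<integral>\<^sup>+I. a I \<partial>count_space (gaps K))"
      unfolding a_def using countable_gaps[OF closed_K] by (intro nn_integral_count_space_nn_integral) auto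
    finally show ?thesis .
  qed
  have pw_eq: "(\<integral>\<^sup>+I. ennreal (g (crit_point K I) * (2 / d)) \<partial>count_space (gaps K)) = ennreal (2 / d * enn2real (PW K))"
  proof -
    have "(\<integral>\<^sup>+I. ennreal (g (crit_point K I) * (2 / d)) \<partial>count_space (gaps K)) =
       (\<integral>\<^sup>+I. ennreal (2 / d) * ennreal (g (crit_point K I)) \<partial>count_space (gaps K))"
      by (rule nn_integral_cong) (use crit_point_gap(2) d in \<open>auto simp: mult.commute less_imp_le simp flip: ennreal_mult\<close>)
    also have "\<dots> = ennreal (2 / d) * PW K" unfolding PW_eq by (rule nn_integral_cmult) simp
    also have "\<dots> = ennreal (2 / d * enn2real (PW K))"
    proof -
      have "PW K = ennreal (enn2real (PW K))" using PW_finite by simp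
      then show ?thesis using d by (metis ennreal_mult enn2real_nonneg less_imp_le zero_less_divide_iff zero_less_numeral)
    qed
    finally show ?thesis .
  qed
  have g1: "greenR K 1 = g 1" by (rule greenR_eq) simp
  \<comment> \<open>The factor \<open>d / 2\<close> = n + 1/2 is the exponent that relates the ratio
    of the two capacities to the ratio of the Chebyshev norms.\<close>
  define X where "X = d / 2 * Y"
  \<comment> \<open>Mass 2 / d per gap and 1 / d at the right end: multiplied by d / 2 these become
    the full sum over the gaps and half of the Green function at 1.\<close>
  have sum: "ennreal (2 / d * enn2real (PW K)) + ennreal (g 1 * (1 / d)) = ennreal (2 / d * pw_bound)"
    using d g_1(1) by (simp add: g1 field_simps flip: ennreal_plus)
  show thesis
  proof
    have "X = (d / 2) * (- ln C - ln (4 / M\<^sup>2) / d)"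
      by (simp add: X_def Y_def \<Gamma>_def A.level_eq d_def add.commute)
    also have "\<dots> = - ((real n + 1 / 2) * ln C) - ln (4 / M\<^sup>2) / 2"
      using d by (simp add: field_simps d_def)
    also note ln_four_div_square[OF A.M_pos]
    finally have "ln M = ln (2 * sqrt C * C ^ n) + X"
      by (simp add: ln_widom_bound[OF Cap_pos] diff_divide_distrib)
    then have "exp (ln M) = exp (ln (2 * sqrt C * C ^ n)) * exp X" by (simp add: exp_add)
    then show "cheb_t K w n = 2 * sqrt C * C ^ n * exp X" using A.M_pos Cap_pos by (simp add: M_def)
    have gaps_le: "(\<integral>\<^sup>+I. a I \<partial>count_space (gaps K)) \<le> ennreal (2 / d * enn2real (PW K))"
      unfolding pw_eq[symmetric] by (rule nn_integral_mono) (use a_gap in \<open>auto intro: less_imp_le\<close>)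
    have "ennreal Y \<le> ennreal (2 / d * pw_bound)"
      unfolding sum[symmetric] using a_last gaps_le by (intro order_trans[OF le] add_mono) auto
    moreover have bnd: "0 \<le> pw_bound" using g1 g_1 by simp
    ultimately have "Y \<le> 2 / d * pw_bound" using d by simp
    then show "X \<le> pw_bound" using d by (simp add: X_def field_simps)
    assume "gaps K \<noteq> {} \<or> b < 1"
    then have "ennreal Y < ennreal (2 / d * pw_bound)"
    proof
      assume "b < 1"
      then have "a {b<..1} < ennreal (g 1 * (1 / d))" using a_last by blast
      then have "ennreal (2 / d * enn2real (PW K)) + a {b<..1} < ennreal (2 / d * pw_bound)"
        unfolding sum[symmetric] ennreal_add_left_cancel_less by simp
      moreover have "ennreal Y \<le> ennreal (2 / d * enn2real (PW K)) + a {b<..1}"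
        using le add_right_mono[OF gaps_le] by (rule order_trans)
      ultimately show ?thesis by (rule le_less_trans[rotated])
    next
      assume "gaps K \<noteq> {}"
      then obtain I0 where I0: "I0 \<in> gaps K" by blast
      \<comment> \<open>Term by term strictness might be lost in a sum over infinitely many gaps.
        The slack \<delta> of one fixed gap is therefore added to its term and carried through the
        sum.\<close>
      obtain \<delta> where \<delta>: "0 < \<delta>" "a I0 + \<delta> = ennreal (g (crit_point K I0) * (2 / d))"
        using ennreal_le_diff_of_less[OF a_gap[OF I0]] by auto
      have "(\<integral>\<^sup>+I. a I \<partial>count_space (gaps K)) + \<delta> = (\<integral>\<^sup>+I. a I + \<delta> * indicator {I0} I \<partial>count_space (gaps K))"
        using I0 by (subst nn_integral_add) (auto simp: nn_integral_cmult_indicator)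
      also have "\<dots> \<le> (\<integral>\<^sup>+I. ennreal (g (crit_point K I) * (2 / d)) \<partial>count_space (gaps K))"
        by (rule nn_integral_mono) (use a_gap \<delta>(2) in \<open>auto simp: indicator_def intro: less_imp_le\<close>)
      finally have le': "(\<integral>\<^sup>+I. a I \<partial>count_space (gaps K)) + \<delta> \<le> ennreal (2 / d * enn2real (PW K))"
        unfolding pw_eq .
      have "ennreal Y + \<delta> \<le> ((\<integral>\<^sup>+I. a I \<partial>count_space (gaps K)) + \<delta>) + a {b<..1}"
        using add_right_mono[OF le, of \<delta>] by (simp add: ac_simps)
      also have "\<dots> \<le> ennreal (2 / d * pw_bound)"
        unfolding sum[symmetric] using le' a_last by (intro add_mono) auto
      finally have le'': "ennreal Y + \<delta> \<le> ennreal (2 / d * pw_bound)" .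
      have "ennreal Y < ennreal Y + \<delta>" using \<delta>(1) by simp
      then show ?thesis using le'' by (rule less_le_trans)
    qed
    then have "Y < 2 / d * pw_bound" using Y0 by (simp add: ennreal_less_iff)
    then show "X < pw_bound" using d by (simp add: X_def field_simps)
  qed
qed

end

section \<open>Both bounds and their cases of equality\<close>

theorem theorem5:
  fixes K :: "real set" and n :: nat
  assumes "compact K" and "K \<subseteq> {-1..1}" and "Cap (cset K) > 0" and "n \<ge> 1"
  defines "w \<equiv> (\<lambda>x::real. sqrt (1 - x))"
  shows "widom_factor K w n \<ge> 2 * sqrt (Cap (cset K))
      \<and> (widom_factor K w n = 2 * sqrt (Cap (cset K)) \<longleftrightarrow>
           (\<exists>S :: complex poly. degree S = n \<and>
              cset K = {z. (1 - z) * (poly S z)\<^sup>2 \<in> complex_of_real ` {0..1}}))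
    \<and> (regular_real K \<and> parreau_widom K \<longrightarrow>
      widom_factor K w n \<le> 2 * sqrt (Cap (cset K))
          * exp (greenR K 1 / 2 + enn2real (PW K))
      \<and> (widom_factor K w n = 2 * sqrt (Cap (cset K))
            * exp (greenR K 1 / 2 + enn2real (PW K))
         \<longleftrightarrow> (\<exists>a. -1 \<le> a \<and> a < 1 \<and> K = {a..1})))"
proof -
  interpret sqrt_weight_problem K n
    using assms(1-4) by unfold_locales
  have C: "0 < Cap (cset K) ^ n" using Cap_pos by simp
  have W: "widom_factor K w n = cheb_t K (\<lambda>x. sqrt (1 - x)) n / Cap (cset K) ^ n"
    by (simp add: widom_factor_def w_def)
  have ge: "2 * sqrt (Cap (cset K)) \<le> widom_factor K w n"
    unfolding W using cheb_t_ge C by (simp add: pos_le_divide_eq)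
  moreover have "widom_factor K w n = 2 * sqrt (Cap (cset K)) \<longleftrightarrow>
      (\<exists>S :: complex poly. degree S = n \<and> cset K = {z. (1 - z) * (poly S z)\<^sup>2 \<in> complex_of_real ` {0..1}})"
  proof
    assume "widom_factor K w n = 2 * sqrt (Cap (cset K))"
    then show "\<exists>S :: complex poly. degree S = n \<and> cset K = {z. (1 - z) * (poly S z)\<^sup>2 \<in> complex_of_real ` {0..1}}"
      using Cap_pos by (intro cheb_t_eq_imp_preimage) (simp add: W divide_eq_eq)
  next
    assume "\<exists>S :: complex poly. degree S = n \<and> cset K = {z. (1 - z) * (poly S z)\<^sup>2 \<in> complex_of_real ` {0..1}}"
    then have "cheb_t K (\<lambda>x. sqrt (1 - x)) n \<le> 2 * sqrt (Cap (cset K)) * Cap (cset K) ^ n"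
      using preimage_imp_cheb_t_le by blast
    then have "widom_factor K w n \<le> 2 * sqrt (Cap (cset K))" unfolding W using C by (simp add: pos_divide_le_eq)
    then show "widom_factor K w n = 2 * sqrt (Cap (cset K))" using ge by simp
  qed
  moreover have "widom_factor K w n \<le> 2 * sqrt (Cap (cset K)) * exp (greenR K 1 / 2 + enn2real (PW K))
      \<and> (widom_factor K w n = 2 * sqrt (Cap (cset K)) * exp (greenR K 1 / 2 + enn2real (PW K))
         \<longleftrightarrow> (\<exists>a. -1 \<le> a \<and> a < 1 \<and> K = {a..1}))"
    if "regular_real K \<and> parreau_widom K"
  proof -
    interpret regular_problem K n
      using that by unfold_locales auto
    obtain X where X: "cheb_t K (\<lambda>x. sqrt (1 - x)) n = 2 * sqrt (Cap (cset K)) * Cap (cset K) ^ n * exp X"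
      "X \<le> greenR K 1 / 2 + enn2real (PW K)"
      and strict: "gaps K \<noteq> {} \<or> b < 1 \<Longrightarrow> X < greenR K 1 / 2 + enn2real (PW K)"
      by (rule widom_exponent) blast
    have WX: "widom_factor K w n = 2 * sqrt (Cap (cset K)) * exp X"
      unfolding W X(1) using C by simp
    have eq_iff: "widom_factor K w n = 2 * sqrt (Cap (cset K)) * exp (greenR K 1 / 2 + enn2real (PW K))
        \<longleftrightarrow> X = greenR K 1 / 2 + enn2real (PW K)"
      unfolding WX using Cap_pos by simp
    have "X = greenR K 1 / 2 + enn2real (PW K) \<longleftrightarrow> (\<exists>a. -1 \<le> a \<and> a < 1 \<and> K = {a..1})"
    proof
      assume "X = greenR K 1 / 2 + enn2real (PW K)"
      \<comment> \<open>Equality leaves no gap and forces \<open>Sup K = 1\<close>, so K is an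
        interval ending at 1; it is not a single point, because K is infinite.\<close>
      then have none: "gaps K = {}" "b = 1" using strict b_le_1 by force+
      define a where "a = Inf K"
      have ne: "K \<noteq> {}" and bdd: "bdd_below K"
        using infinite_K compact by (auto intro: bounded_imp_bdd_below compact_imp_bounded)
      have aK: "a \<in> K" unfolding a_def by (rule closed_contains_Inf[OF ne bdd closed_K])
      have low: "a \<le> t" if "t \<in> K" for t unfolding a_def by (rule cInf_lower[OF that bdd])
      have "x \<in> K" if "a \<le> x" "x \<le> 1" for x
        using mem_gaps[OF closed_K _ aK b_mem, of x] that none aK b_mem by (cases "x = a"; cases "x = 1") auto
      then have K: "K = {a..1}" using low K_subset by force
      moreover have "a < 1" using infinite_K K aK K_subset by (cases "a = 1") auto
      ultimately show "\<exists>a. -1 \<le> a \<and> a < 1 \<and> K = {a..1}" using aK K_subset by auto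
    next
      assume "\<exists>a. -1 \<le> a \<and> a < 1 \<and> K = {a..1}"
      then obtain a where a: "a < 1" "K = {a..1}" by blast
      have "gaps K = {}"
      proof (rule ccontr)
        assume "gaps K \<noteq> {}"
        then obtain I where "I \<in> gaps K" by blast
        then obtain \<alpha> \<beta> where g: "\<alpha> \<in> K" "\<beta> \<in> K" "\<alpha> < \<beta>" "{\<alpha><..<\<beta>} \<inter> K = {}"
          using gaps_cases[OF closed_K] by metis
        have "(\<alpha> + \<beta>) / 2 \<in> {\<alpha><..<\<beta>} \<inter> K" using g(1-3) unfolding a(2) by auto
        then show False using g(4) by blast
      qed
      \<comment> \<open>For K = [a, 1] the Parreau-Widom sum is empty and the Green function
        vanishes at 1, so the upper bound coincides with the lower bound, which gives
        \<open>0 \<le> X\<close>.\<close>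
      then have "PW K = 0" by (simp add: PW_def nn_integral_count_space_finite)
      moreover have "greenR K 1 = 0" using g_K[of 1] greenR_eq[of 1] a by simp
      moreover have "0 \<le> X"
      proof -
        have "2 * sqrt (Cap (cset K)) * 1 \<le> 2 * sqrt (Cap (cset K)) * exp X" using ge unfolding WX by simp
        then have "1 \<le> exp X" using Cap_pos by (subst (asm) mult_le_cancel_left_pos) auto
        then show ?thesis by simp
      qed
      ultimately show "X = greenR K 1 / 2 + enn2real (PW K)" using X(2) by simp
    qed
    moreover have "widom_factor K w n \<le> 2 * sqrt (Cap (cset K)) * exp (greenR K 1 / 2 + enn2real (PW K))"
      unfolding WX using X(2) Cap_pos by (intro mult_left_mono) auto
    ultimately show ?thesis using eq_iff by blast
  qed
  ultimately show ?thesis by blast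
qed

end
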